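(* Let $n\ge 2$ be an integer and let $d$ be a nonzero complex number with $|d|\neq 1$. If for some $m\in\mathbb{N}$ the quotient $M_d^n/\mathbb{Z}_m$ admits an effective action of the unitary group $\mathrm{U}_n$ by holomorphic transformations, then $(n,m)=1$, that is, $n$ and $m$ are coprime. Further, for every $m\in\mathbb{N}$ and every effective transitive action of $\mathrm{U}_n$ on $M_d^n/\mathbb{Z}_m$ by holomorphic transformations, there exist $p,q,r\in\mathbb{Z}$ with $r\neq 0$ and $C\in \mathrm{GL}_n(\mathbb{C})$ such that the action has either the form $$A\{[z]\}=\left\{\left[e^{i\left(1+(p+\frac{q}{m})n\right)t}\,d^{\frac{nrt}{2\pi}}\,CBC^{-1}z\right]\right\}$$ or the form $$A\{[z]\}=\left\{\left[e^{i\left(-1+(p+\frac{q}{m})n\right)t}\,d^{\frac{nrt}{2\pi}}\,C\overline{B}C^{-1}z\right]\right\}$$ for all $z\in\mathbb{C}^n\setminus\{0\}$ and all $A\in\mathrm{U}_n$, where $A$ is represented as $A=e^{it}\cdot B$ with $t\in\mathbb{R}$ and $B\in\mathrm{SU}_n$.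
   Context: For a nonzero complex number $d$ with $|d|\neq 1$, the $n$-dimensional Hopf manifold $M_d^n$ is the compact complex manifold obtained from $\mathbb{C}^n\setminus\{0\}$ by identifying every point $z$ with $d\cdot z$ (hence with $d^k\cdot z$ for all $k\in\mathbb{Z}$); $[z]\in M_d^n$ denotes the equivalence class of $z\in\mathbb{C}^n\setminus\{0\}$. For $m\in\mathbb{N}$ (positive integers), $M_d^n/\mathbb{Z}_m$ denotes the compact complex manifold obtained from $M_d^n$ by identifying $[z]$ with $[e^{\frac{2\pi i}{m}}z]$ (hence with each $[e^{\frac{2\pi i K}{m}}z]$, $K=0,\dots,m-1$); $\{[z]\}\in M_d^n/\mathbb{Z}_m$ denotes the equivalence class of $[z]$. For $\mu\in\mathbb{R}$ set $d^{\mu}:=|d|^{\mu}e^{i\mu\arg d}$, where $\arg$ takes values in $[0,2\pi)$. $\overline{B}$ denotes the entrywise complex conjugate of the matrix $B$. The representation $A=e^{it}\cdot B$ is not unique; the right-hand sides of the formulas do not depend on the choice of representation. An action of $\mathrm{U}_n$ on a complex manifold $X$ by holomorphic transformations is a (left) action such that each group element acts by a biholomorphic map of $X$ and the action map $\mathrm{U}_n\times X\to X$ is continuous. It is effective if only the identity element acts trivially. *)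

theory Defs
  imports "HOL-Analysis.Analysis" "HOL-Algebra.Group_Action"
begin

definition adjoint_matrix :: "complex^'n^'n \<Rightarrow> complex^'n^'n" where
  "adjoint_matrix A = map_matrix cnj (transpose A)"

definition unitary_matrices :: "(complex^'n^'n) set" where
  "unitary_matrices = {A. A ** adjoint_matrix A = mat 1 \<and> adjoint_matrix A ** A = mat 1}"

definition special_unitary_matrices :: "(complex^'n^'n) set" where
  "special_unitary_matrices = {A \<in> unitary_matrices. det A = 1}"

definition unitary_group :: "(complex^'n^'n) monoid" where
  "unitary_group = \<lparr>carrier = unitary_matrices, mult = (**), one = mat 1\<rparr>"

text \<open>Holomorphy in several variables: the real Frechet derivative exists at each point of the
  open set and is linear over the complex numbers.\<close>

definition holomorphic_vec_on :: "(complex^'n \<Rightarrow> complex^'k) \<Rightarrow> (complex^'n) set \<Rightarrow> bool" where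
  "holomorphic_vec_on f S \<longleftrightarrow>
     open S \<and> (\<forall>z\<in>S. \<exists>L. (f has_derivative L) (at z) \<and> Vector_Spaces.linear (*s) (*s) L)"

text \<open>A chart is a pair of its domain and the coordinate map; the values of the coordinate map
  outside the domain are irrelevant.\<close>

type_synonym ('a, 'n) charts = "('a set \<times> ('a \<Rightarrow> complex^'n)) set"

definition complex_atlas :: "'a topology \<Rightarrow> ('a, 'n::finite) charts \<Rightarrow> bool" where
  "complex_atlas T \<A> \<longleftrightarrow>
     (\<forall>(U, \<phi>)\<in>\<A>. openin T U \<and> open (\<phi> ` U) \<and>
        homeomorphic_map (subtopology T U) (top_of_set (\<phi> ` U)) \<phi>) \<and>
     (\<Union>(U, \<phi>)\<in>\<A>. U) = topspace T \<and>
     (\<forall>(U, \<phi>)\<in>\<A>. \<forall>(V, \<psi>)\<in>\<A>.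
        holomorphic_vec_on (\<lambda>z. \<psi> (inv_into U \<phi> z)) (\<phi> ` (U \<inter> V)))"

definition complex_manifold :: "'a topology \<Rightarrow> ('a, 'n::finite) charts \<Rightarrow> bool" where
  "complex_manifold T \<A> \<longleftrightarrow> Hausdorff_space T \<and> second_countable T \<and> complex_atlas T \<A>"

definition holomorphic_map ::
    "'a topology \<Rightarrow> ('a, 'n::finite) charts \<Rightarrow> 'b topology \<Rightarrow> ('b, 'k::finite) charts \<Rightarrow>
     ('a \<Rightarrow> 'b) \<Rightarrow> bool" where
  "holomorphic_map S \<A> T \<B> f \<longleftrightarrow>
     continuous_map S T f \<and>
     (\<forall>(U, \<phi>)\<in>\<A>. \<forall>(V, \<psi>)\<in>\<B>.
        holomorphic_vec_on (\<lambda>z. \<psi> (f (inv_into U \<phi> z))) (\<phi> ` {x \<in> U. f x \<in> V}))"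

definition biholomorphic_self_map ::
    "'a topology \<Rightarrow> ('a, 'n::finite) charts \<Rightarrow> ('a \<Rightarrow> 'a) \<Rightarrow> bool" where
  "biholomorphic_self_map T \<A> f \<longleftrightarrow>
     bij_betw f (topspace T) (topspace T) \<and>
     holomorphic_map T \<A> T \<A> f \<and>
     holomorphic_map T \<A> T \<A> (inv_into (topspace T) f)"

text \<open>Library group actions are homomorphisms into \<^const>\<open>BijGroup\<close>, whose elements are
  \<^const>\<open>undefined\<close> outside the space; this only normalises irrelevant values.\<close>

definition holomorphic_unitary_action ::
    "'a topology \<Rightarrow> ('a, 'n::finite) charts \<Rightarrow> (complex^'n^'n \<Rightarrow> 'a \<Rightarrow> 'a) \<Rightarrow> bool" where
  "holomorphic_unitary_action T \<A> act \<longleftrightarrow>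
     group_action unitary_group (topspace T) act \<and>
     (\<forall>A\<in>unitary_matrices. biholomorphic_self_map T \<A> (act A)) \<and>
     continuous_map (prod_topology (top_of_set unitary_matrices) T) T (\<lambda>(A, x). act A x)"

definition effective_action :: "('g, 'b) monoid_scheme \<Rightarrow> 'a set \<Rightarrow> ('g \<Rightarrow> 'a \<Rightarrow> 'a) \<Rightarrow> bool" where
  "effective_action G X act \<longleftrightarrow>
     (\<forall>g\<in>carrier G. (\<forall>x\<in>X. act g x = x) \<longrightarrow> g = \<one>\<^bsub>G\<^esub>)"

definition hopf_rel :: "complex \<Rightarrow> (complex^'n) rel" where
  "hopf_rel d = {(z, w). z \<noteq> 0 \<and> w \<noteq> 0 \<and> (\<exists>k::int. w = (d powi k) *s z)}"

definition hopf_manifold :: "complex \<Rightarrow> (complex^'n) set set" where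
  "hopf_manifold d = (- {0}) // hopf_rel d"

definition hopf_class :: "complex \<Rightarrow> complex^'n \<Rightarrow> (complex^'n) set" where
  "hopf_class d z = hopf_rel d `` {z}"

definition cyclic_rel :: "complex \<Rightarrow> nat \<Rightarrow> ((complex^'n) set) rel" where
  "cyclic_rel d m =
     {(hopf_class d z, hopf_class d (cis (2 * pi * real K / real m) *s z)) | z K. z \<noteq> 0 \<and> K < m}"

definition hopf_quotient :: "complex \<Rightarrow> nat \<Rightarrow> (complex^'n) set set set" where
  "hopf_quotient d m = hopf_manifold d // cyclic_rel d m"

definition hopf_quotient_class :: "complex \<Rightarrow> nat \<Rightarrow> complex^'n \<Rightarrow> (complex^'n) set set" where
  "hopf_quotient_class d m z = cyclic_rel d m `` {hopf_class d z}"

text \<open>The quotient topology, taken in one step from the punctured space. The complex structure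
  is the one making the projection locally biholomorphic: the charts are the local inverses of
  the projection.\<close>

definition hopf_quotient_topology :: "complex \<Rightarrow> nat \<Rightarrow> (complex^'n) set set topology" where
  "hopf_quotient_topology d m =
     topology (\<lambda>U. U \<subseteq> hopf_quotient d m \<and>
       openin (top_of_set (- {0})) {z \<in> - {0}. hopf_quotient_class d m z \<in> U})"

definition hopf_quotient_charts :: "complex \<Rightarrow> nat \<Rightarrow> ((complex^'n) set set, 'n::finite) charts" where
  "hopf_quotient_charts d m =
     {(hopf_quotient_class d m ` V, inv_into V (hopf_quotient_class d m)) | V.
        open V \<and> 0 \<notin> V \<and> inj_on (hopf_quotient_class d m) V}"

text \<open>The power with the branch of the argument in the half-open interval from 0 to \<open>2 * pi\<close>.\<close>

definition hopf_power :: "complex \<Rightarrow> real \<Rightarrow> complex" where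
  "hopf_power d \<mu> = of_real (norm d powr \<mu>) * cis (\<mu> * Arg2pi d)"

lemma adjoint_matrix_mult: "adjoint_matrix (A ** B) = adjoint_matrix B ** adjoint_matrix A"
  by (simp add: adjoint_matrix_def vec_eq_iff matrix_matrix_mult_def transpose_def mult.commute)

lemma adjoint_adjoint_matrix [simp]: "adjoint_matrix (adjoint_matrix A) = A"
  by (simp add: adjoint_matrix_def vec_eq_iff transpose_def)

lemma adjoint_matrix_one [simp]: "adjoint_matrix (mat 1) = mat 1"
  by (simp add: adjoint_matrix_def vec_eq_iff transpose_def mat_def)

lemma unitary_matrices_mult: "A \<in> unitary_matrices \<Longrightarrow> B \<in> unitary_matrices \<Longrightarrow> A ** B \<in> unitary_matrices"
  unfolding unitary_matrices_def mem_Collect_eq adjoint_matrix_mult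
  by (metis matrix_mul_assoc matrix_mul_rid)

lemma group_unitary_group: "group unitary_group"
proof (rule groupI)
  fix x :: "complex^'a^'a" assume "x \<in> carrier unitary_group"
  then show "\<exists>y\<in>carrier unitary_group. y \<otimes>\<^bsub>unitary_group\<^esub> x = \<one>\<^bsub>unitary_group\<^esub>"
    by (intro bexI[of _ "adjoint_matrix x"]) (auto simp: unitary_group_def unitary_matrices_def)
qed (auto simp: unitary_group_def unitary_matrices_mult matrix_mul_assoc, simp add: unitary_matrices_def)

lemma norm_cvec_scale: "norm (c *s (x::complex^'n)) = norm c * norm x"
  by (simp add: norm_vec_def L2_set_def norm_mult power_mult_distrib real_sqrt_mult flip: sum_distrib_left)

lemma bounded_linear_cvec_scale: "bounded_linear (\<lambda>x::complex^'n. c *s x)"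
  by (rule bounded_linear_intro[of _ "norm c"])
     (auto simp: norm_cvec_scale vector_add_ldistrib mult.commute vec_eq_iff)

lemma cvec_scale_eq_0: "c *s (x::complex^'n) = 0 \<longleftrightarrow> c = 0 \<or> x = 0"
  by (metis norm_cvec_scale mult_eq_0_iff norm_eq_zero)

lemma open_cvec_scale:
  assumes "open (V::(complex^'n) set)" "c \<noteq> 0" shows "open ((\<lambda>x. c *s x) ` V)"
proof -
  have "(\<lambda>x. c *s x) ` V = (\<lambda>x. inverse c *s x) -` V"
  proof (intro Set.set_eqI iffI)
    fix x assume "x \<in> (\<lambda>x. inverse c *s x) -` V"
    then show "x \<in> (\<lambda>x. c *s x) ` V"
      by (intro image_eqI[of _ _ "inverse c *s x"]) (use assms(2) in \<open>auto simp: vector_smult_assoc\<close>)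
  qed (use assms(2) in \<open>auto simp: vector_smult_assoc\<close>)
  moreover have "open ((\<lambda>x. inverse c *s x) -` V)"
    by (intro open_vimage assms linear_continuous_on bounded_linear_cvec_scale)
  ultimately show ?thesis by simp
qed

text \<open>The scalars relating points of the punctured space that have the same class in the iterated
  quotient.\<close>

definition hopf_deck :: "complex \<Rightarrow> nat \<Rightarrow> complex set" where
  "hopf_deck d m = {d powi k * cis (2 * pi * real_of_int K / real m) | k K. True}"

context
  fixes d :: complex and m :: nat
  assumes d0: "d \<noteq> 0" and m0: "m > 0"
begin

lemma deck_nz: "c \<in> hopf_deck d m \<Longrightarrow> c \<noteq> 0"
  using d0 by (auto simp: hopf_deck_def)

lemma deck_one: "1 \<in> hopf_deck d m"
  unfolding hopf_deck_def by (rule CollectI, rule exI[of _ 0], rule exI[of _ 0]) auto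

lemma deck_mult: "c \<in> hopf_deck d m \<Longrightarrow> c' \<in> hopf_deck d m \<Longrightarrow> c * c' \<in> hopf_deck d m"
proof -
  assume "c \<in> hopf_deck d m" "c' \<in> hopf_deck d m"
  then obtain k K k' K' where "c = d powi k * cis (2 * pi * real_of_int K / real m)"
    "c' = d powi k' * cis (2 * pi * real_of_int K' / real m)" by (auto simp: hopf_deck_def)
  then have "c * c' = d powi (k + k') * cis (2 * pi * real_of_int (K + K') / real m)"
    using d0 by (simp add: power_int_add cis_mult[symmetric] ring_distribs add_divide_distrib)
  then show ?thesis unfolding hopf_deck_def by blast
qed

lemma deck_inverse: "c \<in> hopf_deck d m \<Longrightarrow> inverse c \<in> hopf_deck d m"
proof -
  assume "c \<in> hopf_deck d m"
  then obtain k K where "c = d powi k * cis (2 * pi * real_of_int K / real m)"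
    by (auto simp: hopf_deck_def)
  then have "inverse c = d powi (- k) * cis (2 * pi * real_of_int (- K) / real m)"
    by (simp add: power_int_minus cis_inverse[symmetric] del: cis_inverse)
       
  then show ?thesis unfolding hopf_deck_def by blast
qed

lemma hopf_class_eq:
  fixes z w :: "complex^'n"
  assumes "z \<noteq> 0" "w \<noteq> 0"
  shows "hopf_class d z = hopf_class d w \<longleftrightarrow> (\<exists>k::int. w = (d powi k) *s z)"
proof -
  have "equiv (-{0}) (hopf_rel d :: (complex^'n) rel)"
  proof (rule equivI)
    show "refl_on (- {0}) (hopf_rel d :: (complex^'n) rel)"
      by (auto simp: refl_on_def hopf_rel_def intro!: exI[of _ 0])
    show "sym (hopf_rel d :: (complex^'n) rel)"
    proof (rule symI)
      fix x y :: "complex^'n" assume "(x, y) \<in> hopf_rel d"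
      then obtain k::int where "x \<noteq> 0" "y \<noteq> 0" "y = (d powi k) *s x" by (auto simp: hopf_rel_def)
      moreover from this have "x = (d powi (- k)) *s y"
        using d0 by (simp add: vector_smult_assoc power_int_minus)
      ultimately show "(y, x) \<in> hopf_rel d" unfolding hopf_rel_def by blast
    qed
    show "trans (hopf_rel d :: (complex^'n) rel)"
    proof (rule transI)
      fix x y v :: "complex^'n" assume "(x, y) \<in> hopf_rel d" "(y, v) \<in> hopf_rel d"
      then obtain k l::int where "x \<noteq> 0" "v \<noteq> 0" "y = (d powi k) *s x" "v = (d powi l) *s y"
        by (auto simp: hopf_rel_def)
      moreover from this have "v = (d powi (l + k)) *s x"
        using d0 by (simp add: vector_smult_assoc power_int_add)
      ultimately show "(x, v) \<in> hopf_rel d" unfolding hopf_rel_def by blast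
    qed
  qed (auto simp: hopf_rel_def)
  from eq_equiv_class_iff[OF this, of z w] assms show ?thesis
    by (auto simp: hopf_class_def hopf_rel_def)
qed

lemma deckE:
  assumes "c \<in> hopf_deck d m"
  obtains k :: int and K :: nat where "K < m" "c = d powi k * cis (2 * pi * real K / real m)"
proof -
  obtain k K where c: "c = d powi k * cis (2 * pi * real_of_int K / real m)"
    using assms by (auto simp: hopf_deck_def)
  define K' where "K' = nat (K mod int m)"
  have K': "int K' = K mod int m" "K' < m" using m0 by (auto simp: K'_def nat_less_iff)
  have "real_of_int K = real K' + real m * real_of_int (K div int m)"
    using mod_mult_div_eq[of K "int m"] K'(1) by (metis of_int_add of_int_mult of_int_of_nat_eq)
  then have "2 * pi * real_of_int K / real m
      = 2 * pi * real K' / real m + 2 * pi * real_of_int (K div int m)"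
    using m0 by (simp add: field_simps)
  then have "cis (2 * pi * real_of_int K / real m) = cis (2 * pi * real K' / real m)"
    by (simp add: cis_mult[symmetric] cis_multiple_2pi)
  with c K' that show ?thesis by metis
qed

lemma cyclic_rel_iff:
  fixes z w :: "complex^'n"
  assumes "z \<noteq> 0" "w \<noteq> 0"
  shows "(hopf_class d z, hopf_class d w) \<in> cyclic_rel d m \<longleftrightarrow> (\<exists>c\<in>hopf_deck d m. w = c *s z)"
proof
  assume "(hopf_class d z, hopf_class d w) \<in> cyclic_rel d m"
  then obtain y :: "complex^'n" and K where y: "y \<noteq> 0" "K < m" "hopf_class d z = hopf_class d y"
    "hopf_class d w = hopf_class d (cis (2 * pi * real K / real m) *s y)"
    by (auto simp: cyclic_rel_def)
  obtain k :: int where k: "y = (d powi k) *s z" using y hopf_class_eq[of z y] assms by auto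
  have "cis (2 * pi * real K / real m) *s y \<noteq> 0" using y by (simp add: cvec_scale_eq_0)
  with y(4) obtain l :: int where l: "w = (d powi l) *s (cis (2 * pi * real K / real m) *s y)"
    using hopf_class_eq[of "cis (2 * pi * real K / real m) *s y" w] assms by metis
  have "w = (d powi (l + k) * cis (2 * pi * real_of_int (int K) / real m)) *s z"
    unfolding l k using d0 by (simp add: vector_smult_assoc power_int_add mult_ac)
  then show "\<exists>c\<in>hopf_deck d m. w = c *s z" unfolding hopf_deck_def by blast
next
  assume "\<exists>c\<in>hopf_deck d m. w = c *s z"
  then obtain k :: int and K :: nat
    where K: "K < m" "w = (d powi k * cis (2 * pi * real K / real m)) *s z"
    by (metis deckE)
  have "hopf_class d (cis (2 * pi * real K / real m) *s z) = hopf_class d w"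
    using K assms by (subst hopf_class_eq) (auto simp: cvec_scale_eq_0 vector_smult_assoc)
  then show "(hopf_class d z, hopf_class d w) \<in> cyclic_rel d m"
    unfolding cyclic_rel_def using K assms by blast
qed

lemma hopf_manifold_image: "hopf_manifold d = hopf_class d ` (- {0})"
  by (auto simp: hopf_manifold_def hopf_class_def quotient_def)

lemma equiv_cyclic_rel: "equiv (hopf_manifold d) (cyclic_rel d m :: ((complex^'n) set) rel)"
proof (rule equivI)
  show sub: "cyclic_rel d m \<subseteq> hopf_manifold d \<times> (hopf_manifold d :: ((complex^'n) set) set)"
    by (auto simp: cyclic_rel_def hopf_manifold_image cvec_scale_eq_0)
  show "refl_on (hopf_manifold d) (cyclic_rel d m :: ((complex^'n) set) rel)"
    using deck_one by (force simp: refl_on_def hopf_manifold_image cyclic_rel_iff)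
  show "sym (cyclic_rel d m :: ((complex^'n) set) rel)"
  proof (rule symI)
    fix a b :: "(complex^'n) set" assume ab: "(a, b) \<in> cyclic_rel d m"
    then obtain x y where xy: "a = hopf_class d x" "x \<noteq> 0" "b = hopf_class d y" "y \<noteq> 0"
      using sub unfolding hopf_manifold_image by fast
    with ab obtain c where "c \<in> hopf_deck d m" "y = c *s x" by (auto simp: cyclic_rel_iff)
    then have "x = inverse c *s y" "inverse c \<in> hopf_deck d m"
      using deck_nz deck_inverse by (auto simp: vector_smult_assoc)
    then show "(b, a) \<in> cyclic_rel d m" using xy by (auto simp: cyclic_rel_iff)
  qed
  show "trans (cyclic_rel d m :: ((complex^'n) set) rel)"
  proof (rule transI)
    fix a b e :: "(complex^'n) set" assume ab: "(a, b) \<in> cyclic_rel d m" and be: "(b, e) \<in> cyclic_rel d m"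
    then obtain x y v where xy: "a = hopf_class d x" "x \<noteq> 0" "b = hopf_class d y" "y \<noteq> 0"
        "e = hopf_class d v" "v \<noteq> 0"
      using sub unfolding hopf_manifold_image by (smt (verit) ComplD imageE mem_Sigma_iff singletonI subsetD)
    with ab be obtain c c' where "c \<in> hopf_deck d m" "y = c *s x" "c' \<in> hopf_deck d m" "v = c' *s y"
      by (auto simp: cyclic_rel_iff)
    then have "v = (c' * c) *s x" "c' * c \<in> hopf_deck d m"
      using deck_mult by (auto simp: vector_smult_assoc)
    then show "(a, e) \<in> cyclic_rel d m" using xy by (auto simp: cyclic_rel_iff)
  qed
qed

lemma hopf_quotient_class_eq_iff:
  fixes z w :: "complex^'n"
  assumes "z \<noteq> 0" "w \<noteq> 0"
  shows "hopf_quotient_class d m z = hopf_quotient_class d m w \<longleftrightarrow> (\<exists>c\<in>hopf_deck d m. w = c *s z)"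
  using eq_equiv_class_iff[OF equiv_cyclic_rel, of "hopf_class d z" "hopf_class d w"] assms
  by (auto simp: hopf_quotient_class_def hopf_manifold_image cyclic_rel_iff)

end

lemma hopf_quotient_image: "hopf_quotient d m = hopf_quotient_class d m ` (- {0})"
  by (auto simp: hopf_quotient_def hopf_manifold_def hopf_class_def hopf_quotient_class_def quotient_def)

lemma openin_hopf_quotient:
  "openin (hopf_quotient_topology d m) U \<longleftrightarrow>
     U \<subseteq> hopf_quotient d m \<and> open {z \<in> - {0}. hopf_quotient_class d m z \<in> U}"
proof -
  have o: "openin (top_of_set (- {0::complex^'n})) {z \<in> - {0}. P z} \<longleftrightarrow> open {z \<in> - {0}. P z}" for P
    by (subst openin_open_eq) auto
  have "istopology (\<lambda>U. U \<subseteq> hopf_quotient d m \<and>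
       open {z::complex^'n. z \<in> - {0} \<and> hopf_quotient_class d m z \<in> U})"
    unfolding istopology_def
  proof (intro conjI allI impI)
    fix S T :: "(complex^'n) set set set"
    assume "S \<subseteq> hopf_quotient d m \<and> open {z. z \<in> - {0} \<and> hopf_quotient_class d m z \<in> S}"
      "T \<subseteq> hopf_quotient d m \<and> open {z. z \<in> - {0} \<and> hopf_quotient_class d m z \<in> T}"
    moreover have "{z. z \<in> - {0} \<and> hopf_quotient_class d m z \<in> S \<inter> T} =
      {z. z \<in> - {0} \<and> hopf_quotient_class d m z \<in> S} \<inter> {z. z \<in> - {0} \<and> hopf_quotient_class d m z \<in> T}"
      by auto
    ultimately show "open {z. z \<in> - {0} \<and> hopf_quotient_class d m z \<in> S \<inter> T}"
      by (metis (no_types, lifting) open_Int)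
  next
    fix \<K> :: "(complex^'n) set set set set"
    assume *: "\<forall>K\<in>\<K>. K \<subseteq> hopf_quotient d m \<and> open {z. z \<in> - {0} \<and> hopf_quotient_class d m z \<in> K}"
    have "{z. z \<in> - {0} \<and> hopf_quotient_class d m z \<in> \<Union> \<K>} =
      (\<Union>K\<in>\<K>. {z. z \<in> - {0} \<and> hopf_quotient_class d m z \<in> K})" by auto
    then show "open {z. z \<in> - {0} \<and> hopf_quotient_class d m z \<in> \<Union> \<K>}"
      using * by auto
  qed auto
  then show ?thesis unfolding hopf_quotient_topology_def o by (subst topology_inverse') simp_all
qed

lemma topspace_hopf_quotient [simp]:
  "topspace (hopf_quotient_topology d m) = (hopf_quotient d m :: (complex^'n) set set set)"
proof -
  have "{z::complex^'n. z \<in> - {0} \<and> hopf_quotient_class d m z \<in> hopf_quotient d m} = - {0}"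
    by (auto simp: hopf_quotient_image)
  then have "openin (hopf_quotient_topology d m) (hopf_quotient d m :: (complex^'n) set set set)"
    unfolding openin_hopf_quotient by (simp only: open_Compl closed_singleton subset_refl simp_thms)
  moreover have "topspace (hopf_quotient_topology d m) \<subseteq> (hopf_quotient d m :: (complex^'n) set set set)"
    using openin_topspace[of "hopf_quotient_topology d m"] unfolding openin_hopf_quotient by (rule conjunct1)
  ultimately show ?thesis by (intro subset_antisym openin_subset)
qed

lemma quotient_map_hopf_quotient_class:
  "quotient_map (top_of_set (- {0})) (hopf_quotient_topology d m) (hopf_quotient_class d m)"
proof -
  have o: "openin (top_of_set (- {0::complex^'n})) {z. z \<in> - {0} \<and> P z} \<longleftrightarrow> open {z. z \<in> - {0} \<and> P z}" for P
    by (subst openin_open_eq) auto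
  show ?thesis
    unfolding quotient_map_def openin_hopf_quotient topspace_hopf_quotient topspace_euclidean_subtopology o
    by (auto simp: hopf_quotient_image)
qed

context
  fixes d :: complex and m :: nat
  assumes d0: "d \<noteq> 0" and m0: "m > 0" and d1: "norm d \<noteq> 1"
begin

lemma finite_deck_annulus:
  assumes "a > 0" shows "finite {c \<in> hopf_deck d m. a \<le> norm c \<and> norm c \<le> b}"
proof -
  define M where "M = max \<bar>ln a\<bar> \<bar>ln b\<bar> / \<bar>ln (norm d)\<bar>"
  have ld: "\<bar>ln (norm d)\<bar> > 0" using d0 d1 by simp
  have "{c \<in> hopf_deck d m. a \<le> norm c \<and> norm c \<le> b} \<subseteq>
    (\<lambda>(k, K). d powi k * cis (2 * pi * real K / real m)) ` ({-\<lceil>M\<rceil>..\<lceil>M\<rceil>} \<times> {..<m})"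
  proof clarify
    fix c assume c: "c \<in> hopf_deck d m" "a \<le> norm c" "norm c \<le> b"
    obtain k K where kK: "K < m" "c = d powi k * cis (2 * pi * real K / real m)"
      using deckE[OF d0 m0 c(1)] .
    have n: "norm c = norm d powi k" by (simp add: kK norm_mult norm_power_int)
    have "ln (norm c) = real_of_int k * ln (norm d)"
      unfolding n using d0 by (simp add: powr_real_of_int'[symmetric] ln_powr)
    moreover have "ln a \<le> ln (norm c)" "ln (norm c) \<le> ln b"
      using c assms by (smt (verit) ln_le_cancel_iff)+
    ultimately have "\<bar>real_of_int k\<bar> * \<bar>ln (norm d)\<bar> \<le> max \<bar>ln a\<bar> \<bar>ln b\<bar>"
      by (simp flip: abs_mult)
    then have "\<bar>real_of_int k\<bar> \<le> M" unfolding M_def using ld by (simp add: pos_le_divide_eq)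
    then have "k \<in> {-\<lceil>M\<rceil>..\<lceil>M\<rceil>}" by simp linarith
    then show "c \<in> (\<lambda>(k, K). d powi k * cis (2 * pi * real K / real m)) ` ({-\<lceil>M\<rceil>..\<lceil>M\<rceil>} \<times> {..<m})"
      using kK by (intro image_eqI[of _ _ "(k, K)"]) auto
  qed
  then show ?thesis by (rule finite_subset) auto
qed

lemma deck_separation:
  fixes z w :: "complex^'n"
  assumes "z \<noteq> 0" "w \<noteq> 0"
  obtains r where "r > 0" "r < norm z" "r < norm w"
    "\<And>z' w' c. z' \<in> ball z r \<Longrightarrow> w' \<in> ball w r \<Longrightarrow> c \<in> hopf_deck d m \<Longrightarrow> w' = c *s z' \<Longrightarrow> w = c *s z"
proof -
  define a where "a = (norm w / 2) / (3 * norm z / 2)"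
  define b where "b = (3 * norm w / 2) / (norm z / 2)"
  have ab: "a > 0" "b > 0" using assms by (auto simp: a_def b_def)
  define F where "F = {c \<in> hopf_deck d m. a \<le> norm c \<and> norm c \<le> b}"
  have F: "finite F" unfolding F_def by (rule finite_deck_annulus[OF ab(1)])
  define \<delta> where "\<delta> = Min (insert 1 ((\<lambda>c. norm (c *s z - w)) ` {c \<in> F. c *s z \<noteq> w}))"
  have \<delta>: "\<delta> > 0" unfolding \<delta>_def using F by (subst Min_gr_iff) auto
  define r where "r = min (norm z / 2) (min (norm w / 2) (\<delta> / (b + 1)))"
  have r: "r \<le> norm z / 2" "r \<le> norm w / 2" "r \<le> \<delta> / (b + 1)" "r > 0"
    unfolding r_def using assms \<delta> ab by (auto simp: min_le_iff_disj simp del: le_divide_eq_numeral1)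
  show ?thesis
  proof (rule that[of r])
    fix z' w' :: "complex^'n" and c
    assume z': "z' \<in> ball z r" and w': "w' \<in> ball w r" and c: "c \<in> hopf_deck d m" and e: "w' = c *s z'"
    have dz: "norm (z - z') < r" "norm (w - w') < r" using z' w' by (auto simp: dist_norm)
    have nz: "norm z / 2 \<le> norm z'" "norm z' \<le> 3 * norm z / 2"
      using dz r norm_triangle_ineq2[of z z'] norm_triangle_ineq3[of z z'] by linarith+
    have nw: "norm w / 2 \<le> norm w'" "norm w' \<le> 3 * norm w / 2"
      using dz r norm_triangle_ineq2[of w w'] norm_triangle_ineq3[of w w'] by linarith+
    have z'0: "norm z' > 0" "norm z > 0" "norm w > 0" using nz assms by (auto intro: less_le_trans[OF _ nz(1)])
    have nc: "norm c = norm w' / norm z'" using z'0 by (simp add: e norm_cvec_scale)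
    have "a \<le> norm c" unfolding a_def nc using nz nw z'0 by (intro frac_le) auto
    moreover have "norm c \<le> b" unfolding b_def nc using nz nw z'0 by (intro frac_le) auto
    ultimately have cF: "c \<in> F" "norm c \<le> b" using c by (auto simp: F_def)
    have "c *s z - w = c *s (z - z') - (w - w')" by (simp add: e vector_ssub_ldistrib)
    then have "norm (c *s z - w) \<le> norm c * norm (z - z') + norm (w - w')"
      by (metis norm_triangle_ineq4 norm_cvec_scale)
    also have "\<dots> < b * r + r"
    proof -
      have "norm c * norm (z - z') \<le> b * r" using cF dz ab by (intro mult_mono) auto
      then show ?thesis using dz by linarith
    qed
    also have "\<dots> \<le> \<delta>" using r(3) ab by (simp add: field_simps)
    finally have l: "norm (c *s z - w) < \<delta>" .
    show "w = c *s z"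
    proof (rule ccontr)
      assume "w \<noteq> c *s z"
      then have "\<delta> \<le> norm (c *s z - w)" unfolding \<delta>_def using F cF by (intro Min_le) auto
      with l show False by simp
    qed
  qed (use r assms in auto)
qed

lemma hopf_quotient_class_local_inj:
  fixes z :: "complex^'n"
  assumes "z \<noteq> 0" obtains V where "open V" "0 \<notin> V" "z \<in> V" "inj_on (hopf_quotient_class d m) V"
proof -
  obtain r where r: "r > 0" "r < norm z"
    "\<And>z' w' c. z' \<in> ball z r \<Longrightarrow> w' \<in> ball z r \<Longrightarrow> c \<in> hopf_deck d m \<Longrightarrow> w' = c *s z' \<Longrightarrow> z = c *s z"
    using deck_separation[OF assms assms] by metis
  have 0: "0 \<notin> ball z r" using r by (auto simp: dist_norm)
  show ?thesis
  proof (rule that[of "ball z r"])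
    show "inj_on (hopf_quotient_class d m) (ball z r)"
    proof (rule inj_onI)
      fix x y assume xy: "x \<in> ball z r" "y \<in> ball z r" "hopf_quotient_class d m x = hopf_quotient_class d m y"
      moreover from this 0 have "x \<noteq> 0" "y \<noteq> 0" by auto
      ultimately obtain c where c: "c \<in> hopf_deck d m" "y = c *s x"
        using hopf_quotient_class_eq_iff[OF d0 m0] by metis
      have "z = c *s z" using r(3)[OF xy(1,2) c] .
      then have "(c - 1) *s z = 0" by (simp add: vector_sub_rdistrib)
      then have "c - 1 = 0" using assms cvec_scale_eq_0 by blast
      then have "c = 1" by simp
      then show "x = y" using c by simp
    qed
  qed (use r 0 in auto)
qed

lemma openin_hopf_image:
  fixes V :: "(complex^'n) set"
  assumes "open V" "0 \<notin> V" shows "openin (hopf_quotient_topology d m) (hopf_quotient_class d m ` V)"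
proof -
  have "{z \<in> - {0}. hopf_quotient_class d m z \<in> hopf_quotient_class d m ` V} = (\<Union>c\<in>hopf_deck d m. (\<lambda>x. c *s x) ` V)" (is "?L = ?R")
  proof (intro Set.set_eqI iffI)
    fix z assume "z \<in> ?L"
    then obtain x where x: "z \<noteq> 0" "x \<in> V" "hopf_quotient_class d m x = hopf_quotient_class d m z" by auto
    then have "x \<noteq> 0" using assms by auto
    with x obtain c where "c \<in> hopf_deck d m" "z = c *s x"
      using hopf_quotient_class_eq_iff[OF d0 m0] by metis
    with x show "z \<in> ?R" by blast
  next
    fix z assume "z \<in> ?R"
    then obtain c x where x: "c \<in> hopf_deck d m" "z = c *s x" "x \<in> V" by auto
    then have "x \<noteq> 0" "z \<noteq> 0" using assms deck_nz[OF d0 m0] by (auto simp: cvec_scale_eq_0)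
    with x have "hopf_quotient_class d m x = hopf_quotient_class d m z" using hopf_quotient_class_eq_iff[OF d0 m0, of x z] by auto
    with x \<open>z \<noteq> 0\<close> show "z \<in> ?L" by auto
  qed
  moreover have "open ?R" using assms deck_nz[OF d0 m0] by (intro open_UN ballI open_cvec_scale) auto
  ultimately show ?thesis using assms by (auto simp: openin_hopf_quotient hopf_quotient_image)
qed

lemma open_map_hopf_quotient_class:
  "open_map (top_of_set (- {0})) (hopf_quotient_topology d m)
    (hopf_quotient_class d m :: complex^'n \<Rightarrow> (complex^'n) set set)"
proof -
  have "openin (hopf_quotient_topology d m) (hopf_quotient_class d m ` U)" if "openin (top_of_set (- {0})) U" for U :: "(complex^'n) set"
  proof (rule openin_hopf_image)
    show "open U" using that by (subst (asm) openin_open_eq) auto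
    show "0 \<notin> U" using openin_imp_subset[OF that] by auto
  qed
  then show ?thesis by (auto simp: open_map_def)
qed

lemma Hausdorff_hopf_quotient: "Hausdorff_space (hopf_quotient_topology d m :: (complex^'n) set set topology)"
  unfolding Hausdorff_space_def topspace_hopf_quotient
proof (intro allI impI)
  fix x y :: "(complex^'n) set set"
  assume xy: "x \<in> hopf_quotient d m \<and> y \<in> hopf_quotient d m \<and> x \<noteq> y"
  then obtain z w where zw: "x = hopf_quotient_class d m z" "y = hopf_quotient_class d m w" "z \<noteq> 0" "w \<noteq> 0" by (auto simp: hopf_quotient_image)
  obtain r where r: "r > 0" "r < norm z" "r < norm w"
    "\<And>z' w' c. z' \<in> ball z r \<Longrightarrow> w' \<in> ball w r \<Longrightarrow> c \<in> hopf_deck d m \<Longrightarrow> w' = c *s z' \<Longrightarrow> w = c *s z"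
    using deck_separation[OF zw(3,4)] by metis
  have 0: "0 \<notin> ball z r" "0 \<notin> ball w r" using r by (auto simp: dist_norm)
  have "disjnt (hopf_quotient_class d m ` ball z r) (hopf_quotient_class d m ` ball w r)"
  proof (rule ccontr)
    assume "\<not> ?thesis"
    then obtain z' w' where *: "z' \<in> ball z r" "w' \<in> ball w r" "hopf_quotient_class d m z' = hopf_quotient_class d m w'"
      by (fastforce simp: disjnt_def)
    then have "z' \<noteq> 0" "w' \<noteq> 0" using 0 by auto
    with * obtain c where c: "c \<in> hopf_deck d m" "w' = c *s z'"
      using hopf_quotient_class_eq_iff[OF d0 m0] by metis
    have "w = c *s z" using r(4)[OF *(1,2) c] .
    then have "x = y" using zw c hopf_quotient_class_eq_iff[OF d0 m0, of z w] by blast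
    with xy show False by simp
  qed
  then show "\<exists>U V. openin (hopf_quotient_topology d m) U \<and> openin (hopf_quotient_topology d m) V \<and>
      x \<in> U \<and> y \<in> V \<and> disjnt U V"
    using openin_hopf_image[OF open_ball 0(1)] openin_hopf_image[OF open_ball 0(2)] zw r(1)
    by (intro exI[of _ "hopf_quotient_class d m ` ball z r"] exI[of _ "hopf_quotient_class d m ` ball w r"]) auto
qed

lemma second_countable_hopf_quotient:
  "second_countable (hopf_quotient_topology d m :: (complex^'n) set set topology)"
proof (rule second_countable_open_map_image)
  show "open_map (top_of_set (- {0})) (hopf_quotient_topology d m) (hopf_quotient_class d m)" by (rule open_map_hopf_quotient_class)
  show "continuous_map (top_of_set (- {0})) (hopf_quotient_topology d m) (hopf_quotient_class d m)"
    by (rule quotient_imp_continuous_map[OF quotient_map_hopf_quotient_class])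
  show "hopf_quotient_class d m ` topspace (top_of_set (- {0})) = topspace (hopf_quotient_topology d m)"
    by (auto simp: hopf_quotient_image)
  obtain B :: "(complex^'n) set set" where B: "countable B" "topological_basis B"
    using ex_countable_basis by blast
  have "second_countable (euclidean :: (complex^'n) topology)"
    unfolding second_countable_def
  proof (intro exI[of _ B] conjI ballI allI impI)
    fix U and x :: "complex^'n" assume "openin euclidean U \<and> x \<in> U"
    then show "\<exists>V\<in>B. x \<in> V \<and> V \<subseteq> U"
      by (metis topological_basisE[OF B(2)] open_openin)
  qed (use B topological_basis_open[OF B(2)] in auto)
  then show "second_countable (top_of_set (- {0::complex^'n}))"
    by (rule second_countable_subtopology)
qed

lemma compact_space_hopf_quotient: "compact_space (hopf_quotient_topology d m :: (complex^'n) set set topology)"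
proof -
  define \<rho> where "\<rho> = max (norm d) (1 / norm d)"
  have \<rho>: "\<rho> > 1" using d0 d1 by (auto simp: \<rho>_def less_max_iff_disj)
  define A :: "(complex^'n) set" where "A = cball 0 \<rho> - ball 0 1"
  have A0: "A \<subseteq> - {0}" by (auto simp: A_def)
  have "compactin (top_of_set (- {0})) A"
    unfolding compactin_subtopology using A0 by (auto simp: A_def intro: compact_diff)
  then have "compactin (hopf_quotient_topology d m) (hopf_quotient_class d m ` A)"
    by (rule image_compactin) (rule quotient_imp_continuous_map[OF quotient_map_hopf_quotient_class])
  moreover have "hopf_quotient_class d m ` A = hopf_quotient d m"
  proof
    show "hopf_quotient_class d m ` A \<subseteq> hopf_quotient d m" using A0 by (auto simp: hopf_quotient_image)
    show "hopf_quotient d m \<subseteq> hopf_quotient_class d m ` A"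
    proof
      fix x :: "(complex^'n) set set" assume "x \<in> hopf_quotient d m"
      then obtain z where z: "z \<noteq> 0" "x = hopf_quotient_class d m z" by (auto simp: hopf_quotient_image)
      define k :: int where "k = \<lfloor>ln (norm z) / ln \<rho>\<rfloor>"
      define l where "l = (if norm d > 1 then - k else k)"
      have nd: "norm d powi l = \<rho> powr (- real_of_int k)"
      proof (cases "norm d > 1")
        case True
        then have "1 / norm d < 1" by (subst divide_less_eq_1_pos) auto
        with True have "\<rho> = norm d" unfolding \<rho>_def by linarith
        then show ?thesis using True d0 by (simp add: l_def powr_real_of_int' power_int_minus powr_minus)
      next
        case False
        then have "norm d < 1" using d1 by linarith
        moreover from this have "1 < 1 / norm d" using d0 by (subst less_divide_eq_1_pos) auto
        ultimately have "\<rho> = inverse (norm d)" unfolding \<rho>_def by (simp add: inverse_eq_divide)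
        then have "\<rho> powr (- real_of_int k) = norm d powr real_of_int k"
          using d0 by (simp add: powr_minus inverse_powr)
        then show ?thesis using False d0 by (simp add: l_def powr_real_of_int')
      qed
      have n: "norm ((d powi l) *s z) = \<rho> powr (ln (norm z) / ln \<rho> - real_of_int k)"
      proof -
        have "\<rho> powr (ln (norm z) / ln \<rho>) = norm z" using \<rho> z by (simp add: powr_def)
        then show ?thesis
          by (simp add: norm_cvec_scale norm_power_int nd powr_diff powr_minus divide_inverse mult.commute)
      qed
      have "0 \<le> ln (norm z) / ln \<rho> - real_of_int k" "ln (norm z) / ln \<rho> - real_of_int k \<le> 1"
        unfolding k_def by linarith+
      then have "1 \<le> norm ((d powi l) *s z)" "norm ((d powi l) *s z) \<le> \<rho>"
        unfolding n using \<rho> powr_mono[of "ln (norm z) / ln \<rho> - real_of_int k" 1 \<rho>]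
        by (simp_all add: ge_one_powr_ge_zero)
      then have "(d powi l) *s z \<in> A" by (auto simp: A_def)
      moreover have "d powi l \<in> hopf_deck d m" unfolding hopf_deck_def
        by (rule CollectI, rule exI[of _ l], rule exI[of _ 0]) auto
      then have "hopf_quotient_class d m z = hopf_quotient_class d m ((d powi l) *s z)"
        using z d0 hopf_quotient_class_eq_iff[OF d0 m0, of z "(d powi l) *s z"]
        by (auto simp: cvec_scale_eq_0)
      ultimately show "x \<in> hopf_quotient_class d m ` A" using z by auto
    qed
  qed
  ultimately show ?thesis by (simp add: compact_space_def)
qed

lemma complex_atlas_hopf_quotient:
  "complex_atlas (hopf_quotient_topology d m :: (complex^'n) set set topology) (hopf_quotient_charts d m)"
  unfolding complex_atlas_def
proof (intro conjI)
  let ?T = "hopf_quotient_topology d m :: (complex^'n) set set topology"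
  show "\<forall>(U, \<phi>)\<in>hopf_quotient_charts d m. openin ?T U \<and> open (\<phi> ` U) \<and>
        homeomorphic_map (subtopology ?T U) (top_of_set (\<phi> ` U)) \<phi>"
  proof clarify
    fix U and \<phi> :: "(complex^'n) set set \<Rightarrow> complex^'n" assume "(U, \<phi>) \<in> hopf_quotient_charts d m"
    then obtain V where V: "open V" "0 \<notin> V" "inj_on (hopf_quotient_class d m) V" "U = hopf_quotient_class d m ` V" "\<phi> = inv_into V (hopf_quotient_class d m)"
      by (auto simp: hopf_quotient_charts_def)
    have im: "\<phi> ` U = V" using V by (simp add: inv_into_image_cancel)
    have o: "openin ?T U" using V openin_hopf_image by auto
    have "homeomorphic_map (top_of_set V) (subtopology ?T U) (hopf_quotient_class d m)"
    proof (rule bijective_open_imp_homeomorphic_map)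
      have "continuous_map (top_of_set V) ?T (hopf_quotient_class d m)"
        using continuous_map_from_subtopology_mono[OF quotient_imp_continuous_map[OF quotient_map_hopf_quotient_class]] V(2)
        by (metis subset_Compl_singleton)
      then show "continuous_map (top_of_set V) (subtopology ?T U) (hopf_quotient_class d m)"
        using V by (auto simp: continuous_map_in_subtopology)
      have "openin (subtopology ?T U) (hopf_quotient_class d m ` W)" if "openin (top_of_set V) W" for W
      proof -
        have "open W" "W \<subseteq> V"
          using that V(1) openin_open_eq[of V W] by (auto simp: openin_imp_subset)
        then have "openin ?T (hopf_quotient_class d m ` W)" using V(2) by (intro openin_hopf_image) auto
        then show ?thesis using o V \<open>W \<subseteq> V\<close> by (subst openin_open_subtopology) auto
      qed
      then show "open_map (top_of_set V) (subtopology ?T U) (hopf_quotient_class d m)" by (simp add: open_map_def)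
      show "hopf_quotient_class d m ` topspace (top_of_set V) = topspace (subtopology ?T U)"
        using o openin_subset[OF o] V by auto
      show "inj_on (hopf_quotient_class d m) (topspace (top_of_set V))" using V by simp
    qed
    then obtain g where g: "homeomorphic_maps (top_of_set V) (subtopology ?T U) (hopf_quotient_class d m) g"
      by (auto simp: homeomorphic_map_maps)
    then have "homeomorphic_map (subtopology ?T U) (top_of_set V) g"
      using homeomorphic_map_maps homeomorphic_maps_sym by blast
    moreover have "g x = \<phi> x" if "x \<in> topspace (subtopology ?T U)" for x
      using that g V by (auto simp: homeomorphic_maps_def)
    ultimately have "homeomorphic_map (subtopology ?T U) (top_of_set V) \<phi>"
      using homeomorphic_map_eq by blast
    then show "openin ?T U \<and> open (\<phi> ` U) \<and> homeomorphic_map (subtopology ?T U) (top_of_set (\<phi> ` U)) \<phi>"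
      using o V im by auto
  qed
  show "(\<Union>(U, \<phi>)\<in>hopf_quotient_charts d m. U) = topspace ?T"
  proof
    show "topspace ?T \<subseteq> (\<Union>(U, \<phi>)\<in>hopf_quotient_charts d m. U)"
    proof
      fix x assume "x \<in> topspace ?T"
      then obtain z where z: "z \<noteq> 0" "x = hopf_quotient_class d m z" by (auto simp: hopf_quotient_image)
      obtain V where "open V" "0 \<notin> V" "z \<in> V" "inj_on (hopf_quotient_class d m) V" using hopf_quotient_class_local_inj[OF z(1)] .
      then show "x \<in> (\<Union>(U, \<phi>)\<in>hopf_quotient_charts d m. U)"
        using z unfolding hopf_quotient_charts_def
        by (intro UN_I[of "(hopf_quotient_class d m ` V, inv_into V (hopf_quotient_class d m))"]) auto
    qed
  qed (auto simp: hopf_quotient_charts_def hopf_quotient_image)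
  show "\<forall>(U, \<phi>)\<in>hopf_quotient_charts d m. \<forall>(V, \<psi>)\<in>hopf_quotient_charts d m.
        holomorphic_vec_on (\<lambda>z. \<psi> (inv_into U \<phi> z)) (\<phi> ` (U \<inter> V) :: (complex^'n) set)"
  proof clarify
    fix U V and \<phi> \<psi> :: "(complex^'n) set set \<Rightarrow> complex^'n"
    assume "(U, \<phi>) \<in> hopf_quotient_charts d m" "(V, \<psi>) \<in> hopf_quotient_charts d m"
    then obtain P Q where P: "open P" "0 \<notin> P" "inj_on (hopf_quotient_class d m) P" "U = hopf_quotient_class d m ` P" "\<phi> = inv_into P (hopf_quotient_class d m)"
      and Q: "open Q" "0 \<notin> Q" "inj_on (hopf_quotient_class d m) Q" "V = hopf_quotient_class d m ` Q" "\<psi> = inv_into Q (hopf_quotient_class d m)"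
      by (auto simp: hopf_quotient_charts_def)
    have inv: "inv_into U \<phi> z = hopf_quotient_class d m z" if "z \<in> P" for z
    proof -
      have "\<phi> (hopf_quotient_class d m z) = z" using that P by simp
      moreover have "inj_on \<phi> U" using P inj_on_inv_into[of U "hopf_quotient_class d m" P] by simp
      ultimately show ?thesis using that P by (intro inv_into_f_eq) auto
    qed
    have dom: "\<phi> ` (U \<inter> V) = P \<inter> {z \<in> - {0}. hopf_quotient_class d m z \<in> V}"
    proof (intro Set.set_eqI iffI)
      fix z assume "z \<in> \<phi> ` (U \<inter> V)"
      then show "z \<in> P \<inter> {z \<in> - {0}. hopf_quotient_class d m z \<in> V}" using P by auto
    next
      fix z assume "z \<in> P \<inter> {z \<in> - {0}. hopf_quotient_class d m z \<in> V}"
      then show "z \<in> \<phi> ` (U \<inter> V)" using P by (intro image_eqI[of _ _ "hopf_quotient_class d m z"]) auto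
    qed
    have "openin ?T V" using Q openin_hopf_image by auto
    then have od: "open (\<phi> ` (U \<inter> V))" using P(1) unfolding dom by (auto simp: openin_hopf_quotient)
    show "holomorphic_vec_on (\<lambda>z. \<psi> (inv_into U \<phi> z)) (\<phi> ` (U \<inter> V))"
      unfolding holomorphic_vec_on_def
    proof (intro conjI ballI od)
      fix z assume z: "z \<in> \<phi> ` (U \<inter> V)"
      then have zP: "z \<in> P" "z \<noteq> 0" "hopf_quotient_class d m z \<in> V" unfolding dom by auto
      define w where "w = \<psi> (hopf_quotient_class d m z)"
      have w: "w \<in> Q" "hopf_quotient_class d m w = hopf_quotient_class d m z" using zP(3) unfolding w_def Q(4,5)
        by (rule inv_into_into, rule f_inv_into_f)
      then have w0: "w \<noteq> 0" using Q(2) by auto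
      then obtain c where c: "c \<in> hopf_deck d m" "w = c *s z"
        using hopf_quotient_class_eq_iff[OF d0 m0 zP(2) w0] w(2) by metis
      define N where "N = \<phi> ` (U \<inter> V) \<inter> (\<lambda>x. c *s x) -` Q"
      have oN: "open N" unfolding N_def using od Q
        by (intro open_Int open_vimage linear_continuous_on bounded_linear_cvec_scale)
      have zN: "z \<in> N" using z w(1) unfolding N_def c(2) by blast
      have eq: "c *s x = \<psi> (inv_into U \<phi> x)" if "x \<in> N" for x
      proof -
        have x: "x \<in> P" "x \<noteq> 0" "c *s x \<in> Q" using that unfolding N_def dom by auto
        have "c *s x \<noteq> 0" using x(3) Q(2) by auto
        then have "hopf_quotient_class d m x = hopf_quotient_class d m (c *s x)"
          using c(1) hopf_quotient_class_eq_iff[OF d0 m0 x(2)] by blast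
        then show ?thesis unfolding inv[OF x(1)] Q(5) using inv_into_f_f[OF Q(3) x(3)] by simp
      qed
      have "((\<lambda>x. c *s x) has_derivative (\<lambda>x. c *s x)) (at z)"
        by (rule bounded_linear_imp_has_derivative[OF bounded_linear_cvec_scale])
      then have "((\<lambda>x. \<psi> (inv_into U \<phi> x)) has_derivative (\<lambda>x. c *s x)) (at z)"
        by (rule has_derivative_transform_within_open[OF _ oN zN]) (rule eq)
      moreover have "Vector_Spaces.linear (*s) (*s) (\<lambda>x::complex^'n. c *s x)"
        by unfold_locales (auto simp: vector_add_ldistrib vector_smult_assoc mult.commute)
      ultimately show "\<exists>L. ((\<lambda>x. \<psi> (inv_into U \<phi> x)) has_derivative L) (at z) \<and>
          Vector_Spaces.linear (*s) (*s) L" by blast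
    qed
  qed
qed

lemma complex_manifold_hopf_quotient:
  "complex_manifold (hopf_quotient_topology d m :: (complex^'n) set set topology) (hopf_quotient_charts d m)"
  unfolding complex_manifold_def using Hausdorff_hopf_quotient second_countable_hopf_quotient complex_atlas_hopf_quotient by blast

end

end

theory Submission
  imports Defs "HOL-Complex_Analysis.Complex_Analysis"
    "HOL-Computational_Algebra.Fundamental_Theorem_Algebra"
begin

text \<open>A group element close to the identity moves every point of the compact quotient only a little,
  so its action has a unique lift \<open>F\<close> to the punctured space with \<open>norm (F z - z) \<le> \<epsilon> * norm z\<close>. The
  lift is holomorphic and grows at most linearly, so Liouville's theorem on complex lines makes it
  linear. This yields a local homomorphism from the unitary group to the invertible matrices,
  defined up to the discrete group of deck scalars. On the diagonal torus at most \<open>n\<close> weights occur,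
  and transpositions permute them; a weight that is not constant therefore singles out one
  coordinate, and effectiveness forces its slope there to be \<open>\<i>\<close> or \<open>- \<i>\<close>. Hence, near the identity,
  the lift of a special unitary matrix has the same trace as the matrix or its conjugate, and
  nondegeneracy of the trace form makes the lift a conjugation by a fixed matrix. Scalars lift to
  scalars \<open>exp (t * c)\<close>; comparing both descriptions on the centre of the special unitary group
  determines \<open>c\<close>, and also gives coprimality, since a common divisor \<open>k\<close> of \<open>n\<close> and \<open>m\<close> would make
  the scalar \<open>cis (2 * pi / k)\<close> act trivially.\<close>

no_notation fps_nth (infixl "$" 75)

section \<open>Joint eigenvectors and the spectral theorem\<close>

text \<open>Only continuity of the action in the group variable is assumed, so there is no
  derivative of the homomorphism to work with, and a lift of an arbitrary unitary matrix is
  determined only up to a deck scalar. Extraction of roots replaces Lie theory: a unitary matrix is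
  diagonalised, its angles are divided by a large integer, the claim is proved for the resulting
  matrix near the identity, and the result is raised back to that power. This yields the existence
  of lifts, the conjugation rules and the final formula. A second obstacle is that lifts need not be
  unitary, nor obviously diagonalisable on the torus. Hence weights are complex exponents, found
  from logarithms of eigenvalues close to 1, and their integrality comes from periods: a power of a
  torus element that returns to the identity has a scalar lift. Counting then suffices, since n
  distinct weights leave no room for Jordan blocks. Traces enter because they do not see the unknown
  conjugations, which vary with the diagonalisation.\<close>

lemma mv_scale: "A *v (c *s x) = c *s (A *v x)" for A :: "complex^'n^'m"
  by (rule vec.linear_scale[OF matrix_vector_mul_linear_gen])

lemma mv_sum: "A *v (\<Sum>i\<in>S. f i) = (\<Sum>i\<in>S. A *v f i)" for A :: "complex^'n^'m"
  by (rule vec.linear_sum[OF matrix_vector_mul_linear_gen])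

text \<open>\<open>ev p\<close> is p(M) applied to \<open>x\<close>. More than n iterates of
  \<open>x\<close> are dependent, so some nonzero \<open>p\<close> annihilates \<open>x\<close>.
  When linear factors are split off, the last nonzero value of \<open>ev\<close> is an eigenvector,
  and it lies in \<open>W\<close> as a combination of iterates of \<open>x\<close>.\<close>

lemma invariant_eigenvector:
  fixes M :: "complex^'n^'n"
  assumes W: "vec.subspace W" and inv: "\<And>x. x \<in> W \<Longrightarrow> M *v x \<in> W" and x: "x \<in> W" "x \<noteq> 0"
  obtains v l where "v \<in> W" "v \<noteq> 0" "M *v v = l *s v"
proof -
  define f where "f = (\<lambda>k. ((*v) M ^^ k) x)"
  have f0: "f 0 = x" and fS: "f (Suc k) = M *v f k" for k by (auto simp: f_def)
  have fW: "f k \<in> W" for k by (induction k) (auto simp: f0 fS x inv)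
  define ev where "ev = (\<lambda>p. \<Sum>i\<le>degree p. coeff p i *s f i)"
  have ev: "ev p = (\<Sum>i\<le>m. coeff p i *s f i)" if "degree p \<le> m" for p m
    unfolding ev_def using that by (intro sum.mono_neutral_left) (auto simp: coeff_eq_0)
  have evW: "ev p \<in> W" for p
    unfolding ev_def by (intro vec.subspace_sum[OF W] vec.subspace_scale[OF W] fW)
  have root: "ev ([:- l, 1:] * q) = M *v ev q - l *s ev q" for l q
  proof -
    have "degree ([:- l, 1:] * q) \<le> Suc (degree q)"
      by (rule order_trans[OF degree_mult_le]) auto
    then have "ev ([:- l, 1:] * q) = (\<Sum>i\<le>Suc (degree q). coeff ([:- l, 1:] * q) i *s f i)"
      by (rule ev)
    also have "\<dots> = (\<Sum>i\<le>Suc (degree q). coeff (pCons 0 q) i *s f i) - l *s (\<Sum>i\<le>Suc (degree q). coeff q i *s f i)"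
      by (simp add: vec.scale_sum_right sum_subtractf[symmetric] vector_sub_rdistrib vector_smult_assoc del: sum.atMost_Suc)
    also have "(\<Sum>i\<le>Suc (degree q). coeff q i *s f i) = ev q" by (rule ev[symmetric]) simp
    also have "(\<Sum>i\<le>Suc (degree q). coeff (pCons 0 q) i *s f i) = M *v ev q"
      by (subst sum.atMost_Suc_shift) (simp add: ev_def fS mv_sum mv_scale)
    finally show ?thesis .
  qed
  have "\<exists>p. p \<noteq> 0 \<and> ev p = 0"
  \<comment> \<open>Dependence is a notion for sets, so a repetition among the iterates is treated
    separately; there a difference of two monomials annihilates \<open>x\<close>.\<close>
  proof (cases "inj_on f {..CARD('n)}")
    case False
    then obtain i j where ij: "i \<noteq> j" "f i = f j" by (auto simp: inj_on_def)
    define p where "p = (monom 1 i - monom 1 j :: complex poly)"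
    have "degree p \<le> max i j"
      unfolding p_def by (rule order_trans[OF degree_diff_le_max]) (auto simp: degree_monom_eq)
    then have "ev p = (\<Sum>k\<le>max i j. coeff p k *s f k)" by (rule ev)
    also have "\<dots> = f i - f j"
      by (simp add: p_def vector_sub_rdistrib sum_subtractf if_distrib[of "\<lambda>c. c *s _"] cong: if_cong)
    finally have "ev p = 0" using ij by simp
    moreover have "coeff p i \<noteq> 0" using ij by (simp add: p_def)
    ultimately show ?thesis by (intro exI[of _ p]) auto
  next
    case True
    have "vec.dim (f ` {..CARD('n)}) \<le> CARD('n)"
      using vec.dim_subset_UNIV[of "f ` {..CARD('n)}"] by (simp add: vec.dimension_def card_cart_basis)
    then have "vec.dependent (f ` {..CARD('n)})"
      using vec.dim_eq_card_independent[of "f ` {..CARD('n)}"] card_image[OF True] by fastforce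
    then obtain u v where u: "v \<in> f ` {..CARD('n)}" "u v \<noteq> 0" "(\<Sum>v\<in>f ` {..CARD('n)}. u v *s v) = 0"
      by (subst (asm) vec.dependent_finite) auto
    define p where "p = (\<Sum>k\<le>CARD('n). monom (u (f k)) k)"
    have c: "coeff p k = (if k \<le> CARD('n) then u (f k) else 0)" for k
      by (simp add: p_def coeff_sum)
    have "degree p \<le> CARD('n)" by (rule degree_le) (simp add: c)
    then have "ev p = (\<Sum>k\<le>CARD('n). coeff p k *s f k)" by (rule ev)
    also have "\<dots> = (\<Sum>v\<in>f ` {..CARD('n)}. u v *s v)"
      by (subst sum.reindex[OF True]) (auto intro!: sum.cong simp: c)
    finally have "ev p = 0" using u by simp
    moreover have "p \<noteq> 0"
    proof -
      from u obtain k where "k \<le> CARD('n)" "u (f k) \<noteq> 0" by auto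
      then have "coeff p k \<noteq> 0" by (simp add: c)
      then show ?thesis by auto
    qed
    ultimately show ?thesis by auto
  qed
  then obtain p where "p \<noteq> 0" "ev p = 0" by auto
  then have "\<exists>v l. v \<in> W \<and> v \<noteq> 0 \<and> M *v v = l *s v"
  proof (induction "degree p" arbitrary: p rule: less_induct)
    case less
    show ?case
    proof (cases "degree p = 0")
      case True
      then obtain a where "p = [:a:]" by (auto elim: degree_eq_zeroE)
      with less.prems x show ?thesis by (auto simp: ev_def f0)
    next
      case False
      then obtain l where "poly p l = 0"
        using Fundamental_Theorem_Algebra.fundamental_theorem_of_algebra[of p] by (auto simp: constant_degree)
      then obtain q where q: "p = [:- l, 1:] * q" by (auto simp: poly_eq_0_iff_dvd)
      with less.prems have q0: "q \<noteq> 0" by auto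
      then have "degree q < degree p" unfolding q by (subst degree_mult_eq) auto
      show ?thesis
      proof (cases "ev q = 0")
        case True
        then show ?thesis using less.hyps[OF \<open>degree q < degree p\<close> q0] by blast
      next
        case False
        then show ?thesis using less.prems root[of l q] evW[of q] q by auto
      qed
    qed
  qed
  then show ?thesis using that by blast
qed

text \<open>In a nonzero invariant subspace of least dimension, an eigenspace of one member is
  invariant under all members by commutativity, hence is the whole subspace. So every vector in it
  is a joint eigenvector, whatever the size of the family.\<close>

lemma joint_eigenvector:
  fixes \<M> :: "(complex^'n^'n) set"
  assumes W: "vec.subspace W" and inv: "\<And>M x. M \<in> \<M> \<Longrightarrow> x \<in> W \<Longrightarrow> M *v x \<in> W"
    and x: "x \<in> W" "x \<noteq> 0" and comm: "\<And>M N. M \<in> \<M> \<Longrightarrow> N \<in> \<M> \<Longrightarrow> M ** N = N ** M"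
  obtains v where "v \<in> W" "v \<noteq> 0" "\<And>M. M \<in> \<M> \<Longrightarrow> \<exists>l. M *v v = l *s v"
proof -
  define P where "P = (\<lambda>Y. vec.subspace Y \<and> Y \<subseteq> W \<and> (\<exists>y\<in>Y. y \<noteq> 0) \<and> (\<forall>M\<in>\<M>. \<forall>y\<in>Y. M *v y \<in> Y))"
  have "P W" using assms by (auto simp: P_def)
  then obtain Y where Y: "P Y" and min: "\<And>Z. P Z \<Longrightarrow> vec.dim Y \<le> vec.dim Z"
    using ex_has_least_nat[of P W "vec.dim"] by blast
  then obtain v where v: "v \<in> Y" "v \<noteq> 0" by (auto simp: P_def)
  have "\<exists>l. M *v v = l *s v" if M: "M \<in> \<M>" for M
  proof -
    obtain w l where w: "w \<in> Y" "w \<noteq> 0" "M *v w = l *s w"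
      using invariant_eigenvector[of Y M v] Y M v unfolding P_def by blast
    define Z where "Z = {y \<in> Y. M *v y = l *s y}"
    have sZ: "vec.subspace Z"
      using Y by (auto simp: Z_def P_def vec.subspace_def matrix_vector_right_distrib vector_add_ldistrib
          mv_scale vector_smult_assoc mult.commute)
    have "N *v y \<in> Z" if "N \<in> \<M>" "y \<in> Z" for N y
    proof -
      have "M *v (N *v y) = N *v (M *v y)" using comm[OF M that(1)] by (simp add: matrix_vector_mul_assoc)
      then show ?thesis using that Y unfolding Z_def P_def
        by (auto simp: mv_scale)
    qed
    then have "P Z" using sZ w Y unfolding P_def Z_def by auto
    then have "vec.dim Y \<le> vec.dim Z" by (rule min)
    moreover have "Z \<subseteq> Y" by (auto simp: Z_def)
    ultimately have "Z = Y" using sZ Y unfolding P_def by (intro vec.subspace_dim_equal) auto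
    then show ?thesis using v by (auto simp: Z_def)
  qed
  then show ?thesis using that v Y unfolding P_def by blast
qed

section \<open>The Hermitian form and unitary diagonalisation of normal matrices\<close>

definition hinner :: "complex^'n \<Rightarrow> complex^'n \<Rightarrow> complex" where
  "hinner x y = (\<Sum>i\<in>UNIV. x $ i * cnj (y $ i))"

lemma hinner_simps:
  "hinner (x + y) z = hinner x z + hinner y z" "hinner (x - y) z = hinner x z - hinner y z"
  "hinner (c *s x) z = c * hinner x z" "hinner x (c *s z) = cnj c * hinner x z"
  "hinner x (y + z) = hinner x y + hinner x z" "hinner x (y - z) = hinner x y - hinner x z"
  "hinner 0 x = 0" "hinner x 0 = 0"
  by (simp_all add: hinner_def algebra_simps sum.distrib sum_subtractf sum_distrib_left)

lemma hinner_sum: "hinner (\<Sum>i\<in>S. f i) z = (\<Sum>i\<in>S. hinner (f i) z)"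
  by (simp add: hinner_def sum_distrib_right sum.swap[of _ S])

lemma hinner_self: "hinner x x = of_real ((norm x)\<^sup>2)"
proof -
  have "(norm x)\<^sup>2 = (\<Sum>i\<in>UNIV. (norm (x $ i))\<^sup>2)"
    by (simp add: norm_vec_def L2_set_def sum_nonneg)
  then show ?thesis by (simp add: hinner_def complex_norm_square del: of_real_power)
qed

lemma hinner_self_eq_0: "hinner x x = 0 \<longleftrightarrow> x = 0"
  by (simp add: hinner_self)

lemma hinner_commute: "hinner x y = cnj (hinner y x)"
  by (simp add: hinner_def mult.commute)

lemma hinner_adjoint: "hinner (A *v x) y = hinner x (adjoint_matrix A *v y)"
  by (simp add: hinner_def matrix_vector_mult_def adjoint_matrix_def transpose_def
      sum_distrib_left sum_distrib_right mult_ac) (rule sum.swap)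

lemma norm_eq_if_hinner: "hinner x x = hinner y y \<Longrightarrow> norm x = norm y"
  by (metis hinner_self norm_ge_zero of_real_eq_iff power2_eq_imp_eq)

lemma norm_unitary_mv:
  assumes "U \<in> unitary_matrices" shows "norm (U *v x) = norm x"
  using assms by (intro norm_eq_if_hinner)
    (simp add: hinner_adjoint matrix_vector_mul_assoc unitary_matrices_def)

lemma adjoint_unitary: "U \<in> unitary_matrices \<Longrightarrow> adjoint_matrix U \<in> unitary_matrices"
  by (simp add: unitary_matrices_def)

definition diag_mat :: "('n \<Rightarrow> complex) \<Rightarrow> complex^'n^'n" where
  "diag_mat a = (\<chi> i j. if i = j then a i else 0)"

lemma mult_diag_mat: "(U ** diag_mat a) $ i $ j = U $ i $ j * a j"
  by (simp add: matrix_matrix_mult_def diag_mat_def if_distrib[of "\<lambda>x. _ * x"] cong: if_cong)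

text \<open>Normality lets the squared norm of \<open>adjoint_matrix A *v v - cnj l *s v\<close>
  expand to zero.\<close>

lemma normal_eigenvector_adjoint:
  assumes "A ** adjoint_matrix A = adjoint_matrix A ** A" "A *v v = l *s v"
  shows "adjoint_matrix A *v v = cnj l *s v"
proof -
  have "hinner (adjoint_matrix A *v v) (adjoint_matrix A *v v) = cnj l * (l * hinner v v)"
    using assms(1) by (simp add: hinner_adjoint matrix_vector_mul_assoc flip: hinner_simps)
      (simp add: assms(2) hinner_simps hinner_adjoint[symmetric] flip: matrix_vector_mul_assoc)
  moreover have "hinner v (adjoint_matrix A *v v) = l * hinner v v"
    by (simp add: hinner_adjoint[symmetric] assms hinner_simps)
  moreover have "hinner (adjoint_matrix A *v v) v = cnj l * hinner v v"
    by (simp add: hinner_adjoint assms hinner_simps)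
  ultimately have "hinner (adjoint_matrix A *v v - cnj l *s v) (adjoint_matrix A *v v - cnj l *s v) = 0"
    by (simp add: hinner_simps)
  then show ?thesis by (simp add: hinner_self_eq_0)
qed

text \<open>Orthonormal eigenvectors are added one at a time: the orthogonal complement of those
  already found is invariant under \<open>A\<close> because they are eigenvectors of the adjoint
  too, so it contains a further eigenvector until there are n of them.\<close>

theorem spectral_normal:
  fixes A :: "complex^'n^'n"
  assumes A: "A ** adjoint_matrix A = adjoint_matrix A ** A"
  obtains U a where "U \<in> unitary_matrices" "A = U ** diag_mat a ** adjoint_matrix U"
proof -
  define on where "on = (\<lambda>S. finite S \<and> (\<forall>u\<in>S. hinner u u = 1 \<and> (\<exists>l. A *v u = l *s u)) \<and>
     (\<forall>u\<in>S. \<forall>v\<in>S. u \<noteq> v \<longrightarrow> hinner u v = 0))"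
  have "\<exists>S. on S \<and> card S = k" if "k \<le> CARD('n)" for k
    using that
  proof (induction k)
    case 0
    then show ?case by (intro exI[of _ "{}"]) (auto simp: on_def)
  next
    case (Suc k)
    then obtain S where S: "on S" "card S = k" by auto
    then have fS: "finite S" by (auto simp: on_def)
    define W where "W = {x. \<forall>u\<in>S. hinner x u = 0}"
    have W: "vec.subspace W" by (auto simp: W_def vec.subspace_def hinner_simps)
    have inv: "A *v x \<in> W" if "x \<in> W" for x
      unfolding W_def
    proof (intro CollectI ballI)
      fix u assume u: "u \<in> S"
      then obtain l where "A *v u = l *s u" using S unfolding on_def by blast
      then have "adjoint_matrix A *v u = cnj l *s u" by (rule normal_eigenvector_adjoint[OF A])
      then show "hinner (A *v x) u = 0" using that u by (simp add: hinner_adjoint W_def hinner_simps)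
    qed
    have "vec.dim S \<le> k" using vec.dim_le_card[of S S] vec.span_superset fS S by auto
    then have "vec.span S \<noteq> UNIV"
      using Suc.prems vec.dim_span[of S] vec_dim_card[where 'a=complex and 'n='n]
      by (metis not_less_eq_eq order_trans)
    then obtain y where y: "y \<notin> vec.span S" by auto
    define x where "x = y - (\<Sum>u\<in>S. hinner y u *s u)"
    have "(\<Sum>u\<in>S. hinner y u *s u) \<in> vec.span S"
      by (intro vec.span_sum vec.span_scale vec.span_base)
    with y have x0: "x \<noteq> 0" by (auto simp: x_def)
    have "x \<in> W" unfolding W_def
    proof (intro CollectI ballI)
      fix u assume u: "u \<in> S"
      have "(\<Sum>w\<in>S. hinner y w * hinner w u) = (\<Sum>w\<in>S. if w = u then hinner y u else 0)"
        using S u by (intro sum.cong) (auto simp: on_def)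
      then show "hinner x u = 0" using u fS by (simp add: x_def hinner_simps hinner_sum)
    qed
    then obtain v l where v: "v \<in> W" "v \<noteq> 0" "A *v v = l *s v"
      using invariant_eigenvector[OF W inv _ x0] by blast
    define w where "w = of_real (inverse (norm v)) *s v"
    have w: "hinner w w = 1" "A *v w = l *s w" "w \<in> W"
      using v vec.subspace_scale[OF W v(1)]
      by (auto simp: w_def hinner_simps hinner_self norm_cvec_scale norm_divide mv_scale vector_smult_assoc mult.commute field_simps power2_eq_square)
    have wS: "w \<notin> S" using w by (auto simp: W_def)
    have "hinner w u = 0" "hinner u w = 0" if "u \<in> S" for u
      using w(3) that hinner_commute[of u w] by (auto simp: W_def)
    then have "on (insert w S)" using S w(1,2) fS unfolding on_def by auto
    then show ?case using S fS wS by (intro exI[of _ "insert w S"]) auto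
  qed
  then obtain S where S: "on S" "card S = CARD('n)" by blast
  then obtain u where u: "bij_betw u (UNIV::'n set) S"
    using finite_same_card_bij[of "UNIV::'n set" S] by (auto simp: on_def)
  have uS: "u j \<in> S" for j using u by (auto simp: bij_betw_def)
  have "\<forall>j. \<exists>l. A *v u j = l *s u j" using S uS by (auto simp: on_def)
  then obtain a where a: "\<And>j. A *v u j = a j *s u j" by metis
  define U :: "complex^'n^'n" where "U = (\<chi> i j. u j $ i)"
  have "hinner (u i) (u j) = (if i = j then 1 else 0)" for i j
    using S(1) uS[of i] uS[of j] bij_betw_imp_inj_on[OF u] unfolding on_def by (auto dest: injD)
  then have "adjoint_matrix U ** U = mat 1"
    by (auto simp: vec_eq_iff adjoint_matrix_def transpose_def matrix_matrix_mult_def U_def mat_def hinner_def mult.commute)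
  moreover from this have "U ** adjoint_matrix U = mat 1" by (simp add: matrix_left_right_inverse)
  ultimately have U: "U \<in> unitary_matrices" by (simp add: unitary_matrices_def)
  have "(A ** U) $ i $ j = (A *v u j) $ i" for i j
    by (simp add: matrix_matrix_mult_def matrix_vector_mult_def U_def)
  then have "A ** U = U ** diag_mat a"
    unfolding vec_eq_iff mult_diag_mat using a by (simp add: U_def mult.commute)
  then have "U ** diag_mat a ** adjoint_matrix U = A ** (U ** adjoint_matrix U)"
    by (simp add: matrix_mul_assoc)
  then have "A = U ** diag_mat a ** adjoint_matrix U"
    using \<open>U ** adjoint_matrix U = mat 1\<close> by simp
  then show ?thesis using that U by blast
qed

section \<open>Holomorphic maps of linear growth\<close>

text \<open>Complex linearity of the derivative makes its restriction to a complex line a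
  multiplication by \<open>L w $ i\<close>, which is differentiability in one variable.\<close>

lemma holomorphic_along_line:
  fixes F :: "complex^'n \<Rightarrow> complex^'n"
  assumes der: "\<And>z. z \<noteq> 0 \<Longrightarrow> \<exists>L. (F has_derivative L) (at z) \<and> Vector_Spaces.linear (*s) (*s) L"
    and S: "\<And>l. l \<in> S \<Longrightarrow> z + l *s w \<noteq> 0" "open S"
  shows "(\<lambda>l. F (z + l *s w) $ i) holomorphic_on S"
  unfolding holomorphic_on_open[OF S(2)]
proof (intro ballI)
  fix l assume "l \<in> S"
  then obtain L where L: "(F has_derivative L) (at (z + l *s w))" "Vector_Spaces.linear (*s) (*s) L"
    using der S by blast
  have "bounded_linear (\<lambda>h. h *s w)"
    by (rule bounded_linear_intro[of _ "norm w"]) (auto simp: vector_sadd_rdistrib vec_eq_iff norm_cvec_scale)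
  then have "((\<lambda>l. z + l *s w) has_derivative (\<lambda>h. h *s w)) (at l)"
    by (auto intro!: derivative_eq_intros bounded_linear_imp_has_derivative)
  from has_derivative_compose[OF this L(1)]
  have "((\<lambda>l. F (z + l *s w) $ i) has_derivative (\<lambda>h. L (h *s w) $ i)) (at l)"
    by (rule bounded_linear.has_derivative[OF bounded_linear_vec_nth])
  also have "(\<lambda>h. L (h *s w) $ i) = (*) (L w $ i)"
    by (auto simp: fun_eq_iff vec.linear_scale[OF L(2)] mult.commute)
  finally have "((\<lambda>l. F (z + l *s w) $ i) has_field_derivative L w $ i) (at l)"
    by (simp add: has_field_derivative_def)
  then show "\<exists>f'. ((\<lambda>l. F (z + l *s w) $ i) has_field_derivative f') (at l)" by blast
qed

lemma entire_linear_growth: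
  assumes "f holomorphic_on UNIV" and "\<And>l. 1 \<le> norm l \<Longrightarrow> norm (f l) \<le> B * norm l"
  shows "f l = f 0 + deriv f 0 * l"
  using Liouville_polynomial[OF assms(1), of 1 B 1 l] assms(2) by simp

text \<open>Two kinds of complex lines are used. On a line through the origin the growth bound
  removes the singularity at 0, and Liouville gives homogeneity. On a line missing the origin
  \<open>F\<close> is entire and affine in the parameter, which gives additivity once its slope is
  identified.\<close>

lemma holomorphic_linear_growth_imp_linear:
  fixes F :: "complex^'n \<Rightarrow> complex^'n"
  assumes der: "\<And>z. z \<noteq> 0 \<Longrightarrow> \<exists>L. (F has_derivative L) (at z) \<and> Vector_Spaces.linear (*s) (*s) L"
    and bd: "\<And>z. z \<noteq> 0 \<Longrightarrow> norm (F z) \<le> M * norm z"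
  obtains g where "\<And>z. z \<noteq> 0 \<Longrightarrow> F z = g *v z"
proof -
  define G where "G = (\<lambda>z. if z = 0 then 0 else F z)"
  have M: "M \<ge> 0" using bd[of "axis undefined 1"] order_trans[OF norm_ge_zero[of "F (axis undefined 1)"]]
    by (simp add: axis_eq_0_iff)
  have Gb: "norm (G z) \<le> M * norm z" for z using bd by (auto simp: G_def)
  have Gc: "isCont F z" if "z \<noteq> 0" for z using der[OF that] has_derivative_continuous by blast
  have homog: "G (l *s w) = l *s G w" for l w
  proof (cases "w = 0")
    case False
    have "G (l *s w) $ i = l * G w $ i" for i
    proof -
      define g where "g = (\<lambda>l. G (l *s w) $ i)"
      have gb: "norm (g l) \<le> (M * norm w) * norm l" for l
        using Finite_Cartesian_Product.norm_nth_le[of "G (l *s w)" i] Gb[of "l *s w"]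
        by (simp add: g_def norm_cvec_scale mult_ac)
      have "(\<lambda>l. F (0 + l *s w) $ i) holomorphic_on - {0}"
        by (rule holomorphic_along_line[OF der]) (use False in \<open>auto simp: cvec_scale_eq_0\<close>)
      moreover have "F (0 + l *s w) $ i = g l" if "l \<in> - {0}" for l
        using that False by (auto simp: g_def G_def cvec_scale_eq_0)
      ultimately have "g holomorphic_on - {0}"
        by (rule holomorphic_transform)
      then have hol: "g holomorphic_on UNIV - {0}" by (simp add: Compl_eq_Diff_UNIV)
      have "(g \<longlongrightarrow> 0) (at 0)"
      proof (rule Lim_null_comparison)
        show "\<forall>\<^sub>F l in at 0. norm (g l) \<le> (M * norm w) * norm l" using gb by simp
        show "((\<lambda>l. (M * norm w) * norm l) \<longlongrightarrow> 0) (at 0)" by (auto intro!: tendsto_eq_intros)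
      qed
      moreover have "g 0 = 0" by (simp add: g_def G_def)
      ultimately have "isCont g 0" by (simp add: isCont_def)
      moreover have "continuous_on (UNIV - {0}) g" using hol by (rule holomorphic_on_imp_continuous_on)
      ultimately have "continuous_on UNIV g"
        by (auto simp: continuous_on_eq_continuous_at open_delete)
      then have "g holomorphic_on UNIV" using hol by (intro no_isolated_singularity[of UNIV g "{0}"]) auto
      then have "g l = deriv g 0 * l" for l
        using entire_linear_growth[of g "M * norm w" l] gb \<open>g 0 = 0\<close> by simp
      from this[of l] this[of 1] show ?thesis by (simp add: g_def)
    qed
    then show ?thesis by (simp add: vec_eq_iff)
  qed (simp add: G_def)
  have add: "G (z + w) = G z + G w" for z w
  \<comment> \<open>If the line meets the origin then \<open>z\<close> is a multiple of
    \<open>w\<close>, and homogeneity alone gives additivity.\<close>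
  proof (cases "w = 0 \<or> (\<exists>l. z + l *s w = 0)")
    case True
    then consider "w = 0" | l where "z = (- l) *s w" by (auto simp: eq_neg_iff_add_eq_0)
    then show ?thesis
    proof cases
      case 2
      then have "z + w = (1 - l) *s w" by (simp add: vector_sub_rdistrib)
      then have "G (z + w) = (1 - l) *s G w" by (simp only: homog)
      also have "\<dots> = (- l) *s G w + G w" by (simp add: vector_sub_rdistrib)
      finally show ?thesis by (simp only: homog 2)
    qed (simp add: G_def)
  next
    case False
    then have w: "w \<noteq> 0" and nz: "\<And>l. z + l *s w \<noteq> 0" by auto
    have "G (z + w) $ i = G z $ i + G w $ i" for i
    proof -
      define f where "f = (\<lambda>l. F (z + l *s w) $ i)"
      have hol: "f holomorphic_on UNIV" unfolding f_def by (rule holomorphic_along_line[OF der]) (use nz in auto)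
      have fb: "norm (f l) \<le> (M * (norm z + norm w)) * norm l" if "1 \<le> norm l" for l
      proof -
        have "norm (f l) \<le> M * norm (z + l *s w)"
          unfolding f_def by (rule order_trans[OF Finite_Cartesian_Product.norm_nth_le bd[OF nz]])
        also have "\<dots> \<le> M * (norm z * norm l + norm l * norm w)"
          using that M by (intro mult_left_mono order_trans[OF norm_triangle_ineq] add_mono)
            (auto simp: norm_cvec_scale mult_le_cancel_left1 intro: order_trans)
        finally show ?thesis by (simp add: algebra_simps)
      qed
      have f: "f l = f 0 + deriv f 0 * l" for l by (rule entire_linear_growth[OF hol fb])
      \<comment> \<open>The slope of the affine function \<open>f\<close> is its behaviour at
        infinity. Homogeneity with \<open>t\<close> the inverse of the line parameter turns this
        into the limit of \<open>F (t *s z + w)\<close> at \<open>t = 0\<close>, where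
        \<open>F\<close> is continuous because \<open>w\<close> is nonzero.\<close>
      have lim: "((\<lambda>t. F (t *s z + w) $ i) \<longlongrightarrow> F w $ i) (at 0)"
      proof -
        have "((\<lambda>t. t *s z + w) \<longlongrightarrow> 0 *s z + w) (at 0)"
          by (intro tendsto_add tendsto_const vec_tendstoI) (auto intro!: tendsto_eq_intros)
        then have "((\<lambda>t. F (t *s z + w)) \<longlongrightarrow> F w) (at 0)"
          using isCont_tendsto_compose[OF Gc[OF w]] by simp
        then show ?thesis by (rule tendsto_vec_nth)
      qed
      have Ft: "F (t *s z + w) $ i = t * f 0 + deriv f 0" if "t \<noteq> 0" for t
      proof -
        have "t *s z + w = t *s (z + inverse t *s w)" using that by (simp add: vector_add_ldistrib vector_smult_assoc)
        moreover have "t *s z + w \<noteq> 0" using nz[of "inverse t"] that calculation cvec_scale_eq_0 by metis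
        ultimately have "F (t *s z + w) = t *s F (z + inverse t *s w)"
          using homog[of t "z + inverse t *s w"] nz by (simp add: G_def)
        then have "F (t *s z + w) $ i = t * f (inverse t)" by (simp add: f_def)
        moreover have "f (inverse t) = f 0 + deriv f 0 * inverse t" by (rule f)
        ultimately show ?thesis using that by (simp add: algebra_simps)
      qed
      have "((\<lambda>t. t * f 0 + deriv f 0) \<longlongrightarrow> 0 * f 0 + deriv f 0) (at 0)"
        by (intro tendsto_intros)
      moreover have "\<forall>\<^sub>F t in at 0. t * f 0 + deriv f 0 = F (t *s z + w) $ i"
        unfolding eventually_at_filter
      proof (intro always_eventually allI impI)
        fix t :: complex assume "t \<noteq> 0"
        then show "t * f 0 + deriv f 0 = F (t *s z + w) $ i" by (rule Ft[symmetric])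
      qed
      ultimately have "((\<lambda>t. F (t *s z + w) $ i) \<longlongrightarrow> 0 * f 0 + deriv f 0) (at 0)"
        by (rule Lim_transform_eventually)
      from LIM_unique[OF lim this] have "F w $ i = deriv f 0" by simp
      moreover have "f 1 = f 0 + deriv f 0 * 1" by (rule f)
      ultimately show ?thesis using nz[of 0] nz[of 1] w by (simp add: f_def G_def)
    qed
    then show ?thesis by (simp add: vec_eq_iff)
  qed
  have "Vector_Spaces.linear (*s) (*s) G" using add homog by unfold_locales auto
  then have G: "G z = matrix G *v z" for z by (rule matrix_works[symmetric])
  have "F z = matrix G *v z" if "z \<noteq> 0" for z
    using that by (simp only: G[symmetric]) (simp add: G_def)
  then show ?thesis by (rule that)
qed

section \<open>Orbits under swaps and locally additive functions\<close>

text \<open>\<open>D\<close> records where a swapped function differs from \<open>c\<close>: a swap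
  of unequal values gives the pair of swapped points, a trivial swap the empty set. With
  \<open>S\<close> a level set this yields \<open>card S * card (- S) + 1\<close> different
  functions, and n = \<open>card S + card (- S)\<close> bounds this number only if one of the two
  sets is a singleton.\<close>

lemma constant_off_point_if_few_swaps:
  fixes c :: "'n::finite \<Rightarrow> 'b"
  assumes ij: "c i \<noteq> c j" and fin: "finite {c \<circ> Transposition.transpose p q | p q. True}"
    and le: "card {c \<circ> Transposition.transpose p q | p q. True} \<le> CARD('n)"
  obtains k where "\<And>p q. p \<noteq> k \<Longrightarrow> q \<noteq> k \<Longrightarrow> c p = c q"
proof -
  define S where "S = {x. c x = c i}"
  define D where "D = (\<lambda>f. {x. f x \<noteq> c x})"
  define X where "X = {c \<circ> Transposition.transpose p q | p q. True}"
  define E where "E = (\<lambda>(p, q). {p, q}) ` (S \<times> - S)"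
  have D: "D (c \<circ> Transposition.transpose p q) = {p, q}" if "c p \<noteq> c q" for p q
    using that by (auto simp: D_def Transposition.transpose_def)
  have "c \<in> X" unfolding X_def by (rule CollectI, rule exI[of _ i], rule exI[of _ i]) auto
  moreover have "D c = {}" by (auto simp: D_def)
  ultimately have X0: "{} \<in> D ` X" by force
  have XE: "{p, q} \<in> D ` X" if "c p \<noteq> c q" for p q
    using D[OF that] unfolding X_def by force
  have sub: "E \<subseteq> D ` X"
  proof
    fix e assume "e \<in> E"
    then obtain p q where "e = {p, q}" "c p = c i" "c q \<noteq> c i" by (auto simp: E_def S_def)
    with XE[of p q] show "e \<in> D ` X" by simp
  qed
  have "inj_on (\<lambda>(p, q). {p, q}) (S \<times> - S)" by (auto simp: inj_on_def doubleton_eq_iff)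
  then have cE: "card E = card S * card (- S)"
    by (simp add: E_def card_image card_cartesian_product)
  have "i \<in> S" "j \<in> - S" using ij by (auto simp: S_def)
  then have "S \<noteq> {}" "- S \<noteq> {}" by blast+
  then have pos: "card S > 0" "card (- S) > 0" by (simp_all only: card_gt_0_iff finite simp_thms)
  have sum: "card S + card (- S) = CARD('n)"
    by (metis card_Un_disjoint Compl_disjoint Compl_partition finite)
  have fX: "finite (D ` X)" and cX: "card (D ` X) \<le> CARD('n)"
    using fin le card_image_le[of X D] by (auto simp: X_def)
  have E: "finite E" "{} \<notin> E" by (simp add: E_def) (auto simp: E_def)
  then have "card (insert {} E) = Suc (card E)" by simp
  moreover have "card (insert {} E) \<le> card (D ` X)" using X0 sub fX by (intro card_mono) auto
  ultimately have "Suc (card S * card (- S)) \<le> card S + card (- S)" using cE cX sum by simp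
  then have one: "card S = 1 \<or> card (- S) = 1"
    using pos by (cases "card S"; cases "card (- S)") (auto simp: algebra_simps)
  then show ?thesis
  proof
    assume "card (- S) = 1"
    then obtain k where "- S = {k}" by (auto simp: card_1_singleton_iff)
    then have "c p = c i" if "p \<noteq> k" for p using that by (auto simp: S_def)
    then show ?thesis using that by metis
  next
    \<comment> \<open>Unequal values at two points outside \<open>S\<close> would add a pair that is
      not in \<open>E\<close>: with the n - 1 pairs of \<open>E\<close> and the empty set this makes
      n + 1 difference sets, one too many.\<close>
    assume 1: "card S = 1"
    then obtain k where k: "S = {k}" by (auto simp: card_1_singleton_iff)
    have "c p = c q" if "p \<noteq> k" "q \<noteq> k" for p q
    proof (rule ccontr)
      assume ne: "c p \<noteq> c q"
      have "x \<inter> S \<noteq> {}" if "x \<in> E" for x using that by (auto simp: E_def)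
      moreover have "{p, q} \<inter> S = {}" using \<open>p \<noteq> k\<close> \<open>q \<noteq> k\<close> k by simp
      ultimately have "{p, q} \<notin> insert {} E" by blast
      then have "card (insert {p, q} (insert {} E)) = Suc (Suc (card E))"
        using E by simp
      moreover have "card (insert {p, q} (insert {} E)) \<le> card (D ` X)"
        using X0 sub fX XE[OF ne] by (intro card_mono) auto
      ultimately show False using cE cX sum 1 by simp
    qed
    then show ?thesis by (rule that)
  qed
qed

text \<open>After subtraction of the linear function that agrees with \<open>f\<close> at
  \<open>\<delta> / 2\<close>, the remainder \<open>g\<close> is periodic as far as its domain
  permits. A bounded additive function with this property vanishes, because its bound can be halved
  repeatedly.\<close>

lemma local_additive_bounded:
  fixes f :: "real \<Rightarrow> complex"
  assumes \<delta>: "\<delta> > 0"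
    and add: "\<And>s t. \<bar>s\<bar> < \<delta> \<Longrightarrow> \<bar>t\<bar> < \<delta> \<Longrightarrow> \<bar>s + t\<bar> < \<delta> \<Longrightarrow> f (s + t) = f s + f t"
    and bd: "\<And>t. \<bar>t\<bar> < \<delta> \<Longrightarrow> norm (f t) \<le> K"
  obtains c where "\<And>t. \<bar>t\<bar> < \<delta> \<Longrightarrow> f t = of_real t * c"
proof -
  define c where "c = f (\<delta> / 2) / of_real (\<delta> / 2)"
  define g where "g = (\<lambda>t. f t - of_real t * c)"
  have ga: "g (s + t) = g s + g t" if "\<bar>s\<bar> < \<delta>" "\<bar>t\<bar> < \<delta>" "\<bar>s + t\<bar> < \<delta>" for s t
    using add[OF that] by (simp add: g_def algebra_simps)
  have g0: "g 0 = 0" using ga[of 0 0] \<delta> by simp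
  have g1: "g (\<delta> / 2) = 0" using \<delta> by (simp add: g_def c_def)
  have g2: "g (- \<delta> / 2) = 0" using ga[of "\<delta> / 2" "- \<delta> / 2"] g0 g1 \<delta> by simp
  have gb: "norm (g t) \<le> (K + \<delta> * norm c) / 2 ^ k" if "\<bar>t\<bar> \<le> \<delta> / 2" for t k
    using that
  proof (induction k arbitrary: t)
    case 0
    have "norm (g t) \<le> norm (f t) + norm (of_real t * c)"
      unfolding g_def by (rule norm_triangle_ineq4)
    also have "\<dots> \<le> K + \<delta> * norm c"
      using 0 \<delta> bd[of t] by (intro add_mono) (auto simp: norm_mult intro!: mult_right_mono)
    finally show ?case by simp
  next
    case (Suc k)
    \<comment> \<open>A shift by \<open>\<delta> / 2\<close>, where \<open>g\<close> vanishes,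
      brings the argument into the inner half of the interval; there it can be doubled, which halves
      the bound.\<close>
    have "\<exists>s. \<bar>s\<bar> \<le> \<delta> / 4 \<and> g t = g s"
    proof (cases "\<bar>t\<bar> \<le> \<delta> / 4")
      case False
      show ?thesis
      proof (cases "t > 0")
        case True
        then show ?thesis using False Suc.prems \<delta> ga[of "t - \<delta> / 2" "\<delta> / 2"] g1
          by (intro exI[of _ "t - \<delta> / 2"]) auto
      next
        case neg: False
        then show ?thesis using False Suc.prems \<delta> ga[of "t + \<delta> / 2" "- \<delta> / 2"] g2
          by (intro exI[of _ "t + \<delta> / 2"]) auto
      qed
    qed auto
    then obtain s where s: "\<bar>s\<bar> \<le> \<delta> / 4" "g t = g s" by auto
    have "2 * g s = g (s + s)" using ga[of s s] s \<delta> by simp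
    then have "2 * norm (g s) = norm (g (s + s))" by (metis norm_mult norm_numeral)
    also have "\<dots> \<le> (K + \<delta> * norm c) / 2 ^ k" using s by (intro Suc.IH) auto
    finally show ?case using s by (simp add: field_simps)
  qed
  have "g t = 0" if "\<bar>t\<bar> \<le> \<delta> / 2" for t
  proof -
    have "(\<lambda>k. (K + \<delta> * norm c) / 2 ^ k) \<longlonglongrightarrow> 0"
      using tendsto_mult[OF tendsto_const[of "K + \<delta> * norm c"] LIMSEQ_inverse_realpow_zero[of 2]]
      by (simp add: divide_inverse)
    then have "norm (g t) \<le> 0" by (rule LIMSEQ_le_const) (use gb[OF that] in auto)
    then show ?thesis by simp
  qed
  then have "f t = of_real t * c" if "\<bar>t\<bar> < \<delta>" for t
    using ga[of "t / 2" "t / 2"] that by (simp add: g_def)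
  then show ?thesis by (rule that)
qed

section \<open>Unitary matrices near the identity\<close>

text \<open>A bound on the operator norm of A - 1. It is relative to \<open>norm z\<close>, so it
  matches displacement estimates that do not change when a point is multiplied by a deck
  scalar.\<close>

definition near_one :: "real \<Rightarrow> complex^'n^'n \<Rightarrow> bool" where
  "near_one r A \<longleftrightarrow> (\<forall>z. norm (A *v z - z) \<le> r * norm z)"

lemma near_one_mono: "near_one r A \<Longrightarrow> r \<le> s \<Longrightarrow> near_one s A"
  unfolding near_one_def by (meson mult_right_mono norm_ge_zero order_trans)

text \<open>The left factor is an isometry, so the radii simply add.\<close>

lemma near_one_mult:
  assumes "A \<in> unitary_matrices" "near_one r A" "near_one s B"
  shows "near_one (r + s) (A ** B)"
  unfolding near_one_def
proof
  fix z
  have "(A ** B) *v z - z = A *v (B *v z - z) + (A *v z - z)"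
    by (simp add: matrix_vector_mul_assoc matrix_vector_right_distrib matrix_vector_mult_diff_distrib)
  then have "norm ((A ** B) *v z - z) \<le> norm (A *v (B *v z - z)) + norm (A *v z - z)"
    by (metis norm_triangle_ineq)
  also have "\<dots> \<le> s * norm z + r * norm z"
    using assms by (intro add_mono) (auto simp: norm_unitary_mv near_one_def)
  finally show "norm ((A ** B) *v z - z) \<le> (r + s) * norm z" by (simp add: algebra_simps)
qed

lemma unitary_inverse:
  assumes "U \<in> unitary_matrices"
  shows "adjoint_matrix U ** U = mat 1" "U ** adjoint_matrix U = mat 1"
  using assms by (auto simp: unitary_matrices_def)

lemma near_one_conj:
  assumes U: "U \<in> unitary_matrices"
  shows "near_one r (U ** A ** adjoint_matrix U) \<longleftrightarrow> near_one r A"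
proof -
  have *: "near_one r (U ** A ** adjoint_matrix U)" if "near_one r A" "U \<in> unitary_matrices"
    for U A :: "complex^'n^'n"
    unfolding near_one_def
  proof
    fix z
    have "(U ** A ** adjoint_matrix U) *v z - z =
        U *v (A *v (adjoint_matrix U *v z) - adjoint_matrix U *v z)"
      by (simp add: matrix_vector_mult_diff_distrib matrix_vector_mul_assoc matrix_mul_assoc unitary_inverse[OF that(2)])
    then have "norm ((U ** A ** adjoint_matrix U) *v z - z) = norm (A *v (adjoint_matrix U *v z) - adjoint_matrix U *v z)"
      using that by (simp add: norm_unitary_mv)
    also have "\<dots> \<le> r * norm (adjoint_matrix U *v z)" using that by (simp add: near_one_def)
    finally show "norm ((U ** A ** adjoint_matrix U) *v z - z) \<le> r * norm z"
      using that by (simp add: norm_unitary_mv adjoint_unitary)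
  qed
  have "adjoint_matrix U ** (U ** A ** adjoint_matrix U) ** U = (adjoint_matrix U ** U) ** A ** (adjoint_matrix U ** U)"
    by (simp only: matrix_mul_assoc)
  then have "adjoint_matrix U ** (U ** A ** adjoint_matrix U) ** U = A"
    by (simp add: unitary_inverse[OF U])
  then show ?thesis
    using *[of A U] *[of "U ** A ** adjoint_matrix U" "adjoint_matrix U"] U adjoint_unitary by auto
qed

lemma diag_mat_mv: "(diag_mat a *v z) $ i = a i * z $ i"
  by (simp add: matrix_vector_mult_def diag_mat_def if_distrib[of "\<lambda>x. x * _"] cong: if_cong)

lemma diag_mat_mult: "diag_mat a ** diag_mat b = diag_mat (\<lambda>i. a i * b i)"
  by (simp add: vec_eq_iff mult_diag_mat) (simp add: diag_mat_def)

lemma diag_mat_one: "diag_mat (\<lambda>_. 1) = mat 1"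
  by (simp add: diag_mat_def mat_def)

lemma adjoint_diag_mat: "adjoint_matrix (diag_mat a) = diag_mat (\<lambda>i. cnj (a i))"
  by (simp add: vec_eq_iff adjoint_matrix_def diag_mat_def transpose_def)

lemma det_diag_mat: "det (diag_mat a) = (\<Prod>i\<in>UNIV. a i)"
  by (subst det_diagonal) (auto simp: diag_mat_def)

lemma trace_diag_mat: "trace (diag_mat a) = (\<Sum>i\<in>UNIV. a i)"
  by (simp add: trace_def diag_mat_def)

section \<open>The diagonal torus and special unitary matrices near the identity\<close>

definition torus :: "('n::finite \<Rightarrow> real) \<Rightarrow> complex^'n^'n" where
  "torus \<theta> = diag_mat (\<lambda>i. cis (\<theta> i))"

lemma torus_unitary: "torus \<theta> \<in> unitary_matrices"
  by (simp add: torus_def unitary_matrices_def adjoint_diag_mat diag_mat_mult diag_mat_one cis_cnj cis_mult)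

lemma torus_add: "torus \<theta> ** torus \<phi> = torus (\<lambda>i. \<theta> i + \<phi> i)"
  by (simp add: torus_def diag_mat_mult cis_mult)

lemma det_torus: "det (torus \<theta>) = cis (\<Sum>i\<in>UNIV. \<theta> i)"
proof -
  have "(\<Prod>i\<in>S. cis (\<theta> i)) = cis (\<Sum>i\<in>S. \<theta> i)" if "finite S" for S
    using that by induction (auto simp: cis_mult)
  then show ?thesis by (simp add: torus_def det_diag_mat)
qed

lemma norm_cis_diff_one_le: "norm (cis t - 1) \<le> \<bar>t\<bar>"
proof -
  have "norm (exp (\<i> * of_real t) - 1) \<le> \<bar>t\<bar>"
    by (smt (verit) dist_exp_i_1 abs_sin_x_le_abs_x field_sum_of_halves abs_of_nonneg abs_mult)
  then show ?thesis by (simp add: cis_conv_exp)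
qed

lemma near_one_torus:
  assumes "\<And>i. \<bar>\<theta> i\<bar> \<le> r" shows "near_one r (torus \<theta>)"
  unfolding near_one_def
proof
  fix z :: "complex^'a"
  have "norm ((torus \<theta> *v z - z) $ i) \<le> norm ((of_real r *s z) $ i)" for i
  proof -
    have "(torus \<theta> *v z - z) $ i = (cis (\<theta> i) - 1) * z $ i"
      by (simp add: torus_def diag_mat_mv algebra_simps)
    then show ?thesis using assms[of i] norm_cis_diff_one_le[of "\<theta> i"]
      by (auto simp: norm_mult intro!: mult_right_mono)
  qed
  then have "norm (torus \<theta> *v z - z) \<le> norm (of_real r *s z)" by (rule norm_le_componentwise_cart)
  moreover have "0 \<le> r" using assms[of undefined] by linarith
  ultimately show "norm (torus \<theta> *v z - z) \<le> r * norm z" by (simp add: norm_cvec_scale)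
qed

definition special_near :: "real \<Rightarrow> (complex^'n^'n) set" where
  "special_near r = {A \<in> special_unitary_matrices. near_one r A}"

lemma special_near_mult:
  "A \<in> special_near r \<Longrightarrow> B \<in> special_near s \<Longrightarrow> A ** B \<in> special_near (r + s)"
  by (auto simp: special_near_def special_unitary_matrices_def unitary_matrices_mult det_mul near_one_mult)

lemma special_near_conj_torus:
  assumes "U \<in> unitary_matrices" "\<And>i. \<bar>\<theta> i\<bar> \<le> r" "(\<Sum>i\<in>UNIV. \<theta> i) = 0"
  shows "U ** torus \<theta> ** adjoint_matrix U \<in> special_near r"
proof -
  have "det (U ** torus \<theta> ** adjoint_matrix U) = det (U ** adjoint_matrix U) * det (torus \<theta>)"
    by (simp add: det_mul)
  then have "det (U ** torus \<theta> ** adjoint_matrix U) = 1"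
    using assms by (simp add: unitary_inverse det_torus)
  then show ?thesis
    using assms by (simp add: special_near_def special_unitary_matrices_def unitary_matrices_mult
        torus_unitary adjoint_unitary near_one_conj near_one_torus)
qed

text \<open>This makes the matrices a vector space over the complex numbers; \<open>*s\<close> on
  this type would take its scalars from \<open>complex^'n\<close>.\<close>

definition mscale :: "complex \<Rightarrow> complex^'n^'n \<Rightarrow> complex^'n^'n" where
  "mscale c X = (\<chi> i j. c * X $ i $ j)"

interpretation mscale: vector_space mscale
  by unfold_locales (simp_all add: mscale_def vec_eq_iff algebra_simps)

interpretation mscale_pair: vector_space_pair mscale mscale ..

lemma mscale_simps:
  "mscale c X ** Y = mscale c (X ** Y)" "X ** mscale c Y = mscale c (X ** Y)"
  "trace (mscale c X) = c * trace X" "mscale c X *v z = c *s (X *v z)"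
  by (simp_all add: mscale_def vec_eq_iff matrix_matrix_mult_def trace_def matrix_vector_mult_def
      sum_distrib_left mult_ac)

lemma mscale_linearI:
  assumes "\<And>X Y. f (X + Y) = f X + f Y" "\<And>c X. f (mscale c X) = mscale c (f X)"
  shows "Vector_Spaces.linear mscale mscale f"
  using assms by unfold_locales

lemma matrix_distribs:
  fixes A B C :: "complex^'n^'n"
  shows "A ** (B + C) = A ** B + A ** C" "(A + B) ** C = A ** C + B ** C"
    "A ** (B - C) = A ** B - A ** C" "(A - B) ** C = A ** C - B ** C"
  by (simp_all add: vec_eq_iff matrix_matrix_mult_def algebra_simps sum.distrib sum_subtractf)

lemma mscale_linear_mult: "Vector_Spaces.linear mscale mscale (\<lambda>X. A ** X ** B)"
  for A B :: "complex^'n^'n"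
  by (rule mscale_linearI) (simp_all add: mscale_simps matrix_distribs)

text \<open>Differences of torus elements near the identity span the diagonal matrix units.
  Conjugation by unitary matrices and the spectral theorem then give every normal matrix, and each
  matrix is a combination of the normal matrices \<open>X + adjoint_matrix X\<close> and
  \<open>X - adjoint_matrix X\<close>.\<close>

lemma span_special_near:
  assumes n: "CARD('n::finite) \<ge> 2" and r: "r > 0"
  shows "mscale.span (special_near r :: (complex^'n^'n) set) = UNIV"
proof -
  let ?S = "mscale.span (special_near r :: (complex^'n^'n) set)"
  define e where "e = (\<lambda>i j::'n. if j = i then 1 else 0 :: complex)"
  have unit: "U ** diag_mat (e i) ** adjoint_matrix U \<in> ?S"
    if U: "U \<in> unitary_matrices" for U :: "complex^'n^'n" and i
  proof -
    obtain j where j: "j \<noteq> i" using n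
      by (metis One_nat_def UNIV_I card_1_singleton_iff is_singletonI' is_singleton_altdef not_less_eq_eq numeral_2_eq_2 order_refl UNIV_not_empty)
    \<comment> \<open>The bound 1 keeps \<open>t\<close> below \<open>pi\<close>, so that
      \<open>sin t > 0\<close> and \<open>cos t < 1\<close>; this makes the coefficient
      \<open>z\<^sup>2 - (cnj z)\<^sup>2\<close> nonzero.\<close>
    define t where "t = min r 1"
    have t: "0 < t" "t \<le> 1" "t \<le> r" using r by (auto simp: t_def)
    define T where "T = (\<lambda>s::real. torus (\<lambda>k. if k = i then s else if k = j then - s else 0) :: complex^'n^'n)"
    have "(\<Sum>k\<in>UNIV. if k = i then s else if k = j then - s else 0) = (\<Sum>k\<in>{i,j}. if k = i then s else if k = j then - s else 0)" for s :: real
      by (intro sum.mono_neutral_right) auto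
    then have "(\<Sum>k\<in>UNIV. if k = i then s else if k = j then - s else 0) = 0" for s :: real
      using j by simp
    then have "U ** T s ** adjoint_matrix U \<in> special_near r" if "\<bar>s\<bar> \<le> r" for s
      unfolding T_def using that r by (intro special_near_conj_torus U) auto
    then have T: "U ** T s ** adjoint_matrix U \<in> ?S" if "\<bar>s\<bar> \<le> r" for s
      using that by (intro mscale.span_base)
    define z where "z = cis t - 1"
    have "sin t > 0" using t pi_gt3 by (intro sin_gt_zero) auto
    moreover have "cos t < 1" using t pi_gt3 cos_monotone_0_pi[of 0 t] by simp
    ultimately have "sin t * (cos t - 1) \<noteq> 0" by simp
    moreover have "Im (z\<^sup>2 - (cnj z)\<^sup>2) = 4 * (sin t * (cos t - 1))"
      by (simp add: z_def power2_eq_square algebra_simps)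
    ultimately have z: "z\<^sup>2 - (cnj z)\<^sup>2 \<noteq> 0" by (metis mult_eq_0_iff zero_complex.simps(2) zero_neq_numeral)
    have cz: "cis (- t) - 1 = cnj z" by (simp add: z_def cis_cnj)
    \<comment> \<open>\<open>T t - T 0\<close> has entries \<open>z\<close> and \<open>cnj z\<close>
      at \<open>i\<close> and \<open>j\<close>, and \<open>T (- t) - T 0\<close> has them exchanged;
      these coefficients cancel the entry at \<open>j\<close>.\<close>
    have "mscale z (T t - T 0) - mscale (cnj z) (T (- t) - T 0) = mscale (z\<^sup>2 - (cnj z)\<^sup>2) (diag_mat (e i))"
    proof -
      have "(mscale z (T t - T 0) - mscale (cnj z) (T (- t) - T 0)) $ k $ l = mscale (z\<^sup>2 - (cnj z)\<^sup>2) (diag_mat (e i)) $ k $ l" for k l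
        using cz j by (auto simp: mscale_def T_def torus_def diag_mat_def e_def z_def[symmetric] power2_eq_square)
      then show ?thesis by (simp add: vec_eq_iff)
    qed
    then have "diag_mat (e i) = mscale (inverse (z\<^sup>2 - (cnj z)\<^sup>2)) (mscale z (T t - T 0) - mscale (cnj z) (T (- t) - T 0))"
      using z by simp
    moreover have "U ** mscale (inverse (z\<^sup>2 - (cnj z)\<^sup>2)) (mscale z (T t - T 0) - mscale (cnj z) (T (- t) - T 0)) ** adjoint_matrix U \<in> ?S"
      using t T[of t] T[of "-t"] T[of 0] r
      by (simp add: mscale_simps matrix_distribs mscale.span_scale mscale.span_diff)
    ultimately show ?thesis by simp
  qed
  have normal: "A \<in> ?S" if A: "A ** adjoint_matrix A = adjoint_matrix A ** A" for A
  proof -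
    obtain U a where U: "U \<in> unitary_matrices" "A = U ** diag_mat a ** adjoint_matrix U"
      using spectral_normal[OF A] .
    have "diag_mat a = (\<Sum>i\<in>UNIV. mscale (a i) (diag_mat (e i)))"
      by (auto simp: vec_eq_iff mscale_def diag_mat_def e_def if_distrib[of "\<lambda>x. _ * x"] cong: if_cong)
    then have "A = (\<Sum>i\<in>UNIV. mscale (a i) (U ** diag_mat (e i) ** adjoint_matrix U))"
      unfolding U(2) by (simp add: mscale_pair.linear_sum[OF mscale_linear_mult] mscale_simps)
    also have "\<dots> \<in> ?S" using unit[OF U(1)] by (intro mscale.span_sum mscale.span_scale)
    finally show ?thesis .
  qed
  have "X \<in> ?S" for X :: "complex^'n^'n"
  proof -
    have add: "adjoint_matrix (A + B) = adjoint_matrix A + adjoint_matrix B"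
      and sub: "adjoint_matrix (A - B) = adjoint_matrix A - adjoint_matrix B" for A B :: "complex^'n^'n"
      by (simp_all add: adjoint_matrix_def transpose_def vec_eq_iff)
    let ?Y = "adjoint_matrix X"
    have "X + ?Y \<in> ?S" "X - ?Y \<in> ?S"
      by (rule normal; simp add: add sub matrix_distribs)+
    then have "mscale (1/2) ((X + ?Y) + (X - ?Y)) \<in> ?S"
      using mscale.span_add mscale.span_scale by blast
    moreover have "mscale (1/2) ((X + ?Y) + (X - ?Y)) = X" by (simp add: mscale_def vec_eq_iff)
    ultimately show ?thesis by simp
  qed
  then show ?thesis by auto
qed

section \<open>Trace-preserving local homomorphisms\<close>

lemma trace_form_nondegenerate:
  fixes X :: "complex^'n^'n"
  assumes "\<And>Y. trace (X ** Y) = 0" shows "X = 0"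
proof -
  have "X $ i $ j = trace (X ** (\<chi> k l. if k = j then if l = i then 1 else 0 else 0))" for i j
    by (simp add: trace_def matrix_matrix_mult_def if_distrib[of "\<lambda>x. _ * x"] cong: if_cong)
  then show ?thesis using assms by (simp add: vec_eq_iff)
qed

lemma zero_matrix_simps:
  "trace (0 :: complex^'n^'n) = 0" "A ** 0 = (0 :: complex^'n^'n)" "0 ** A = (0 :: complex^'n^'n)"
  by (simp_all add: trace_def matrix_matrix_mult_def vec_eq_iff)

lemma span_UNIV_induct:
  assumes "mscale.span B = UNIV" "P 0" "\<And>c X Y. X \<in> B \<Longrightarrow> P Y \<Longrightarrow> P (mscale c X + Y)"
  shows "P X"
  using mscale.span_induct_alt[of X B P] assms by auto

text \<open>A local homomorphism preserving traces extends to an algebra automorphism because the trace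
  form is nondegenerate; the automorphism is inner by the argument of Skolem and Noether.\<close>

lemma trace_preserving_local_hom_inner:
  fixes M :: "complex^'n^'n \<Rightarrow> complex^'n^'n"
  assumes n: "CARD('n) \<ge> 2" and r: "r > 0"
    and mult: "\<And>A B. A \<in> special_near r \<Longrightarrow> B \<in> special_near r \<Longrightarrow> A ** B \<in> special_near r \<Longrightarrow> M (A ** B) = M A ** M B"
    and tr: "\<And>A. A \<in> special_near r \<Longrightarrow> trace (M A) = trace A"
  obtains C where "invertible C" "\<And>A. A \<in> special_near (r / 2) \<Longrightarrow> M A ** C = C ** A"
proof -
  let ?N = "special_near (r / 4) :: (complex^'n^'n) set"
  have sub: "special_near s \<subseteq> (special_near r :: (complex^'n^'n) set)" if "s \<le> r" for s
    using that by (auto simp: special_near_def intro: near_one_mono)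
  have prod: "A ** B \<in> special_near r" if "A \<in> special_near (r / 2)" "B \<in> ?N" for A B :: "complex^'n^'n"
    using special_near_mult[OF that] sub[of "r / 2 + r / 4"] r by auto
  \<comment> \<open>The radius r / 4 leaves room for products: two elements of \<open>B\<close>
    multiply into radius r / 2, and an element of radius r / 2 times one of \<open>B\<close> still
    lies in \<open>special_near r\<close>.\<close>
  obtain B where B: "B \<subseteq> ?N" "mscale.independent B" "mscale.span B = UNIV"
    using mscale.basis_exists[of ?N] span_special_near[OF n, of "r / 4"] r
    by (metis half_gt_zero_iff mscale.span_eq top.extremum_uniqueI mscale.span_mono mscale.span_span field_sum_of_halves zero_less_divide_iff zero_less_numeral)
  \<comment> \<open>\<open>f\<close> is only known to agree with \<open>M\<close> on the basis.
    Agreement elsewhere must be deduced, since \<open>M\<close> carries no linearity; the pairings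
    \<open>tr1\<close> to \<open>tr3\<close> replace one argument after the other.\<close>
  obtain f where lin: "Vector_Spaces.linear mscale mscale f" and fB: "\<And>X. X \<in> B \<Longrightarrow> f X = M X"
    using mscale_pair.linear_independent_extend[OF B(2), of M] by blast
  have f0: "f 0 = 0" and fadd: "f (X + Y) = f X + f Y" and fsc: "f (mscale c X) = mscale c (f X)" for X Y c
    using mscale_pair.linear_0[OF lin] mscale_pair.linear_add[OF lin] mscale_pair.linear_scale[OF lin] by auto
  have tr1: "trace (M A ** M Y) = trace (A ** Y)" if "A \<in> special_near (r / 2)" "Y \<in> ?N" for A Y
  proof -
    have "A \<in> special_near r" "Y \<in> special_near r" using that sub[of "r / 2"] sub[of "r / 4"] r by auto
    then show ?thesis using prod[OF that] mult[of A Y] tr[of "A ** Y"] by simp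
  qed
  have half: "?N \<subseteq> special_near (r / 2)" using r by (auto simp: special_near_def intro: near_one_mono)
  have tr2: "trace (M A ** f Y) = trace (A ** Y)" if "A \<in> special_near (r / 2)" for A Y
    by (rule span_UNIV_induct[OF B(3)])
      (use B(1) that tr1 in \<open>auto simp: f0 fadd fsc fB matrix_distribs mscale_simps trace_add zero_matrix_simps\<close>)
  have tr3: "trace (f X ** f Y) = trace (X ** Y)" for X Y
    by (rule span_UNIV_induct[OF B(3), where X = X])
      (use B(1) half tr2 in \<open>auto simp: f0 fadd fsc fB matrix_distribs mscale_simps trace_add zero_matrix_simps\<close>)
  have inj: "inj f"
  proof (rule injI)
    fix X Y assume "f X = f Y"
    moreover have "f X = f (X - Y) + f Y" by (simp flip: fadd)
    ultimately have "f (X - Y) = 0" by simp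
    then have "trace ((X - Y) ** Z) = 0" for Z
      using tr3[of "X - Y" Z] by (simp add: zero_matrix_simps)
    then have "X - Y = 0" by (rule trace_form_nondegenerate)
    then show "X = Y" by simp
  qed
  have "linear f"
  proof (rule linearI)
    show "f (r *\<^sub>R X) = r *\<^sub>R f X" for r X
      using fsc[of "of_real r" X] by (simp add: mscale_def scaleR_conv_of_real[symmetric] vec_eq_iff)
        (simp add: scaleR_vec_def scaleR_conv_of_real)
  qed (rule fadd)
  then have surj: "surj f" using inj by (rule linear_injective_imp_surjective) (rule refl)
  \<comment> \<open>\<open>M A\<close> and \<open>f A\<close> have the same trace pairing with every
    \<open>f Y\<close>, and \<open>f\<close> is onto. Once they coincide, multiplicativity of
    \<open>M\<close> passes to \<open>f\<close>.\<close>
  have fM: "f A = M A" if "A \<in> special_near (r / 2)" for A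
  proof -
    have "trace ((M A - f A) ** Z) = 0" for Z
    proof -
      obtain Y where "Z = f Y" using surj by blast
      then show ?thesis using tr2[OF that, of Y] tr3[of A Y] by (simp add: matrix_distribs trace_sub)
    qed
    then have "M A - f A = 0" by (rule trace_form_nondegenerate)
    then show ?thesis by simp
  qed
  have m1: "f (A ** Y) = f A ** f Y" if "A \<in> B" for A Y
  proof (rule span_UNIV_induct[OF B(3), where X = Y])
    show "f (A ** 0) = f A ** f 0" by (simp add: f0 zero_matrix_simps)
  next
    fix c X Y assume X: "X \<in> B" and IH: "f (A ** Y) = f A ** f Y"
    have AN: "A \<in> ?N" "X \<in> ?N" using that X B(1) by auto
    then have "A ** X \<in> special_near (r / 2)" using special_near_mult[OF AN] by simp
    then have "f (A ** X) = f A ** f X"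
      using AN half sub[of "r / 2"] r mult[of A X] by (subst (1 2 3) fM) auto
    then show "f (A ** (mscale c X + Y)) = f A ** f (mscale c X + Y)"
      using IH by (simp add: matrix_distribs fadd fsc mscale_simps)
  qed
  have m2: "f (X ** Y) = f X ** f Y" for X Y
  proof (rule span_UNIV_induct[OF B(3), where X = X])
    show "f (0 ** Y) = f 0 ** f Y" by (simp add: f0 zero_matrix_simps)
  qed (use m1 in \<open>simp add: matrix_distribs fadd fsc mscale_simps\<close>)
  obtain k :: 'n where True by simp
  define e where "e = (\<lambda>i. (\<chi> a b. if b = k then if a = i then 1 else 0 else 0) :: complex^'n^'n)"
  have "e k \<noteq> 0" by (auto simp: e_def vec_eq_iff)
  then have "f (e k) \<noteq> 0" using inj f0 by (metis injD)
  then obtain u where u: "f (e k) *v u \<noteq> 0"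
    by (metis matrix_vector_mul_lid matrix_eq matrix_vector_mult_0)
  \<comment> \<open>The matrix units \<open>e i\<close> fill the column \<open>k\<close> and span a
    left ideal isomorphic to the standard module. \<open>C\<close> is the isomorphism that sends the
    i-th basis vector to \<open>f (e i) *v u\<close>.\<close>
  define C where "C = (\<chi> a b. (f (e b) *v u) $ a)"
  have Xe: "X ** e j = (\<Sum>i\<in>UNIV. mscale (X $ i $ j) (e i))" for X j
  proof -
    have "(X ** e j) $ a $ b = (\<Sum>i\<in>UNIV. mscale (X $ i $ j) (e i)) $ a $ b" for a b
      by (cases "b = k") (simp_all add: e_def mscale_def matrix_matrix_mult_def if_distrib[of "\<lambda>x. _ * x"] cong: if_cong)
    then show ?thesis by (simp add: vec_eq_iff)
  qed
  have inter: "f X ** C = C ** X" for X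
  proof -
    have "(f X ** C) $ a $ j = (C ** X) $ a $ j" for a j
    proof -
      have "(f X ** C) $ a $ j = (f X *v (f (e j) *v u)) $ a"
        by (simp add: C_def matrix_matrix_mult_def matrix_vector_mult_def)
      also have "\<dots> = (f (X ** e j) *v u) $ a" by (simp add: m2 matrix_vector_mul_assoc)
      also have "f (X ** e j) = (\<Sum>i\<in>UNIV. mscale (X $ i $ j) (f (e i)))"
        unfolding Xe by (simp add: mscale_pair.linear_sum[OF lin] fsc)
      also have "(\<dots> *v u) $ a = (\<Sum>i\<in>UNIV. (f (e i) *v u) $ a * X $ i $ j)"
      proof -
        have "(\<Sum>i\<in>S. mscale (X $ i $ j) (f (e i))) *v u = (\<Sum>i\<in>S. X $ i $ j *s (f (e i) *v u))" if "finite S" for S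
          using that by induction (auto simp: matrix_vector_mult_add_rdistrib mscale_simps)
        then show ?thesis by (simp add: mult.commute)
      qed
      also have "\<dots> = (C ** X) $ a $ j" by (simp add: C_def matrix_matrix_mult_def)
      finally show ?thesis .
    qed
    then show ?thesis by (simp add: vec_eq_iff)
  qed
  have "invertible C"
    unfolding invertible_left_inverse matrix_left_invertible_ker
  proof (intro allI impI)
    fix w assume w: "C *v w = 0"
    show "w = 0"
    proof (rule ccontr)
      assume "w \<noteq> 0"
      then obtain j where j: "w $ j \<noteq> 0" by (auto simp: vec_eq_iff)
      \<comment> \<open>\<open>X\<close> carries \<open>w\<close> to the basis vector of index
        \<open>k\<close>, so a kernel vector \<open>w\<close> of \<open>C\<close> would also force
        \<open>f (e k) *v u\<close> to vanish.\<close>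
      define X :: "complex^'n^'n" where "X = (\<chi> a b. if b = j then if a = k then inverse (w $ j) else 0 else 0)"
      have "X *v w = axis k 1"
        using j by (auto simp: X_def vec_eq_iff matrix_vector_mult_def axis_def if_distrib[of "\<lambda>x. x * _"] cong: if_cong)
      moreover have "f X *v (C *v w) = C *v (X *v w)"
        by (simp add: matrix_vector_mul_assoc inter)
      ultimately have "C *v axis k 1 = f X *v (C *v w)" by simp
      moreover have "C *v axis k 1 = f (e k) *v u" by (simp add: C_def vec_eq_iff matrix_vector_mult_def[of "vec_lambda _"] axis_def if_distrib[of "\<lambda>x. _ * x"] cong: if_cong)
      ultimately show False using u w by simp
    qed
  qed
  then show ?thesis using that[of C] inter fM by metis
qed

section \<open>Lifting the unitary group to linear maps\<close>

text \<open>Powers with respect to \<open>**\<close>; the product \<open>*\<close> on this type is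
  entrywise.\<close>

definition mpow :: "complex^'n^'n \<Rightarrow> nat \<Rightarrow> complex^'n^'n" where
  "mpow A k = (((**) A) ^^ k) (mat 1)"

lemma mpow_simps [simp]: "mpow A 0 = mat 1" "mpow A (Suc k) = A ** mpow A k"
  by (simp_all add: mpow_def)

lemma mpow_eigenvector: "A *v v = l *s v \<Longrightarrow> mpow A k *v v = l ^ k *s v"
  by (induction k) (simp_all add: mv_scale mult.commute vector_smult_assoc flip: matrix_vector_mul_assoc)

lemma mpow_intertwine: "A ** C = C ** B \<Longrightarrow> mpow A k ** C = C ** mpow B k"
proof (induction k)
  case (Suc k)
  then have "mpow A (Suc k) ** C = A ** (C ** mpow B k)" by (simp flip: matrix_mul_assoc)
  also have "\<dots> = C ** (B ** mpow B k)" by (simp add: matrix_mul_assoc Suc.prems)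
  finally show ?case by simp
qed simp

lemma mpow_torus: "mpow (torus \<theta>) k = torus (\<lambda>i. real k * \<theta> i)"
proof (induction k)
  case (Suc k)
  then show ?case by (simp add: torus_add algebra_simps)
qed (simp add: torus_def diag_mat_one)

lemma torus_zero: "torus (\<lambda>_. 0) = mat 1"
  by (simp add: torus_def diag_mat_one)

lemma conj_mult:
  assumes "U \<in> unitary_matrices"
  shows "(U ** X ** adjoint_matrix U) ** (U ** Y ** adjoint_matrix U) = U ** (X ** Y) ** adjoint_matrix U"
proof -
  have "(U ** X ** adjoint_matrix U) ** (U ** Y ** adjoint_matrix U) = U ** X ** (adjoint_matrix U ** U) ** Y ** adjoint_matrix U"
    by (simp only: matrix_mul_assoc)
  then show ?thesis by (simp add: unitary_inverse[OF assms] matrix_mul_assoc)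
qed

lemma mpow_conj:
  assumes "U \<in> unitary_matrices"
  shows "mpow (U ** X ** adjoint_matrix U) k = U ** mpow X k ** adjoint_matrix U"
  by (induction k) (simp_all add: conj_mult assms unitary_inverse)

lemma unitary_conj_torus:
  "U \<in> unitary_matrices \<Longrightarrow> U ** torus \<theta> ** adjoint_matrix U \<in> unitary_matrices"
  by (simp add: unitary_matrices_mult torus_unitary adjoint_unitary)

text \<open>The angles come from the principal logarithm, so one choice is small whenever
  \<open>A\<close> is close to the identity; the factor 2 and the range below 1/2 are those of the
  estimate for \<open>Ln (1 + z)\<close>.\<close>

lemma unitary_spectral:
  fixes A :: "complex^'n^'n"
  assumes A: "A \<in> unitary_matrices"
  obtains U \<theta> where "U \<in> unitary_matrices" "A = U ** torus \<theta> ** adjoint_matrix U"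
    "\<And>r i. near_one r A \<Longrightarrow> r < 1/2 \<Longrightarrow> \<bar>\<theta> i\<bar> \<le> 2 * r"
proof -
  obtain U a where U: "U \<in> unitary_matrices" "A = U ** diag_mat a ** adjoint_matrix U"
    using spectral_normal[of A] A by (auto simp: unitary_inverse)
  have D: "diag_mat a = adjoint_matrix U ** A ** adjoint_matrix (adjoint_matrix U)"
  proof -
    have "adjoint_matrix U ** A ** U = (adjoint_matrix U ** U) ** diag_mat a ** (adjoint_matrix U ** U)"
      unfolding U(2) by (simp only: matrix_mul_assoc)
    then show ?thesis using U by (simp add: unitary_inverse)
  qed
  then have D': "diag_mat a \<in> unitary_matrices"
    unfolding D using A U by (intro unitary_matrices_mult adjoint_unitary) auto
  have ax: "diag_mat a *v axis i 1 = a i *s axis i 1" for i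
    by (simp add: vec_eq_iff diag_mat_mv axis_def)
  have na: "norm (a i) = 1" for i
    using norm_unitary_mv[OF D', of "axis i 1"] by (simp add: ax norm_cvec_scale)
  define \<theta> where "\<theta> = (\<lambda>i. Im (Ln (a i)))"
  have "cis (\<theta> i) = a i" for i
  proof -
    have "a i \<noteq> 0" using na[of i] by auto
    then have "Re (Ln (a i)) = 0" using na[of i] by simp
    then have "Ln (a i) = \<i> * of_real (\<theta> i)" by (simp add: \<theta>_def complex_eq_iff)
    then show ?thesis using exp_Ln[OF \<open>a i \<noteq> 0\<close>] by (simp add: cis_conv_exp)
  qed
  then have "torus \<theta> = diag_mat a" by (simp add: torus_def)
  moreover have "\<bar>\<theta> i\<bar> \<le> 2 * r" if "near_one r A" "r < 1/2" for r i
  proof -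
    have "near_one r (diag_mat a)"
      unfolding D using near_one_conj[of "adjoint_matrix U"] that U adjoint_unitary by blast
    then have "norm ((a i - 1) *s axis i (1::complex)) \<le> r * norm (axis i (1::complex))"
      unfolding near_one_def by (metis ax vector_sub_rdistrib vector_smult_lid)
    then have n: "norm (a i - 1) \<le> r" unfolding norm_cvec_scale by simp
    have "\<bar>\<theta> i\<bar> \<le> norm (Ln (1 + (a i - 1)))" by (simp add: \<theta>_def abs_Im_le_cmod)
    also have "\<dots> \<le> 2 * norm (a i - 1)" by (rule norm_Ln_le) (use n that in simp)
    finally show ?thesis using n by simp
  qed
  ultimately show ?thesis using that[of U \<theta>] U by simp
qed

text \<open>Provides the roots near the identity by which local statements are extended to all
  unitary matrices.\<close>

lemma divide_angles:
  fixes \<theta> :: "'n::finite \<Rightarrow> real"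
  assumes "r > 0" obtains N where "N > 0" "\<And>i. \<bar>\<theta> i / real N\<bar> < r"
proof -
  obtain N where N: "(\<Sum>i\<in>UNIV. \<bar>\<theta> i\<bar>) < real N * r" using ex_less_of_nat_mult[OF assms] by blast
  moreover have "0 \<le> (\<Sum>i\<in>UNIV. \<bar>\<theta> i\<bar>)" by (simp add: sum_nonneg)
  ultimately have "0 < real N * r" by linarith
  then have N0: "N > 0" using assms by (simp add: zero_less_mult_iff)
  have "\<bar>\<theta> i / real N\<bar> < r" for i
  proof -
    have "\<bar>\<theta> i\<bar> \<le> (\<Sum>i\<in>UNIV. \<bar>\<theta> i\<bar>)" by (intro member_le_sum) auto
    then show ?thesis using N N0 by (simp add: abs_divide field_simps)
  qed
  then show ?thesis using that N0 by blast
qed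

lemma matrix_norm_bound:
  fixes g :: "complex^'n^'n"
  obtains K where "K > 0" "\<And>z. norm (g *v z) \<le> K * norm z"
proof -
  have "bounded_linear ((*v) g)"
    unfolding linear_conv_bounded_linear[symmetric]
    by (rule linearI) (simp_all add: matrix_vector_right_distrib matrix_vector_mult_def vec_eq_iff scaleR_sum_right algebra_simps sum.distrib)
  then show ?thesis using bounded_linear.pos_bounded[of "(*v) g"] that by (auto simp: mult.commute)
qed

text \<open>The interface between geometry and linear algebra: \<open>lifts A g\<close> stands for a
  linear map \<open>g\<close> covering the action of \<open>A\<close>, and \<open>\<Gamma>\<close>
  for the deck scalars. Lifts are required to exist only near the identity.\<close>

locale linear_lift =
  fixes lifts :: "complex^'n^'n \<Rightarrow> complex^'n^'n \<Rightarrow> bool" and \<Gamma> :: "complex set"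
  assumes card2: "CARD('n) \<ge> 2"
    and lift_one: "lifts (mat 1) (mat 1)"
    and lift_mult: "lifts A g \<Longrightarrow> lifts B h \<Longrightarrow> lifts (A ** B) (g ** h)"
    and lift_unitary: "lifts A g \<Longrightarrow> A \<in> unitary_matrices"
    and lift_inverse: "lifts A g \<Longrightarrow> \<exists>h. g ** h = mat 1 \<and> h ** g = mat 1 \<and> lifts (adjoint_matrix A) h"
    and lift_unique: "lifts A g \<Longrightarrow> lifts A h \<Longrightarrow> \<exists>\<gamma>\<in>\<Gamma>. h = mscale \<gamma> g"
    and discrete: "\<exists>\<eta>>0. \<forall>\<gamma>\<in>\<Gamma>. norm (\<gamma> - 1) < \<eta> \<longrightarrow> \<gamma> = 1"
    and lift_near: "\<epsilon> > 0 \<Longrightarrow> \<exists>r>0. \<forall>A\<in>unitary_matrices. near_one r A \<longrightarrow> (\<exists>g. lifts A g \<and> near_one \<epsilon> g)"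
    and effective: "lifts A (mat 1) \<Longrightarrow> A = mat 1"
begin

lemma lift_mpow: "lifts A g \<Longrightarrow> lifts (mpow A k) (mpow g k)"
  by (induction k) (auto simp: lift_one lift_mult)

text \<open>Two lifts of the same matrix differ by some \<open>\<gamma>\<close>. On a unit vector
  both move by at most \<open>\<epsilon>\<close>, so
  \<open>norm (\<gamma> - 1) * norm (g *v z)\<close> is at most 2 \<open>\<epsilon>\<close> while
  \<open>norm (g *v z)\<close> is at least 1/2. Hence \<open>4 * \<epsilon> < \<eta>\<close> forces
  \<open>\<gamma> = 1\<close>.\<close>

lemma near_lift_unique:
  obtains \<epsilon> where "\<epsilon> > 0" "\<epsilon> \<le> 1/4"
    "\<And>A g h. lifts A g \<Longrightarrow> lifts A h \<Longrightarrow> near_one \<epsilon> g \<Longrightarrow> near_one \<epsilon> h \<Longrightarrow> g = h"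
proof -
  obtain \<eta> where \<eta>: "\<eta> > 0" "\<And>\<gamma>. \<gamma> \<in> \<Gamma> \<Longrightarrow> norm (\<gamma> - 1) < \<eta> \<Longrightarrow> \<gamma> = 1" using discrete by blast
  define \<epsilon> where "\<epsilon> = min (1/4) (\<eta> / 8)"
  have \<epsilon>: "\<epsilon> > 0" "\<epsilon> \<le> 1/4" "4 * \<epsilon> < \<eta>" using \<eta> by (auto simp: \<epsilon>_def)
  show ?thesis
  proof (rule that[OF \<epsilon>(1,2)])
    fix A g h assume l: "lifts A g" "lifts A h" and n: "near_one \<epsilon> g" "near_one \<epsilon> h"
    obtain \<gamma> where \<gamma>: "\<gamma> \<in> \<Gamma>" "h = mscale \<gamma> g" using lift_unique[OF l] by blast
    define z :: "complex^'n" where "z = axis undefined 1"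
    have z: "norm z = 1" by (simp add: z_def)
    have ng: "norm (g *v z - z) \<le> \<epsilon>" "norm (h *v z - z) \<le> \<epsilon>" using n z by (metis mult.right_neutral near_one_def)+
    have "(\<gamma> - 1) *s (g *v z) = (h *v z - z) - (g *v z - z)" by (simp add: \<gamma> mscale_simps vector_sub_rdistrib)
    then have "norm (\<gamma> - 1) * norm (g *v z) \<le> 2 * \<epsilon>"
      using norm_triangle_ineq4[of "h *v z - z" "g *v z - z"] ng by (simp flip: norm_cvec_scale)
    moreover have "1/2 \<le> norm (g *v z)" using norm_triangle_ineq2[of z "g *v z"] ng z \<epsilon> by (simp add: norm_minus_commute)
    then have "norm (\<gamma> - 1) * (1/2) \<le> norm (\<gamma> - 1) * norm (g *v z)" by (intro mult_left_mono) auto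
    ultimately have "norm (\<gamma> - 1) < \<eta>" using \<epsilon> by linarith
    then have "\<gamma> = 1" using \<eta> \<gamma> by blast
    then show "g = h" by (simp add: \<gamma>)
  qed
qed

end

text \<open>For matrices that are not isometries the mixed term a * b is absorbed into b. Two
  factors of radius \<open>\<epsilon> / 3\<close> therefore have a product of radius
  \<open>\<epsilon>\<close>.\<close>

lemma near_one_mult':
  assumes "near_one a g" "near_one b h" "a \<le> 1" "0 \<le> a" "0 \<le> b"
  shows "near_one (a + 2 * b) (g ** h)"
  unfolding near_one_def
proof
  fix z
  have "norm (h *v z) \<le> norm (h *v z - z) + norm z" by (metis diff_add_cancel norm_triangle_ineq)
  then have h: "norm (h *v z) \<le> (b + 1) * norm z" "norm (h *v z - z) \<le> b * norm z"
    using assms(2) by (auto simp: near_one_def algebra_simps intro: order_trans)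
  have "norm ((g ** h) *v z - z) \<le> norm (g *v (h *v z) - h *v z) + norm (h *v z - z)"
    by (metis diff_add_cancel add_diff_eq matrix_vector_mul_assoc norm_triangle_ineq)
  also have "\<dots> \<le> a * norm (h *v z) + b * norm z" using assms h by (intro add_mono) (auto simp: near_one_def)
  also have "\<dots> \<le> a * ((b + 1) * norm z) + b * norm z" using h assms by (intro add_mono mult_left_mono) auto
  also have "\<dots> = (a * b + a + b) * norm z" by (simp add: algebra_simps)
  also have "\<dots> \<le> (a + 2 * b) * norm z"
    using mult_right_mono[of a 1 b] assms by (intro mult_right_mono) auto
  finally show "norm ((g ** h) *v z - z) \<le> (a + 2 * b) * norm z" .
qed

text \<open>\<open>L\<close> selects the small lift. Commutation is stated without a bound on the
  product, because weights need commuting lifts for all small angles. In the conjugation rule the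
  radius depends on \<open>g\<close>, as conjugation by a lift may stretch displacements. The bound
  1/4 keeps eigenvalues of \<open>L A\<close> where the logarithm is controlled.\<close>

locale local_section = linear_lift lifts \<Gamma>
  for lifts :: "complex^'n^'n \<Rightarrow> complex^'n^'n \<Rightarrow> bool" and \<Gamma> +
  fixes r :: real and L :: "complex^'n^'n \<Rightarrow> complex^'n^'n"
  assumes r: "0 < r" "r < 1/2"
    and lifts_L: "A \<in> unitary_matrices \<Longrightarrow> near_one r A \<Longrightarrow> lifts A (L A)"
    and near_L: "A \<in> unitary_matrices \<Longrightarrow> near_one r A \<Longrightarrow> near_one (1/4) (L A)"
    and L_mult: "A \<in> unitary_matrices \<Longrightarrow> near_one r A \<Longrightarrow> B \<in> unitary_matrices \<Longrightarrow> near_one r B \<Longrightarrow>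
        near_one r (A ** B) \<Longrightarrow> L (A ** B) = L A ** L B"
    and L_commute: "A \<in> unitary_matrices \<Longrightarrow> near_one r A \<Longrightarrow> B \<in> unitary_matrices \<Longrightarrow> near_one r B \<Longrightarrow>
        A ** B = B ** A \<Longrightarrow> L A ** L B = L B ** L A"
    and L_conj: "lifts U g \<Longrightarrow> \<exists>s>0. \<forall>A\<in>unitary_matrices. near_one s A \<longrightarrow>
        L (U ** A ** adjoint_matrix U) ** g = g ** L A"

text \<open>Each identity compares two lifts of one matrix, both within \<open>\<epsilon>\<close> of
  the identity, and follows from uniqueness.\<close>

lemma (in linear_lift) local_section_exists: "\<exists>r L. local_section lifts \<Gamma> r L"
proof -
  obtain \<epsilon> where \<epsilon>: "\<epsilon> > 0" "\<epsilon> \<le> 1/4"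
    and uni: "\<And>A g h. lifts A g \<Longrightarrow> lifts A h \<Longrightarrow> near_one \<epsilon> g \<Longrightarrow> near_one \<epsilon> h \<Longrightarrow> g = h"
    using near_lift_unique by blast
  obtain r0 where r0: "r0 > 0" "\<And>A. A \<in> unitary_matrices \<Longrightarrow> near_one r0 A \<Longrightarrow> \<exists>g. lifts A g \<and> near_one (\<epsilon>/3) g"
    using lift_near[of "\<epsilon>/3"] \<epsilon> by auto
  define r where "r = min r0 (1/3)"
  define L where "L = (\<lambda>A. SOME g. lifts A g \<and> near_one (\<epsilon>/3) g)"
  have L: "lifts A (L A)" "near_one (\<epsilon>/3) (L A)" if "A \<in> unitary_matrices" "near_one r A" for A
  proof -
    have "\<exists>g. lifts A g \<and> near_one (\<epsilon>/3) g" using r0 that near_one_mono[of r A r0] by (auto simp: r_def)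
    then have "lifts A (L A) \<and> near_one (\<epsilon>/3) (L A)" unfolding L_def by (rule someI_ex)
    then show "lifts A (L A)" "near_one (\<epsilon>/3) (L A)" by auto
  qed
  have L': "near_one \<epsilon> (L A)" if "A \<in> unitary_matrices" "near_one r A" for A
    using near_one_mono[OF L(2)[OF that]] \<epsilon> by simp
  have prod: "near_one \<epsilon> (L A ** L B)" if "A \<in> unitary_matrices" "near_one r A" "B \<in> unitary_matrices" "near_one r B" for A B
    using near_one_mult'[OF L(2)[OF that(1,2)] L(2)[OF that(3,4)]] \<epsilon> by simp
  have "local_section lifts \<Gamma> r L"
  proof
    show "0 < r" "r < 1/2" using r0 by (auto simp: r_def)
    show "lifts A (L A)" if "A \<in> unitary_matrices" "near_one r A" for A by (rule L(1)[OF that])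
    show "near_one (1/4) (L A)" if "A \<in> unitary_matrices" "near_one r A" for A
      using near_one_mono[OF L(2)[OF that], of "1/4"] \<epsilon> by simp
    show "L (A ** B) = L A ** L B"
      if "A \<in> unitary_matrices" "near_one r A" "B \<in> unitary_matrices" "near_one r B" "near_one r (A ** B)" for A B
      using that prod[OF that(1-4)] L L' by (intro uni[of "A ** B"] lift_mult) (auto simp: unitary_matrices_mult)
    show "L A ** L B = L B ** L A"
      if "A \<in> unitary_matrices" "near_one r A" "B \<in> unitary_matrices" "near_one r B" "A ** B = B ** A" for A B
    proof (rule uni[of "A ** B"])
      show "lifts (A ** B) (L A ** L B)" using that L by (intro lift_mult) auto
      show "lifts (A ** B) (L B ** L A)" unfolding that(5) using that L by (intro lift_mult) auto
    qed (use that prod in auto)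
    show "\<exists>s>0. \<forall>A\<in>unitary_matrices. near_one s A \<longrightarrow> L (U ** A ** adjoint_matrix U) ** g = g ** L A"
      if Ug: "lifts U g" for U g
    proof -
      have U: "U \<in> unitary_matrices" by (rule lift_unitary[OF Ug])
      obtain h where h: "g ** h = mat 1" "h ** g = mat 1" "lifts (adjoint_matrix U) h"
        using lift_inverse[OF Ug] by blast
      obtain K1 where K1: "K1 > 0" "\<And>z. norm (g *v z) \<le> K1 * norm z" using matrix_norm_bound by blast
      obtain K2 where K2: "K2 > 0" "\<And>z. norm (h *v z) \<le> K2 * norm z" using matrix_norm_bound by blast
      \<comment> \<open>Conjugation by \<open>g\<close> enlarges a displacement bound at most by the
        factor \<open>K1 * K2\<close>.\<close>
      define \<delta> where "\<delta> = min \<epsilon> (\<epsilon> / (K1 * K2))"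
      have \<delta>: "\<delta> > 0" "\<delta> \<le> \<epsilon>" "K1 * \<delta> * K2 \<le> \<epsilon>"
      proof -
        show "\<delta> > 0" "\<delta> \<le> \<epsilon>" using \<epsilon> K1 K2 by (auto simp: \<delta>_def)
        have "K1 * K2 * \<delta> \<le> K1 * K2 * (\<epsilon> / (K1 * K2))" using K1 K2 by (intro mult_left_mono) (auto simp: \<delta>_def)
        then show "K1 * \<delta> * K2 \<le> \<epsilon>" using K1 K2 by (simp add: mult_ac)
      qed
      obtain s0 where s0: "s0 > 0" "\<And>A. A \<in> unitary_matrices \<Longrightarrow> near_one s0 A \<Longrightarrow> \<exists>g. lifts A g \<and> near_one \<delta> g"
        using lift_near[OF \<delta>(1)] by auto
      have "L (U ** A ** adjoint_matrix U) ** g = g ** L A"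
        if A: "A \<in> unitary_matrices" "near_one (min s0 r) A" for A
      proof -
        have Ar: "near_one r A" "near_one s0 A" using near_one_mono[OF A(2)] by auto
        have UA: "U ** A ** adjoint_matrix U \<in> unitary_matrices" "near_one r (U ** A ** adjoint_matrix U)"
          using U A Ar by (simp_all add: near_one_conj unitary_matrices_mult adjoint_unitary)
        obtain k where k: "lifts A k" "near_one \<delta> k" using s0(2) A Ar by blast
        have "k = L A" using uni[OF k(1) L(1)[OF A(1) Ar(1)]] near_one_mono[OF k(2) \<delta>(2)] L'[OF A(1) Ar(1)] by blast
        have "near_one \<epsilon> (g ** L A ** h)"
          unfolding near_one_def
        proof
          fix z
          have "(g ** L A ** h) *v z - z = g *v (k *v (h *v z) - h *v z)"
            by (simp add: \<open>k = L A\<close> matrix_vector_mult_diff_distrib matrix_vector_mul_assoc matrix_mul_assoc h)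
          also have "norm \<dots> \<le> K1 * norm (k *v (h *v z) - h *v z)" by (rule K1)
          also have "\<dots> \<le> K1 * (\<delta> * (K2 * norm z))"
          proof (intro mult_left_mono)
            have "norm (k *v (h *v z) - h *v z) \<le> \<delta> * norm (h *v z)" using k by (simp add: near_one_def)
            also have "\<dots> \<le> \<delta> * (K2 * norm z)" using K2 \<delta> by (intro mult_left_mono) auto
            finally show "norm (k *v (h *v z) - h *v z) \<le> \<delta> * (K2 * norm z)" .
          qed (use K1 in simp)
          also have "\<dots> \<le> \<epsilon> * norm z" using mult_right_mono[OF \<delta>(3) norm_ge_zero[of z]] by (simp add: mult_ac)
          finally show "norm ((g ** L A ** h) *v z - z) \<le> \<epsilon> * norm z" .
        qed
        moreover have "lifts (U ** A ** adjoint_matrix U) (g ** L A ** h)"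
          using lift_mult[OF lift_mult[OF Ug L(1)[OF A(1) Ar(1)]] h(3)] .
        ultimately have "L (U ** A ** adjoint_matrix U) = g ** L A ** h"
          using uni L(1)[OF UA] L'[OF UA] by blast
        then show ?thesis by (simp add: h flip: matrix_mul_assoc)
      qed
      then show ?thesis using s0 r0 by (intro exI[of _ "min s0 r"]) (auto simp: r_def)
    qed
  qed
  then show ?thesis by blast
qed

section \<open>Weights of the torus\<close>

context local_section
begin

definition small :: "('n \<Rightarrow> real) \<Rightarrow> bool" where
  "small \<theta> \<longleftrightarrow> (\<forall>i. \<bar>\<theta> i\<bar> < r)"

definition T :: "('n \<Rightarrow> real) \<Rightarrow> complex^'n^'n" where
  "T \<theta> = L (torus \<theta>)"

lemma small_torus: "small \<theta> \<Longrightarrow> near_one r (torus \<theta>)"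
  by (rule near_one_torus) (auto simp: small_def intro: less_imp_le)

lemma small_scale:
  assumes "small (\<lambda>i. real N * \<theta> i)" "k \<le> N" shows "small (\<lambda>i. real k * \<theta> i)"
  unfolding small_def
proof
  fix i
  have "\<bar>real k * \<theta> i\<bar> \<le> \<bar>real N * \<theta> i\<bar>" using assms(2) by (auto simp: abs_mult intro!: mult_right_mono)
  then show "\<bar>real k * \<theta> i\<bar> < r" using assms(1) unfolding small_def by (meson le_less_trans)
qed

lemma lifts_T: "small \<theta> \<Longrightarrow> lifts (torus \<theta>) (T \<theta>)"
  by (simp add: T_def lifts_L torus_unitary small_torus)

lemma T_add:
  assumes "small \<theta>" "small \<phi>" "small (\<lambda>i. \<theta> i + \<phi> i)"
  shows "T (\<lambda>i. \<theta> i + \<phi> i) = T \<theta> ** T \<phi>"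
  unfolding T_def torus_add[symmetric]
  by (rule L_mult) (use assms small_torus in \<open>auto simp: torus_unitary torus_add\<close>)

lemma T_commute:
  assumes "small \<theta>" "small \<phi>" shows "T \<theta> ** T \<phi> = T \<phi> ** T \<theta>"
  unfolding T_def
  by (rule L_commute) (use assms small_torus in \<open>auto simp: torus_unitary torus_add add.commute\<close>)

lemma L_one: "L (mat 1) = mat 1"
proof -
  have n: "near_one r (mat 1 :: complex^'n^'n)" using r by (simp add: near_one_def)
  have u: "mat 1 \<in> (unitary_matrices :: (complex^'n^'n) set)" by (simp add: unitary_matrices_def)
  have "L (mat 1) ** L (mat 1) = L (mat 1)" using L_mult[of "mat 1" "mat 1"] n u by simp
  moreover obtain h where "L (mat 1) ** h = mat 1" using lift_inverse[OF lifts_L[OF u n]] by blast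
  ultimately show ?thesis by (metis matrix_mul_assoc matrix_mul_rid)
qed

lemma L_conj_mpow:
  assumes U: "U \<in> unitary_matrices" and s: "small (\<lambda>i. real N * \<theta> i)" and k: "k \<le> N"
  shows "L (U ** torus (\<lambda>i. real k * \<theta> i) ** adjoint_matrix U) = mpow (L (U ** torus \<theta> ** adjoint_matrix U)) k"
  using k
proof (induction k)
  case 0
  then show ?case by (simp add: torus_zero unitary_inverse[OF U] L_one)
next
  case (Suc k)
  let ?c = "\<lambda>\<theta>. U ** torus \<theta> ** adjoint_matrix U"
  have near: "near_one r (?c (\<lambda>i. real j * \<theta> i))" if "j \<le> N" for j
    using small_torus[OF small_scale[OF s that]] near_one_conj[OF U] by blast
  have eq: "?c (\<lambda>i. real (Suc k) * \<theta> i) = ?c \<theta> ** ?c (\<lambda>i. real k * \<theta> i)"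
    by (simp add: conj_mult[OF U] torus_add algebra_simps)
  have "L (?c (\<lambda>i. real (Suc k) * \<theta> i)) = L (?c \<theta>) ** L (?c (\<lambda>i. real k * \<theta> i))"
    unfolding eq
    by (rule L_mult) (use Suc.prems near[of 1] near[of k] near[of "Suc k"] eq in \<open>simp_all add: unitary_conj_torus[OF U]\<close>)
  then show ?case using Suc by simp
qed

lemma T_mpow:
  assumes "small (\<lambda>i. real N * \<theta> i)" shows "T (\<lambda>i. real N * \<theta> i) = mpow (T \<theta>) N"
  using L_conj_mpow[OF _ assms order_refl, of "mat 1"] by (simp add: T_def unitary_matrices_def)

text \<open>The conjugation rule holds only in a neighbourhood depending on \<open>g\<close>. It is
  applied to \<open>\<theta>\<close> divided by N, and the N-th power of the intertwining relation
  restores \<open>\<theta>\<close>.\<close>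

lemma L_conj_torus:
  assumes lU: "lifts U g" and \<theta>: "small \<theta>"
  shows "L (U ** torus \<theta> ** adjoint_matrix U) ** g = g ** T \<theta>"
proof -
  have U: "U \<in> unitary_matrices" by (rule lift_unitary[OF lU])
  obtain s where s: "s > 0" "\<And>A. A \<in> unitary_matrices \<Longrightarrow> near_one s A \<Longrightarrow>
        L (U ** A ** adjoint_matrix U) ** g = g ** L A" using L_conj[OF lU] by blast
  obtain N where N: "N > 0" "\<And>i. \<bar>\<theta> i / real N\<bar> < s" using divide_angles[OF s(1)] by blast
  let ?\<phi> = "\<lambda>i. \<theta> i / real N"
  have eq: "(\<lambda>i. real N * ?\<phi> i) = \<theta>" using N by simp
  have "L (U ** torus ?\<phi> ** adjoint_matrix U) ** g = g ** T ?\<phi>"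
    unfolding T_def using N by (intro s torus_unitary near_one_torus) (simp add: less_imp_le)
  from mpow_intertwine[OF this, of N] show ?thesis
    using L_conj_mpow[OF U, of N ?\<phi> N] T_mpow[of N ?\<phi>] \<theta> unfolding eq by simp
qed

text \<open>A unitary matrix is a power of one near the identity, and powers of lifts are
  lifts.\<close>

lemma every_unitary_lifts:
  assumes "A \<in> unitary_matrices" obtains g where "lifts A g"
proof -
  obtain V \<theta> where V: "V \<in> unitary_matrices" "A = V ** torus \<theta> ** adjoint_matrix V"
    using unitary_spectral[OF assms] by metis
  obtain N where N: "N > 0" "\<And>i. \<bar>\<theta> i / real N\<bar> < r" using divide_angles[OF r(1)] by blast
  let ?B = "V ** torus (\<lambda>i. \<theta> i / real N) ** adjoint_matrix V"
  have "near_one r ?B" unfolding near_one_conj[OF V(1)] using N by (intro near_one_torus) (simp add: less_imp_le)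
  then have "lifts (mpow ?B N) (mpow (L ?B) N)"
    by (intro lift_mpow lifts_L unitary_conj_torus V)
  then show ?thesis using that N by (simp add: mpow_conj V mpow_torus)
qed

text \<open>\<open>c\<close> is the differential of a character of the torus, known only for small
  angles; nothing yet makes its values imaginary.\<close>

definition weight :: "('n \<Rightarrow> complex) \<Rightarrow> complex^'n \<Rightarrow> bool" where
  "weight c v \<longleftrightarrow> v \<noteq> 0 \<and> (\<forall>\<theta>. small \<theta> \<longrightarrow> T \<theta> *v v = exp (\<Sum>j\<in>UNIV. of_real (\<theta> j) * c j) *s v)"

text \<open>The eigenvalue stays within 1/4 of 1, so its logarithm has norm at most 1/2. Sums of two
  such logarithms have imaginary part below \<open>pi\<close>, so the logarithm is additive, hence
  linear along each coordinate axis and then in all angles.\<close>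

lemma joint_eigenvector_weight:
  assumes v0: "v \<noteq> 0" and ev: "\<And>\<theta>. small \<theta> \<Longrightarrow> \<exists>l. T \<theta> *v v = l *s v"
  obtains c where "weight c v"
proof -
  define l where "l = (\<lambda>\<theta>. SOME l. T \<theta> *v v = l *s v)"
  have l: "T \<theta> *v v = l \<theta> *s v" if "small \<theta>" for \<theta>
    unfolding l_def using ev[OF that] by (rule someI_ex)
  have inj: "a = b" if "a *s v = b *s v" for a b
    using that v0 by (metis cvec_scale_eq_0 eq_iff_diff_eq_0 vector_sub_rdistrib)
  have near: "norm (l \<theta> - 1) \<le> 1/4" if "small \<theta>" for \<theta>
  proof -
    have "near_one (1/4) (T \<theta>)" unfolding T_def by (intro near_L torus_unitary small_torus that)
    then have "norm ((l \<theta> - 1) *s v) \<le> 1/4 * norm v"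
      unfolding near_one_def by (metis l[OF that] vector_sub_rdistrib vector_smult_lid)
    then show ?thesis using v0 unfolding norm_cvec_scale by (simp del: mult_le_cancel_right_pos add: mult_le_cancel_right)
  qed
  define f where "f = (\<lambda>\<theta>. Ln (l \<theta>))"
  have f: "norm (f \<theta>) \<le> 1/2" "exp (f \<theta>) = l \<theta>" if "small \<theta>" for \<theta>
  proof -
    have "norm (Ln (1 + (l \<theta> - 1))) \<le> 2 * norm (l \<theta> - 1)"
      by (rule norm_Ln_le) (use near[OF that] in simp)
    then show "norm (f \<theta>) \<le> 1/2" using near[OF that] by (simp add: f_def)
    have "l \<theta> \<noteq> 0" using near[OF that] by auto
    then show "exp (f \<theta>) = l \<theta>" by (simp add: f_def)
  qed
  have fadd: "f (\<lambda>i. \<theta> i + \<phi> i) = f \<theta> + f \<phi>" if s: "small \<theta>" "small \<phi>" "small (\<lambda>i. \<theta> i + \<phi> i)" for \<theta> \<phi>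
  proof -
    have "l (\<lambda>i. \<theta> i + \<phi> i) *s v = (l \<theta> * l \<phi>) *s v"
      using l[OF s(3)] l[OF s(1)] l[OF s(2)]
      by (auto simp: T_add[OF s] mv_scale vector_smult_assoc mult.commute simp flip: matrix_vector_mul_assoc)
    then have "l (\<lambda>i. \<theta> i + \<phi> i) = exp (f \<theta> + f \<phi>)" using inj f s by (simp add: exp_add)
    moreover have "\<bar>Im (f \<theta> + f \<phi>)\<bar> \<le> 1"
      using f(1)[OF s(1)] f(1)[OF s(2)] abs_Im_le_cmod[of "f \<theta>"] abs_Im_le_cmod[of "f \<phi>"] by simp
    then have "Ln (exp (f \<theta> + f \<phi>)) = f \<theta> + f \<phi>" using pi_gt3 by (intro Ln_exp) linarith+
    moreover have "f (\<lambda>i. \<theta> i + \<phi> i) = Ln (l (\<lambda>i. \<theta> i + \<phi> i))" by (simp add: f_def)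
    ultimately show ?thesis by simp
  qed
  define e where "e = (\<lambda>(j::'n) t i. if i = j then t else 0 :: real)"
  have se: "small (e j t)" if "\<bar>t\<bar> < r" for j t using that r by (auto simp: small_def e_def)
  have "\<exists>c. \<forall>t. \<bar>t\<bar> < r \<longrightarrow> f (e j t) = of_real t * c" for j
  proof (rule local_additive_bounded[OF r(1), of "\<lambda>t. f (e j t)" "1/2"])
    fix s t assume "\<bar>s\<bar> < r" "\<bar>t\<bar> < r" "\<bar>s + t\<bar> < r"
    moreover have "e j (s + t) = (\<lambda>i. e j s i + e j t i)" by (auto simp: e_def)
    ultimately show "f (e j (s + t)) = f (e j s) + f (e j t)" using fadd[of "e j s" "e j t"] se by metis
  qed (use f se in auto)
  then obtain c where c: "\<And>j t. \<bar>t\<bar> < r \<Longrightarrow> f (e j t) = of_real t * c j" by metis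
  have "T \<theta> *v v = exp (\<Sum>j\<in>UNIV. of_real (\<theta> j) * c j) *s v" if s: "small \<theta>" for \<theta>
  proof -
    \<comment> \<open>\<open>R F\<close> keeps only the angles in \<open>F\<close>; coordinates are
      switched on one at a time so that every intermediate vector remains small.\<close>
    define R where "R = (\<lambda>F i. if i \<in> F then \<theta> i else 0)"
    have sR: "small (R F)" for F using s r by (auto simp: small_def R_def)
    have "f (R F) = (\<Sum>j\<in>F. of_real (\<theta> j) * c j)" if "finite F" for F
      using that
    proof (induction F)
      case empty
      have "R {} = e undefined 0" by (auto simp: R_def e_def)
      then show ?case using c[of 0 undefined] r by simp
    next
      case (insert j F)
      have "R (insert j F) = (\<lambda>i. e j (\<theta> j) i + R F i)" using insert by (auto simp: R_def e_def)
      moreover have j: "\<bar>\<theta> j\<bar> < r" using s by (simp add: small_def)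
      ultimately have "f (R (insert j F)) = f (e j (\<theta> j)) + f (R F)"
        using fadd[OF se[OF j] sR] sR by metis
      then show ?case using insert c[OF j] by simp
    qed
    from this[of UNIV] have "f \<theta> = (\<Sum>j\<in>UNIV. of_real (\<theta> j) * c j)" by (simp add: R_def)
    then show ?thesis using l[OF s] f(2)[OF s] by simp
  qed
  then show ?thesis using that v0 unfolding weight_def by blast
qed

text \<open>The N-th power lifts the identity, as the identity matrix does, so it is a deck scalar.
  This is the source of all integrality.\<close>

lemma torus_period_scalar:
  assumes "small \<theta>" "torus (\<lambda>i. real N * \<theta> i) = mat 1"
  obtains \<gamma> where "mpow (T \<theta>) N = mscale \<gamma> (mat 1)"
proof -
  have "lifts (mat 1) (mpow (T \<theta>) N)"
    using lift_mpow[OF lifts_T[OF assms(1)], of N] assms(2) by (simp add: mpow_torus)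
  then show ?thesis using lift_unique[OF lift_one] that by blast
qed

text \<open>If the weights were all symmetric in the two chosen coordinates, then the lift \<open>Q\<close> of a root
  of unity in these coordinates would be unipotent on the range of \<open>Q - 1\<close>; as a power of \<open>Q\<close> is
  scalar, \<open>Q\<close> would be trivial.\<close>

lemma nonconstant_weight:
  assumes ij: "i \<noteq> j" obtains c v where "weight c v" "c i \<noteq> c j"
proof -
  \<comment> \<open>Opposite angles in \<open>i\<close> and \<open>j\<close>: with
    \<open>s = 2 * pi / N\<close> the torus element is small and its N-th power is the
    identity.\<close>
  define \<psi> where "\<psi> = (\<lambda>x (k::'n). if k = i then x else if k = j then - x else 0 :: real)"
  obtain N where N: "N > 0" "\<And>k. \<bar>\<psi> (2 * pi) k / real N\<bar> < r" using divide_angles[OF r(1)] by blast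
  define s where "s = 2 * pi / real N"
  have s: "\<bar>s\<bar> < r" using N(2)[of i] by (simp add: s_def \<psi>_def)
  have s0: "s > 0" using N by (simp add: s_def)
  define \<theta> where "\<theta> = \<psi> s"
  have sm: "small \<theta>" using s r by (auto simp: small_def \<theta>_def \<psi>_def)
  have "torus (\<lambda>k. real N * \<theta> k) = diag_mat (\<lambda>_. 1)"
    unfolding torus_def using N(1) by (intro arg_cong[of _ _ diag_mat] ext) (simp add: complex_eq_iff \<theta>_def \<psi>_def s_def)
  then obtain \<gamma> where \<gamma>: "mpow (T \<theta>) N = mscale \<gamma> (mat 1)"
    using torus_period_scalar[OF sm, of N] by (auto simp: diag_mat_one)
  let ?Q = "T \<theta>"
  have Q1: "?Q \<noteq> mat 1"
  proof
    assume "?Q = mat 1"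
    then have "torus \<theta> = mat 1" using effective lifts_T[OF sm] by simp
    then have "torus \<theta> $ i $ i = 1" by (simp add: mat_def)
    then have "cis s = 1" by (simp add: torus_def diag_mat_def \<theta>_def \<psi>_def)
    then have "sin s = 0" by (simp add: complex_eq_iff)
    moreover have "sin s > 0" using s s0 r pi_gt3 by (intro sin_gt_zero) auto
    ultimately show False by simp
  qed
  \<comment> \<open>The range of \<open>Q - 1\<close> is invariant under all \<open>T \<phi>\<close>
    by commutativity and is nonzero by effectiveness, so it contains a weight vector.\<close>
  define W where "W = range (\<lambda>x. ?Q *v x - x)"
  have W: "vec.subspace W"
  proof (rule vec.subspaceI)
    show "0 \<in> W" by (auto simp: W_def intro!: image_eqI[of _ _ 0])
    show "x + y \<in> W" if "x \<in> W" "y \<in> W" for x y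
      using that by (auto simp: W_def image_iff) (metis (no_types, opaque_lifting) add_diff_add matrix_vector_right_distrib)
    show "c *s x \<in> W" if "x \<in> W" for c x
      using that by (auto simp: W_def image_iff) (metis mv_scale vector_ssub_ldistrib)
  qed
  obtain x0 where "?Q *v x0 \<noteq> mat 1 *v x0" using Q1 by (metis matrix_eq)
  then have x0: "?Q *v x0 - x0 \<in> W" "?Q *v x0 - x0 \<noteq> 0" by (auto simp: W_def)
  obtain v where v: "v \<in> W" "v \<noteq> 0" "\<And>M. M \<in> T ` {\<phi>. small \<phi>} \<Longrightarrow> \<exists>l. M *v v = l *s v"
  proof (rule joint_eigenvector[OF W _ x0])
    fix M x assume "M \<in> T ` {\<phi>. small \<phi>}" "x \<in> W"
    then obtain \<phi> y where \<phi>: "small \<phi>" "M = T \<phi>" "x = ?Q *v y - y" by (auto simp: W_def)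
    have "M *v x = ?Q *v (M *v y) - M *v y"
      using T_commute[OF sm \<phi>(1)] by (simp add: \<phi> matrix_vector_mult_diff_distrib matrix_vector_mul_assoc)
    then show "M *v x \<in> W" by (simp add: W_def)
  qed (auto simp: T_commute)
  then obtain c where c: "weight c v" using joint_eigenvector_weight[of v] by blast
  have "c i \<noteq> c j"
  proof
    assume eq: "c i = c j"
    have "(\<Sum>k\<in>UNIV. of_real (\<theta> k) * c k) = (\<Sum>k\<in>{i,j}. of_real (\<theta> k) * c k)"
      by (intro sum.mono_neutral_right) (auto simp: \<theta>_def \<psi>_def)
    also have "\<dots> = 0" using ij eq by (simp add: \<theta>_def \<psi>_def)
    finally have Qv: "?Q *v v = v" using c sm by (simp add: weight_def)
    obtain x where x: "v = ?Q *v x - x" using v by (auto simp: W_def)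
    \<comment> \<open>A Jordan block for the eigenvalue 1 shows as linear growth. The scalar
      \<open>\<gamma>\<close> is 1 because \<open>Q\<close> fixes \<open>v\<close>, and then N times
      \<open>v\<close> would vanish.\<close>
    have "mpow ?Q k *v x = x + of_nat k *s v" for k
    proof (induction k)
      case (Suc k)
      have "mpow ?Q (Suc k) *v x = ?Q *v x + of_nat k *s v"
        using Suc by (simp add: matrix_vector_right_distrib mv_scale Qv flip: matrix_vector_mul_assoc)
      also have "?Q *v x = x + v" by (simp add: x)
      finally show ?case by (simp add: vector_sadd_rdistrib)
    qed simp
    from this[of N] have 1: "\<gamma> *s x = x + of_nat N *s v" using \<gamma> by (simp add: mscale_simps)
    have "mpow ?Q N *v v = v" using mpow_eigenvector[of ?Q v 1 N] Qv by simp
    then have "\<gamma> *s v = 1 *s v" using \<gamma> by (simp add: mscale_simps)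
    then have "\<gamma> = 1" using v(2) by (metis cvec_scale_eq_0 eq_iff_diff_eq_0 vector_sub_rdistrib)
    then have "of_nat N *s v = 0" using 1 by simp
    then show False using v(2) N(1) by (simp add: cvec_scale_eq_0)
  qed
  then show ?thesis using that c by blast
qed

end

section \<open>Permutation matrices, the symmetry of the weights and their number\<close>

definition swap_mat :: "'n::finite \<Rightarrow> 'n \<Rightarrow> complex^'n^'n" where
  "swap_mat p q = (\<chi> a b. if a = Transposition.transpose p q b then 1 else 0)"

lemma swap_mat_mv: "(swap_mat p q *v z) $ a = z $ (Transposition.transpose p q a)"
proof -
  have "(\<Sum>b\<in>UNIV. (if a = Transposition.transpose p q b then 1 else 0) * z $ b) =
      (\<Sum>b\<in>UNIV. if b = Transposition.transpose p q a then z $ b else 0)"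
    by (intro sum.cong) auto
  then show ?thesis by (simp add: swap_mat_def matrix_vector_mult_def)
qed

lemma adjoint_swap_mat: "adjoint_matrix (swap_mat p q) = swap_mat p q"
  by (auto simp: adjoint_matrix_def swap_mat_def Finite_Cartesian_Product.transpose_def vec_eq_iff)

lemma swap_mat_unitary: "swap_mat p q \<in> unitary_matrices"
proof -
  have "swap_mat p q ** swap_mat p q = mat 1"
    by (subst matrix_eq) (simp add: vec_eq_iff swap_mat_mv flip: matrix_vector_mul_assoc)
  then show ?thesis by (simp add: unitary_matrices_def adjoint_swap_mat)
qed

lemma swap_mat_conj_torus:
  "swap_mat p q ** torus \<theta> ** adjoint_matrix (swap_mat p q) = torus (\<theta> \<circ> Transposition.transpose p q)"
  by (subst matrix_eq)
    (simp add: vec_eq_iff swap_mat_mv torus_def diag_mat_mv adjoint_swap_mat flip: matrix_vector_mul_assoc)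

context local_section
begin

text \<open>Conjugation by a swap matrix permutes the angles, so a lift of the swap matrix carries
  weight vectors to weight vectors.\<close>

lemma weight_swap:
  assumes c: "weight c v"
  shows "\<exists>w. weight (c \<circ> Transposition.transpose p q) w"
proof -
  let ?\<tau> = "Transposition.transpose p q"
  obtain g where g: "lifts (swap_mat p q) g" using every_unitary_lifts[OF swap_mat_unitary] .
  obtain h where h: "h ** g = mat 1" using lift_inverse[OF g] by blast
  have "weight (c \<circ> ?\<tau>) (g *v v)"
    unfolding weight_def
  proof (intro conjI allI impI)
    have "h *v (g *v v) = v" by (simp add: matrix_vector_mul_assoc h)
    then show "g *v v \<noteq> 0" using c by (auto simp: weight_def)
    fix \<theta> assume \<theta>: "small \<theta>"
    then have s: "small (\<theta> \<circ> ?\<tau>)" by (simp add: small_def)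
    have "T \<theta> ** g = g ** T (\<theta> \<circ> ?\<tau>)"
      using L_conj_torus[OF g s] by (simp add: swap_mat_conj_torus T_def comp_assoc)
    then have "T \<theta> *v (g *v v) = g *v (T (\<theta> \<circ> ?\<tau>) *v v)" by (simp add: matrix_vector_mul_assoc)
    also have "\<dots> = exp (\<Sum>j\<in>UNIV. of_real ((\<theta> \<circ> ?\<tau>) j) * c j) *s (g *v v)"
      using c s by (simp add: weight_def mv_scale)
    also have "(\<Sum>j\<in>UNIV. of_real ((\<theta> \<circ> ?\<tau>) j) * c j) = (\<Sum>j\<in>UNIV. of_real (\<theta> j) * (c \<circ> ?\<tau>) j)"
      by (rule sum.reindex_bij_witness[of _ ?\<tau> ?\<tau>]) auto
    finally show "T \<theta> *v (g *v v) = exp (\<Sum>j\<in>UNIV. of_real (\<theta> j) * (c \<circ> ?\<tau>) j) *s (g *v v)" .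
  qed
  then show ?thesis by blast
qed

text \<open>A single nonzero angle at a coordinate where the weights differ suffices, if it is small
  enough that the difference of the exponents has imaginary part below \<open>pi\<close>.\<close>

lemma weights_separated:
  fixes c c' :: "'n \<Rightarrow> complex"
  assumes "c \<noteq> c'"
  obtains \<theta> where "small \<theta>" "exp (\<Sum>j\<in>UNIV. of_real (\<theta> j) * c j) \<noteq> exp (\<Sum>j\<in>UNIV. of_real (\<theta> j) * c' j)"
proof -
  obtain k where k: "c k \<noteq> c' k" using assms by auto
  define t where "t = min (r / 2) (1 / norm (c k - c' k))"
  define \<theta> where "\<theta> = (\<lambda>j. if j = k then t else 0)"
  have t: "0 < t" "t < r" "t * norm (c k - c' k) \<le> 1"
    using r k by (auto simp: t_def min_def field_simps)
  have sum: "(\<Sum>j\<in>UNIV. of_real (\<theta> j) * f j) = of_real t * f k" for f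
    by (simp add: \<theta>_def if_distrib[of "\<lambda>x. of_real x * _"] cong: if_cong)
  have "exp (of_real t * c k) \<noteq> exp (of_real t * c' k)"
  proof
    assume "exp (of_real t * c k) = exp (of_real t * c' k)"
    then have "exp (of_real t * (c k - c' k)) = 1" by (simp add: right_diff_distrib exp_diff)
    moreover have "\<bar>Im (of_real t * (c k - c' k))\<bar> \<le> norm (of_real t * (c k - c' k))" by (rule abs_Im_le_cmod)
    then have "\<bar>Im (of_real t * (c k - c' k))\<bar> < pi" using t pi_gt3 by (simp add: norm_mult)
    then have "Ln (exp (of_real t * (c k - c' k))) = of_real t * (c k - c' k)" by (intro Ln_exp) linarith+
    ultimately have "of_real t * (c k - c' k) = 0" by simp
    then show False using t k by simp
  qed
  moreover have "small \<theta>" using t r by (simp add: small_def \<theta>_def)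
  ultimately show ?thesis using that by (simp add: sum)
qed

text \<open>Applying \<open>T \<theta>\<close> and subtracting the multiple belonging to
  \<open>c0\<close> removes one vector from a relation; the remaining coefficients are multiplied by
  factors that can be made nonzero.\<close>

lemma weights_independent:
  assumes "finite F" "\<And>c. c \<in> F \<Longrightarrow> weight c (v c)" "(\<Sum>c\<in>F. a c *s v c) = 0"
  shows "\<forall>c\<in>F. a c = 0"
  using assms
proof (induction F arbitrary: a rule: finite_induct)
  case (insert c0 F)
  define E where "E = (\<lambda>(\<theta> :: 'n \<Rightarrow> real) (c :: 'n \<Rightarrow> complex). exp (\<Sum>j\<in>UNIV. of_real (\<theta> j) * c j))"
  have *: "\<forall>c\<in>F. a c * (E \<theta> c - E \<theta> c0) = 0" if \<theta>: "small \<theta>" for \<theta>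
  proof (rule insert.IH)
    have ev: "T \<theta> *v v c = E \<theta> c *s v c" if "c \<in> insert c0 F" for c
      using insert.prems(1)[OF that] \<theta> by (simp add: weight_def E_def)
    have "T \<theta> *v (\<Sum>c\<in>insert c0 F. a c *s v c) - E \<theta> c0 *s (\<Sum>c\<in>insert c0 F. a c *s v c) = 0"
      using insert.prems(2) by simp
    also have "T \<theta> *v (\<Sum>c\<in>insert c0 F. a c *s v c) = (\<Sum>c\<in>insert c0 F. (a c * E \<theta> c) *s v c)"
      unfolding mv_sum by (intro sum.cong refl) (simp add: mv_scale ev vector_smult_assoc)
    also have "E \<theta> c0 *s (\<Sum>c\<in>insert c0 F. a c *s v c) = (\<Sum>c\<in>insert c0 F. (a c * E \<theta> c0) *s v c)"
      by (simp only: vec.scale_sum_right vector_smult_assoc mult.commute)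
    finally have "(\<Sum>c\<in>insert c0 F. (a c * (E \<theta> c - E \<theta> c0)) *s v c) = 0"
      by (simp only: sum_subtractf[symmetric] vector_sub_rdistrib[symmetric] right_diff_distrib)
    then show "(\<Sum>c\<in>F. (a c * (E \<theta> c - E \<theta> c0)) *s v c) = 0" using insert.hyps by simp
  qed (use insert.prems in auto)
  have F: "a c = 0" if "c \<in> F" for c
  proof -
    have "c \<noteq> c0" using that insert.hyps by auto
    then obtain \<theta> where "small \<theta>" "E \<theta> c \<noteq> E \<theta> c0" using weights_separated unfolding E_def by blast
    then show ?thesis using * that by auto
  qed
  then have "(\<Sum>c\<in>F. a c *s v c) = 0" by (intro sum.neutral) auto
  then have "a c0 *s v c0 = 0" using insert.prems(2) insert.hyps by simp
  then show ?case using F insert.prems(1)[of c0] by (auto simp: weight_def cvec_scale_eq_0)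
qed simp

lemma card_weights_le:
  assumes F: "finite F" "\<And>c. c \<in> F \<Longrightarrow> weight c (v c)"
  shows "card F \<le> CARD('n)"
proof -
  have inj: "inj_on v F"
  proof (rule inj_onI, rule ccontr)
    fix c d assume cd: "c \<in> F" "d \<in> F" "v c = v d" "c \<noteq> d"
    define a where "a = (\<lambda>x. if x = c then 1 else if x = d then -1 else 0 :: complex)"
    have "(\<Sum>x\<in>F. a x *s v x) = (\<Sum>x\<in>{c, d}. a x *s v x)"
      using cd F(1) by (intro sum.mono_neutral_right) (auto simp: a_def)
    also have "\<dots> = 0" using cd by (simp add: a_def)
    finally show False using weights_independent[OF F, of a] cd by (auto simp: a_def)
  qed
  have "\<not> vec.dependent (v ` F)"
  proof
    assume "vec.dependent (v ` F)"
    then obtain u x where u: "x \<in> v ` F" "u x \<noteq> 0" "(\<Sum>x\<in>v ` F. u x *s x) = 0"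
      using F(1) by (subst (asm) vec.dependent_finite) auto
    then have "(\<Sum>c\<in>F. u (v c) *s v c) = 0" by (simp add: sum.reindex[OF inj])
    then show False using weights_independent[OF F, of "\<lambda>c. u (v c)"] u by auto
  qed
  then have "card (v ` F) = vec.dim (v ` F)" by (rule vec.dim_eq_card_independent[symmetric])
  also have "\<dots> \<le> CARD('n)" using vec.dim_subset_UNIV[of "v ` F"] by (simp add: vec.dimension_def card_cart_basis)
  finally show ?thesis by (simp add: card_image[OF inj])
qed

text \<open>All swaps of a nonconstant weight are weights, but there are at most n of them. So the
  weight is constant off one coordinate, and further swaps move this coordinate to every
  position.\<close>

lemma weight_structure:
  obtains a b :: complex and v where "b \<noteq> 0" "\<And>l. weight (\<lambda>j. a + (if j = l then b else 0)) (v l)"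
proof -
  obtain i j :: 'n where ij: "i \<noteq> j" using card2 card_le_Suc0_iff_eq[of "UNIV :: 'n set"] by fastforce
  obtain c v where c: "weight c v" "c i \<noteq> c j" using nonconstant_weight[OF ij] .
  define X where "X = {c \<circ> Transposition.transpose p q | p q. True}"
  have "X = (\<lambda>(p, q). c \<circ> Transposition.transpose p q) ` UNIV" by (auto simp: X_def)
  then have fin: "finite X" by simp
  have "\<forall>d\<in>X. \<exists>w. weight d w" unfolding X_def using weight_swap[OF c(1)] by blast
  then obtain w where w: "\<And>d. d \<in> X \<Longrightarrow> weight d (w d)" by metis
  then have "card X \<le> CARD('n)" by (rule card_weights_le[OF fin])
  then obtain k where k: "\<And>p q. p \<noteq> k \<Longrightarrow> q \<noteq> k \<Longrightarrow> c p = c q"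
    using constant_off_point_if_few_swaps[OF c(2)] fin unfolding X_def by blast
  obtain p where p: "p \<noteq> k" using ij by metis
  define a b where "a = c p" and "b = c k - c p"
  have cs: "c = (\<lambda>j. a + (if j = k then b else 0))" using k[OF _ p] by (auto simp: a_def b_def)
  have "b \<noteq> 0" using c(2) by (auto simp: cs)
  moreover have "\<exists>v. weight (\<lambda>j. a + (if j = l then b else 0)) v" for l
  proof -
    have "c \<circ> Transposition.transpose k l = (\<lambda>j. a + (if j = l then b else 0))"
      unfolding cs by (auto simp: fun_eq_iff Transposition.transpose_def)
    then show ?thesis using weight_swap[OF c(1), of k l] by metis
  qed
  then obtain v where "\<And>l. weight (\<lambda>j. a + (if j = l then b else 0)) (v l)" by metis
  ultimately show ?thesis using that by blast
qed

text \<open>The n weights are distinct because \<open>b\<close> is nonzero, so their vectors are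
  independent and form the columns of \<open>C\<close>.\<close>

lemma torus_diagonalized:
  obtains a b :: complex and C where "b \<noteq> 0" "invertible C"
    "\<And>\<theta>. small \<theta> \<Longrightarrow> T \<theta> ** C = C ** diag_mat (\<lambda>l. exp (a * (\<Sum>j\<in>UNIV. of_real (\<theta> j)) + b * of_real (\<theta> l)))"
proof -
  obtain a b :: complex and v where b: "b \<noteq> 0" and v: "\<And>l. weight (\<lambda>j. a + (if j = l then b else 0)) (v l)"
    by (rule weight_structure) (rule that)
  define W where "W = (\<lambda>l j::'n. a + (if j = l then b else 0))"
  have vW: "weight (W l) (v l)" for l using v by (simp add: W_def)
  have injW: "inj W"
  proof (rule injI)
    fix l l' assume "W l = W l'"
    then have "W l l = W l' l" by simp
    then show "l = l'" using b by (auto simp: W_def split: if_splits)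
  qed
  define C :: "complex^'n^'n" where "C = (\<chi> i l. v l $ i)"
  have "invertible C"
    unfolding invertible_left_inverse matrix_left_invertible_ker
  proof (intro allI impI)
    fix x assume "C *v x = 0"
    moreover have "C *v x = (\<Sum>l\<in>UNIV. x $ l *s v l)"
      by (simp add: vec_eq_iff C_def matrix_vector_mult_def mult.commute)
    ultimately have "(\<Sum>c\<in>range W. x $ (inv_into UNIV W c) *s v (inv_into UNIV W c)) = 0"
      by (simp add: sum.reindex[OF injW] inv_f_f[OF injW])
    then have "\<forall>c\<in>range W. x $ (inv_into UNIV W c) = 0"
      by (intro weights_independent[of "range W" "\<lambda>c. v (inv_into UNIV W c)"])
        (use vW in \<open>auto simp: inv_f_f[OF injW]\<close>)
    then show "x = 0" by (auto simp: vec_eq_iff inv_f_f[OF injW])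
  qed
  moreover have "T \<theta> ** C = C ** diag_mat (\<lambda>l. exp (a * (\<Sum>j\<in>UNIV. of_real (\<theta> j)) + b * of_real (\<theta> l)))"
    if "small \<theta>" for \<theta>
  proof -
    have "(\<Sum>j\<in>UNIV. of_real (\<theta> j) * W l j) = a * (\<Sum>j\<in>UNIV. of_real (\<theta> j)) + b * of_real (\<theta> l)" for l
      by (simp add: W_def distrib_left sum.distrib sum_distrib_left mult.commute if_distrib[of "\<lambda>x. _ * x"] cong: if_cong)
    then have "T \<theta> *v v l = exp (a * (\<Sum>j\<in>UNIV. of_real (\<theta> j)) + b * of_real (\<theta> l)) *s v l" for l
      using v[of l] that unfolding weight_def W_def[symmetric] by (simp add: W_def)
    moreover have "(T \<theta> ** C) $ i $ l = (T \<theta> *v v l) $ i" for i l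
      by (simp add: C_def matrix_matrix_mult_def matrix_vector_mult_def)
    ultimately show ?thesis unfolding vec_eq_iff mult_diag_mat by (simp add: C_def mult.commute)
  qed
  ultimately show ?thesis using that b by blast
qed

end

section \<open>Classification of the lifts\<close>

lemma mpow_diag_mat: "mpow (diag_mat a) k = diag_mat (\<lambda>i. a i ^ k)"
  by (induction k) (simp_all add: diag_mat_mult diag_mat_one)

lemma matrix_inv_cancel:
  fixes C :: "complex^'n^'n"
  assumes "invertible C"
  shows matrix_inv_right: "C ** matrix_inv C = mat 1" and matrix_inv_left: "matrix_inv C ** C = mat 1"
proof -
  have "C ** matrix_inv C = mat 1 \<and> matrix_inv C ** C = mat 1"
    unfolding matrix_inv_def using assms unfolding invertible_def by (rule someI_ex)
  then show "C ** matrix_inv C = mat 1" "matrix_inv C ** C = mat 1" by auto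
qed

lemma invertible_cancel_left:
  fixes C :: "complex^'n^'n"
  assumes "invertible C" "C ** X = C ** Y" shows "X = Y"
proof -
  have "matrix_inv C ** (C ** X) = matrix_inv C ** (C ** Y)" using assms by simp
  then show ?thesis by (simp add: matrix_mul_assoc matrix_inv_left[OF assms(1)])
qed

lemma trace_intertwined:
  fixes C :: "complex^'n^'n"
  assumes "invertible C" "X ** C = C ** Y" shows "trace X = trace Y"
proof -
  have "X = X ** C ** matrix_inv C" by (simp add: matrix_inv_right[OF assms(1)] flip: matrix_mul_assoc)
  also have "\<dots> = C ** Y ** matrix_inv C" using assms(2) by simp
  finally have "X = C ** Y ** matrix_inv C" .
  then have "trace X = trace (matrix_inv C ** (C ** Y))" by (metis trace_mul_sym)
  then show ?thesis by (simp add: matrix_mul_assoc matrix_inv_left[OF assms(1)])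
qed

lemma cis_eq_1_iff: "cis x = 1 \<longleftrightarrow> (\<exists>k::int. x = 2 * pi * of_int k)"
proof -
  have "cis x = exp (\<i> * of_real x)" by (rule cis_conv_exp)
  then show ?thesis by (auto simp: exp_eq_1 mult_ac)
qed

context local_section
begin

lemma torus_diagonalized_standard:
  obtains a b :: complex and C where "b = \<i> \<or> b = - \<i>" "invertible C"
    "\<And>\<theta>. small \<theta> \<Longrightarrow> T \<theta> ** C = C ** diag_mat (\<lambda>l. exp (a * (\<Sum>j\<in>UNIV. of_real (\<theta> j)) + b * of_real (\<theta> l)))"
proof -
  obtain a b :: complex and C where b: "b \<noteq> 0" and C: "invertible C"
    and TC: "\<And>\<theta>. small \<theta> \<Longrightarrow> T \<theta> ** C = C ** diag_mat (\<lambda>l. exp (a * (\<Sum>j\<in>UNIV. of_real (\<theta> j)) + b * of_real (\<theta> l)))"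
    by (rule torus_diagonalized) (rule that)
  define D where "D = (\<lambda>\<theta>::'n\<Rightarrow>real. \<lambda>l::'n. exp (a * (\<Sum>j\<in>UNIV. of_real (\<theta> j)) + b * of_real (\<theta> l)))"
  have pw: "mpow (T (\<lambda>i. \<theta> i / real N)) N ** C = C ** diag_mat (D \<theta>)"
    if "N > 0" "small (\<lambda>i. \<theta> i / real N)" for N \<theta>
  proof -
    have "exp (a * (\<Sum>j\<in>UNIV. of_real (\<theta> j / real N)) + b * of_real (\<theta> l / real N)) ^ N = D \<theta> l" for l
    proof -
      have "of_nat N * (a * (\<Sum>j\<in>UNIV. of_real (\<theta> j / real N)) + b * of_real (\<theta> l / real N)) = a * (\<Sum>j\<in>UNIV. of_real (\<theta> j)) + b * of_real (\<theta> l)"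
        using that(1) by (simp add: distrib_left flip: sum_divide_distrib)
      then show ?thesis by (simp add: D_def flip: exp_of_nat_mult)
    qed
    then show ?thesis using mpow_intertwine[OF TC[OF that(2)], of N] by (simp add: mpow_diag_mat)
  qed
  obtain i j :: 'n where ij: "i \<noteq> j" using card2 card_le_Suc0_iff_eq[of "UNIV :: 'n set"] by fastforce
  \<comment> \<open>A full turn in the single coordinate \<open>i\<close> has a scalar lift; its
    entries at \<open>i\<close> and \<open>j\<close> agree, and their quotient is
    \<open>exp (2 * pi * b)\<close>.\<close>
  have "exp (2 * pi * b) = 1"
  proof -
    define \<theta> where "\<theta> = (\<lambda>k. if k = i then 2 * pi else 0)"
    obtain N where N: "N > 0" "\<And>k. \<bar>\<theta> k / real N\<bar> < r" using divide_angles[OF r(1)] by blast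
    then have sm: "small (\<lambda>k. \<theta> k / real N)" by (simp add: small_def)
    have "torus (\<lambda>k. real N * (\<theta> k / real N)) = diag_mat (\<lambda>_. 1)"
      unfolding torus_def using N(1) by (intro arg_cong[of _ _ diag_mat] ext) (simp add: \<theta>_def)
    then obtain \<gamma> where "mpow (T (\<lambda>k. \<theta> k / real N)) N = mscale \<gamma> (mat 1)"
      using torus_period_scalar[OF sm, of N] by (auto simp: diag_mat_one)
    then have "C ** diag_mat (D \<theta>) = C ** mscale \<gamma> (mat 1)"
      using pw[OF N(1) sm] by (simp add: mscale_simps)
    then have "diag_mat (D \<theta>) = mscale \<gamma> (mat 1)" by (rule invertible_cancel_left[OF C])
    then have "diag_mat (D \<theta>) $ k $ k = \<gamma>" for k by (simp add: mscale_def mat_def)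
    then have "D \<theta> i = D \<theta> j" by (simp add: diag_mat_def)
    then show ?thesis using ij by (simp add: D_def \<theta>_def exp_add mult.commute)
  qed
  then obtain k :: int where k: "Re b = 0" "Im b = of_int k" by (auto simp: exp_eq_1)
  have bk: "b = \<i> * of_int k" using k by (simp add: complex_eq_iff)
  have k0: "k \<noteq> 0" using b bk by auto
  \<comment> \<open>Opposite angles of size \<open>2 * pi / k\<close> have sum zero, which removes
    the \<open>a\<close>-term, and \<open>b\<close> turns each into a multiple of 2 pi i. The lift
    is then the identity, so effectiveness gives \<open>cis (2 * pi / k) = 1\<close>.\<close>
  have "\<bar>k\<bar> = 1"
  proof -
    define \<theta> where "\<theta> = (\<lambda>l. if l = i then 2 * pi / of_int k else if l = j then - (2 * pi / of_int k) else 0 :: real)"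
    obtain N where N: "N > 0" "\<And>l. \<bar>\<theta> l / real N\<bar> < r" using divide_angles[OF r(1)] by blast
    then have sm: "small (\<lambda>l. \<theta> l / real N)" by (simp add: small_def)
    have "(\<Sum>l\<in>UNIV. of_real (\<theta> l)) = (\<Sum>l\<in>{i, j}. of_real (\<theta> l) :: complex)"
      by (intro sum.mono_neutral_right) (auto simp: \<theta>_def)
    then have s0: "(\<Sum>l\<in>UNIV. of_real (\<theta> l)) = (0 :: complex)" using ij by (simp add: \<theta>_def)
    have "D \<theta> l = 1" for l
    proof -
      have "b * of_real (\<theta> l) = (if l = i then 2 * pi * \<i> else if l = j then - (2 * pi * \<i>) else 0)"
        using k0 by (simp add: bk \<theta>_def)
      then show ?thesis by (simp add: D_def s0 exp_minus)
    qed
    then have "D \<theta> = (\<lambda>_. 1)" by auto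
    then have "mpow (T (\<lambda>l. \<theta> l / real N)) N ** C = mat 1 ** C"
      using pw[OF N(1) sm] by (simp add: diag_mat_one)
    then have "mpow (T (\<lambda>l. \<theta> l / real N)) N ** (C ** matrix_inv C) = C ** matrix_inv C"
      by (simp add: matrix_mul_assoc)
    then have "mpow (T (\<lambda>l. \<theta> l / real N)) N = mat 1" by (simp add: matrix_inv_right[OF C])
    then have "lifts (torus (\<lambda>l. real N * (\<theta> l / real N))) (mat 1)"
      using lift_mpow[OF lifts_T[OF sm], of N] by (simp add: mpow_torus)
    then have "torus \<theta> = mat 1" using effective N(1) by simp
    then have "torus \<theta> $ i $ i = 1" by (simp add: mat_def)
    then have "cis (2 * pi / of_int k) = 1" by (simp add: torus_def diag_mat_def \<theta>_def)
    then obtain q :: int where "2 * pi / of_int k = 2 * pi * of_int q" unfolding cis_eq_1_iff by blast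
    then have "1 = real_of_int q * of_int k" using k0 by (simp add: field_simps)
    then have "real_of_int (q * k) = real_of_int 1" by simp
    then have "k * q = 1" by (simp only: of_int_eq_iff mult.commute)
    then show ?thesis using zmult_eq_1_iff[of k q] by auto
  qed
  then consider "k = 1" | "k = - 1" by linarith
  then have "b = \<i> \<or> b = - \<i>" by cases (simp_all add: bk)
  then show ?thesis using that[OF _ C TC] by blast
qed

text \<open>Determinant 1 only makes the angle sum a multiple of \<open>2 * pi\<close>; near the
  identity the sum is too small to be anything but zero.\<close>

lemma special_near_diagonalize:
  assumes B: "B \<in> special_near \<rho>" and \<rho>: "\<rho> < 1/2" "2 * real CARD('n) * \<rho> < 2 * pi" and "2 * \<rho> < r"
  obtains U \<theta> where "U \<in> unitary_matrices" "B = U ** torus \<theta> ** adjoint_matrix U"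
    "small \<theta>" "(\<Sum>i\<in>UNIV. \<theta> i) = 0"
proof -
  have Bu: "B \<in> unitary_matrices" "near_one \<rho> B" "det B = 1"
    using B by (auto simp: special_near_def special_unitary_matrices_def)
  obtain U \<theta> where U: "U \<in> unitary_matrices" "B = U ** torus \<theta> ** adjoint_matrix U"
      and \<theta>: "\<And>s i. near_one s B \<Longrightarrow> s < 1/2 \<Longrightarrow> \<bar>\<theta> i\<bar> \<le> 2 * s"
    using unitary_spectral[OF Bu(1)] by metis
  have \<theta>': "\<bar>\<theta> i\<bar> \<le> 2 * \<rho>" for i using \<theta> Bu \<rho> by blast
  have "det B = det (U ** adjoint_matrix U) * det (torus \<theta>)" by (simp add: U(2) det_mul)
  then have "cis (\<Sum>i\<in>UNIV. \<theta> i) = 1" using Bu by (simp add: unitary_inverse[OF U(1)] det_torus)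
  then obtain k :: int where k: "(\<Sum>i\<in>UNIV. \<theta> i) = 2 * pi * of_int k" unfolding cis_eq_1_iff by blast
  have "\<bar>\<Sum>i\<in>UNIV. \<theta> i\<bar> \<le> (\<Sum>i\<in>(UNIV::'n set). 2 * \<rho>)" by (rule order_trans[OF sum_abs]) (intro sum_mono \<theta>')
  then have "\<bar>2 * pi * of_int k\<bar> < 2 * pi * 1" using \<rho> k by simp
  then have "\<bar>k\<bar> < 1" by (simp add: abs_mult)
  then have "(\<Sum>i\<in>UNIV. \<theta> i) = 0" using k by simp
  moreover have "small \<theta>" using \<theta>' assms(4) by (auto simp: small_def intro: le_less_trans)
  ultimately show ?thesis using that U by blast
qed

end

text \<open>Far from the identity the angle sum is corrected by a multiple of \<open>2 * pi\<close>
  in one coordinate, at the price of any control on its size.\<close>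

lemma special_diagonalize:
  fixes B :: "complex^'n^'n"
  assumes "B \<in> special_unitary_matrices"
  obtains U \<theta> where "U \<in> unitary_matrices" "B = U ** torus \<theta> ** adjoint_matrix U" "(\<Sum>i\<in>UNIV. \<theta> i) = 0"
proof -
  have B: "B \<in> unitary_matrices" "det B = 1" using assms by (auto simp: special_unitary_matrices_def)
  obtain U \<theta> where U: "U \<in> unitary_matrices" "B = U ** torus \<theta> ** adjoint_matrix U"
    using unitary_spectral[OF B(1)] by metis
  have "det B = det (U ** adjoint_matrix U) * det (torus \<theta>)" by (simp add: U(2) det_mul)
  then have "cis (\<Sum>i\<in>UNIV. \<theta> i) = 1" using B by (simp add: unitary_inverse[OF U(1)] det_torus)
  then obtain k :: int where k: "(\<Sum>i\<in>UNIV. \<theta> i) = 2 * pi * of_int k" unfolding cis_eq_1_iff by blast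
  define i0 :: 'n where "i0 = undefined"
  define \<phi> where "\<phi> = (\<lambda>i. \<theta> i - (if i = i0 then 2 * pi * of_int k else 0))"
  have "cis (2 * pi * of_int k) = 1" using cis_eq_1_iff by blast
  then have "torus \<phi> = torus \<theta>"
    unfolding torus_def by (intro arg_cong[of _ _ diag_mat] ext) (simp add: \<phi>_def flip: cis_divide)
  moreover have "(\<Sum>i\<in>UNIV. \<phi> i) = 0" by (simp add: \<phi>_def sum_subtractf k)
  ultimately show ?thesis using that[of U \<phi>] U by simp
qed

section \<open>Entrywise conjugation of unitary matrices\<close>

lemma map_matrix_cnj_mult: "map_matrix cnj (A ** B) = map_matrix cnj A ** map_matrix cnj B"
  for A B :: "complex^'n^'n"
  by (simp add: vec_eq_iff matrix_matrix_mult_def)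

lemma map_matrix_cnj_one: "map_matrix cnj (mat 1 :: complex^'n^'n) = mat 1"
  by (simp add: vec_eq_iff mat_def)

lemma map_matrix_cnj_cnj: "map_matrix cnj (map_matrix cnj A) = A" for A :: "complex^'n^'n"
  by (simp add: vec_eq_iff)

lemma map_matrix_cnj_unitary: "A \<in> unitary_matrices \<Longrightarrow> map_matrix cnj A \<in> unitary_matrices"
proof -
  have "adjoint_matrix (map_matrix cnj A) = map_matrix cnj (adjoint_matrix A)"
    by (simp add: vec_eq_iff adjoint_matrix_def transpose_def)
  then show "A \<in> unitary_matrices \<Longrightarrow> map_matrix cnj A \<in> unitary_matrices"
    by (simp add: unitary_matrices_def map_matrix_cnj_one flip: map_matrix_cnj_mult)
qed

lemma map_matrix_cnj_special:
  "A \<in> special_unitary_matrices \<Longrightarrow> map_matrix cnj A \<in> special_unitary_matrices"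
proof -
  have "det (map_matrix cnj A) = cnj (det A)" by (simp add: det_def)
  then show "A \<in> special_unitary_matrices \<Longrightarrow> map_matrix cnj A \<in> special_unitary_matrices"
    by (simp add: special_unitary_matrices_def map_matrix_cnj_unitary)
qed

lemma map_matrix_cnj_special_near: "A \<in> special_near s \<Longrightarrow> map_matrix cnj A \<in> special_near s"
proof -
  have "norm (map_matrix cnj A *v z - z) \<le> s * norm z" if "near_one s A" for z
  proof -
    have c: "norm (\<chi> i. cnj (x $ i)) = norm x" for x :: "complex^'n" by (simp add: norm_vec_def)
    have "(\<chi> i. cnj ((map_matrix cnj A *v z - z) $ i)) = A *v (\<chi> i. cnj (z $ i)) - (\<chi> i. cnj (z $ i))"
      by (simp add: vec_eq_iff matrix_vector_mult_def)
    then show ?thesis using that c unfolding near_one_def by metis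
  qed
  then show "A \<in> special_near s \<Longrightarrow> map_matrix cnj A \<in> special_near s"
    by (auto simp: special_near_def map_matrix_cnj_special near_one_def)
qed

context local_section
begin

text \<open>Treats both signs of \<open>b\<close> together: \<open>\<kappa>\<close> is the identity
  or entrywise conjugation, and composing \<open>L\<close> with it gives a trace-preserving local
  homomorphism. The resulting conjugation extends to the whole special unitary group by roots and
  powers.\<close>

lemma conjugate_to_standard:
  assumes \<rho>: "0 < \<rho>" "\<rho> \<le> r"
    and mult: "\<And>A B. \<kappa> (A ** B) = \<kappa> A ** \<kappa> B" and one: "\<kappa> (mat 1) = mat 1"
    and near: "\<And>B s. B \<in> special_near s \<Longrightarrow> \<kappa> B \<in> special_near s" and inv: "\<And>B. \<kappa> (\<kappa> B) = B"
    and tr: "\<And>B. B \<in> special_near \<rho> \<Longrightarrow> trace (L B) = trace (\<kappa> B)"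
  obtains C where "invertible C" "\<And>B. B \<in> special_unitary_matrices \<Longrightarrow> lifts B (C ** \<kappa> B ** matrix_inv C)"
proof -
  have sn: "B \<in> unitary_matrices" "near_one r B" if "B \<in> special_near \<rho>" for B
    using that \<rho> by (auto simp: special_near_def special_unitary_matrices_def intro: near_one_mono)
  obtain C where C: "invertible C" "\<And>A. A \<in> special_near (\<rho> / 2) \<Longrightarrow> L (\<kappa> A) ** C = C ** A"
  proof (rule trace_preserving_local_hom_inner[OF card2 \<rho>(1), of "\<lambda>A. L (\<kappa> A)"])
    fix A B :: "complex^'n^'n" assume "A \<in> special_near \<rho>" "B \<in> special_near \<rho>" "A ** B \<in> special_near \<rho>"
    then show "L (\<kappa> (A ** B)) = L (\<kappa> A) ** L (\<kappa> B)"
      using sn near unfolding mult by (intro L_mult) (auto simp flip: mult)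
  next
    show "trace (L (\<kappa> A)) = trace A" if "A \<in> special_near \<rho>" for A
      using tr[OF near[OF that]] by (simp add: inv)
  qed blast
  have LC: "L B ** C = C ** \<kappa> B" if "B \<in> special_near (\<rho> / 2)" for B
    using C(2)[OF near[OF that]] by (simp add: inv)
  have "lifts B (C ** \<kappa> B ** matrix_inv C)" if B: "B \<in> special_unitary_matrices" for B
  proof -
    obtain U \<theta> where U: "U \<in> unitary_matrices" "B = U ** torus \<theta> ** adjoint_matrix U" "(\<Sum>i\<in>UNIV. \<theta> i) = 0"
      using special_diagonalize[OF B] .
    obtain N where N: "N > 0" "\<And>i. \<bar>\<theta> i / real N\<bar> < \<rho> / 2" using divide_angles[of "\<rho> / 2"] \<rho> by auto
    define A where "A = U ** torus (\<lambda>i. \<theta> i / real N) ** adjoint_matrix U"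
    have A: "A \<in> special_near (\<rho> / 2)"
      unfolding A_def using N U by (intro special_near_conj_torus) (auto simp: less_imp_le simp flip: sum_divide_distrib)
    have B: "mpow A N = B" using N(1) by (simp add: A_def mpow_conj U mpow_torus)
    have "\<kappa> (mpow A k) = mpow (\<kappa> A) k" for k by (induction k) (simp_all add: one mult)
    then have "mpow (L A) N ** C = C ** \<kappa> B" using mpow_intertwine[OF LC[OF A], of N] B by metis
    then have "mpow (L A) N ** (C ** matrix_inv C) = C ** \<kappa> B ** matrix_inv C" by (simp add: matrix_mul_assoc)
    then have "mpow (L A) N = C ** \<kappa> B ** matrix_inv C" by (simp add: matrix_inv_right[OF C(1)])
    moreover have "A \<in> special_near \<rho>" using A \<rho> by (auto simp: special_near_def intro: near_one_mono)
    then have "lifts A (L A)" by (intro lifts_L sn)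
    ultimately show ?thesis using lift_mpow[of A "L A" N] B by simp
  qed
  then show ?thesis using that C by blast
qed

lemma lift_classification:
  obtains C c \<kappa> where "invertible C" "\<kappa> = (\<lambda>B. B) \<or> \<kappa> = map_matrix cnj"
    "\<And>t::real. lifts (mat (cis t)) (mat (exp (of_real t * c)))"
    "\<And>B. B \<in> special_unitary_matrices \<Longrightarrow> lifts B (C ** \<kappa> B ** matrix_inv C)"
proof -
  obtain a b :: complex and C0 where b: "b = \<i> \<or> b = - \<i>" and C0: "invertible C0" and
    T: "\<And>\<theta>. small \<theta> \<Longrightarrow> T \<theta> ** C0 = C0 ** diag_mat (\<lambda>l. exp (a * (\<Sum>j\<in>UNIV. of_real (\<theta> j)) + b * of_real (\<theta> l)))"
    by (rule torus_diagonalized_standard) (rule that)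
  have matd: "(mat x :: complex^'n^'n) = diag_mat (\<lambda>_. x)" for x by (simp add: mat_def diag_mat_def)
  define c where "c = a * of_nat CARD('n) + b"
  have "lifts (mat (cis t)) (mat (exp (of_real t * c)))" for t
  proof -
    obtain N where N: "N > 0" "\<And>i::'n. \<bar>t / real N\<bar> < r" using divide_angles[OF r(1), of "\<lambda>_. t"] by blast
    then have sm: "small (\<lambda>_. t / real N)" by (simp add: small_def)
    let ?e = "exp (of_real (t / real N) * c)"
    have "T (\<lambda>_. t / real N) ** C0 = C0 ** mat ?e"
      using T[OF sm] by (simp add: matd c_def algebra_simps)
    also have "\<dots> = mat ?e ** C0" by (simp add: vec_eq_iff matrix_matrix_mult_def mat_def
      if_distrib[of "\<lambda>x. _ * x"] if_distrib[of "\<lambda>x. x * _"] cong: if_cong)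
    finally have "T (\<lambda>_. t / real N) ** (C0 ** matrix_inv C0) = mat ?e ** (C0 ** matrix_inv C0)"
      by (simp add: matrix_mul_assoc)
    then have "T (\<lambda>_. t / real N) = mat ?e" by (simp add: matrix_inv_right[OF C0])
    then have "lifts (mpow (torus (\<lambda>_. t / real N)) N) (mpow (mat ?e) N)"
      using lift_mpow[OF lifts_T[OF sm], of N] by simp
    moreover have "?e ^ N = exp (of_real t * c)" using N(1) by (simp flip: exp_of_nat_mult)
    ultimately show ?thesis using N(1) by (simp add: mpow_torus matd mpow_diag_mat) (simp add: torus_def)
  qed
  note scalars = this
  \<comment> \<open>Eigenvalue angles in \<open>special_near \<rho>\<close> are at most 2
    \<open>\<rho>\<close>: the bound r / 4 keeps them below \<open>r\<close>, and 1 / n keeps their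
    sum below \<open>2 * pi\<close>.\<close>
  define \<rho> where "\<rho> = min (r / 4) (1 / real CARD('n))"
  have "\<rho> \<le> 1 / real CARD('n)" by (simp add: \<rho>_def)
  then have "2 * real CARD('n) * \<rho> \<le> 2" by (simp add: field_simps)
  moreover have "0 < \<rho>" "\<rho> \<le> r / 4" using r by (simp_all add: \<rho>_def)
  ultimately have \<rho>: "0 < \<rho>" "\<rho> \<le> r / 4" "\<rho> < 1/2" "2 * real CARD('n) * \<rho> < 2 * pi" "2 * \<rho> < r"
    using r pi_gt3 by linarith+
  \<comment> \<open>\<open>B\<close> is conjugate to a torus element by \<open>U\<close>, and
    \<open>L B\<close> to the lift of that element by a lift of \<open>U\<close>, so both traces can
    be read off on the torus. The angle sum is zero, hence the \<open>a\<close>-term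
    disappears.\<close>
  have tr: "\<exists>\<theta> :: 'n \<Rightarrow> real. trace (L B) = (\<Sum>i\<in>UNIV. exp (b * of_real (\<theta> i))) \<and> trace B = (\<Sum>i\<in>UNIV. cis (\<theta> i))"
    if B: "B \<in> special_near \<rho>" for B
  proof -
    obtain U \<theta> where U: "U \<in> unitary_matrices" "B = U ** torus \<theta> ** adjoint_matrix U" "small \<theta>" "(\<Sum>i\<in>UNIV. \<theta> i) = 0"
      using special_near_diagonalize[OF B \<rho>(3-5)] .
    obtain g where g: "lifts U g" using every_unitary_lifts[OF U(1)] .
    have ig: "invertible g" using lift_inverse[OF g] unfolding invertible_def by blast
    have iU: "invertible U" using unitary_inverse[OF U(1)] unfolding invertible_def by blast
    have "(\<Sum>j\<in>UNIV. of_real (\<theta> j)) = (0::complex)" using U(4) by (metis of_real_0 of_real_sum)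
    then have "trace (T \<theta>) = (\<Sum>i\<in>UNIV. exp (b * of_real (\<theta> i)))"
      using trace_intertwined[OF C0 T[OF U(3)]] by (simp add: trace_diag_mat)
    moreover have "trace (L B) = trace (T \<theta>)"
      using trace_intertwined[OF ig L_conj_torus[OF g U(3)]] U(2) by simp
    moreover have "B ** U = U ** torus \<theta>"
      unfolding U(2) by (simp add: unitary_inverse[OF U(1)] flip: matrix_mul_assoc)
    then have "trace B = (\<Sum>i\<in>UNIV. cis (\<theta> i))"
      using trace_intertwined[OF iU] by (metis torus_def trace_diag_mat)
    ultimately show ?thesis by (intro exI[of _ \<theta>]) simp
  qed
  have \<rho>r: "\<rho> \<le> r" using \<rho> r by linarith
  from b show ?thesis
  proof
    assume b: "b = \<i>"
    have "trace (L B) = trace B" if "B \<in> special_near \<rho>" for B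
      using tr[OF that] by (auto simp: b cis_conv_exp)
    then obtain C where "invertible C" "\<And>B. B \<in> special_unitary_matrices \<Longrightarrow> lifts B (C ** B ** matrix_inv C)"
      using conjugate_to_standard[OF \<rho>(1) \<rho>r, of "\<lambda>B. B"] by blast
    then show ?thesis using that[of C "\<lambda>B. B" c] scalars by blast
  next
    assume b: "b = - \<i>"
    have "trace (L B) = trace (map_matrix cnj B)" if "B \<in> special_near \<rho>" for B
    proof -
      have "trace (map_matrix cnj B) = cnj (trace B)" by (simp add: trace_def)
      then show ?thesis using tr[OF that] by (auto simp: b exp_cnj cis_conv_exp)
    qed
    then obtain C where "invertible C" "\<And>B. B \<in> special_unitary_matrices \<Longrightarrow> lifts B (C ** map_matrix cnj B ** matrix_inv C)"
      using conjugate_to_standard[OF \<rho>(1) \<rho>r, of "map_matrix cnj"] map_matrix_cnj_mult map_matrix_cnj_one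
        map_matrix_cnj_cnj map_matrix_cnj_special_near by blast
    then show ?thesis using that[of C "map_matrix cnj" c] scalars by blast
  qed
qed

end

lemma (in linear_lift) classification:
  obtains C c \<kappa> where "invertible C" "\<kappa> = (\<lambda>B. B) \<or> \<kappa> = map_matrix cnj"
    "\<And>t::real. lifts (mat (cis t)) (mat (exp (of_real t * c)))"
    "\<And>B. B \<in> special_unitary_matrices \<Longrightarrow> lifts B (C ** \<kappa> B ** matrix_inv C)"
proof -
  obtain r L where "local_section lifts \<Gamma> r L" using local_section_exists by blast
  then show ?thesis by (rule local_section.lift_classification) (rule that)
qed

section \<open>Lifting actions on Hopf quotients\<close>

lemma entry_le_near_one:
  assumes "near_one s A" shows "norm ((A - mat 1) $ i $ j) \<le> s"
proof -
  have "(A - mat 1) $ i $ j = (A *v axis j 1 - axis j 1) $ i"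
    by (simp add: matrix_vector_mult_def axis_def mat_def if_distrib[of "\<lambda>x. _ * x"] cong: if_cong)
  also have "norm \<dots> \<le> norm (A *v axis j 1 - axis j 1)" by (rule Finite_Cartesian_Product.norm_nth_le)
  also have "\<dots> \<le> s * norm (axis j (1::complex))" using assms by (simp only: near_one_def)
  finally show ?thesis by simp
qed

text \<open>Translates \<open>near_one\<close> into the Euclidean norm of the matrix space, in whose
  topology the action is continuous.\<close>

lemma norm_le_near_one:
  fixes A :: "complex^'n^'n"
  assumes "near_one s A" shows "norm (A - mat 1) \<le> (real CARD('n))\<^sup>2 * s"
proof -
  have "norm (A - mat 1) \<le> (\<Sum>i\<in>UNIV. norm ((A - mat 1) $ i))" unfolding norm_vec_def by (rule L2_set_le_sum) simp
  also have "\<dots> \<le> (\<Sum>i\<in>(UNIV::'n set). \<Sum>j\<in>(UNIV::'n set). s)"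
  proof (rule sum_mono)
    fix i
    have "norm ((A - mat 1) $ i) \<le> (\<Sum>j\<in>UNIV. norm ((A - mat 1) $ i $ j))"
      unfolding norm_vec_def[of "(A - mat 1) $ i"] by (rule L2_set_le_sum) simp
    also have "\<dots> \<le> (\<Sum>j\<in>(UNIV::'n set). s)" by (intro sum_mono entry_le_near_one assms)
    finally show "norm ((A - mat 1) $ i) \<le> (\<Sum>j\<in>(UNIV::'n set). s)" .
  qed
  also have "\<dots> = (real CARD('n))\<^sup>2 * s" by (simp add: power2_eq_square)
  finally show ?thesis .
qed

text \<open>A priori the scalar depends on the vector. The basis vectors make \<open>X\<close>
  diagonal, and the vector of ones makes its diagonal entries equal.\<close>

lemma matrix_of_scalar_orbits:
  fixes X :: "complex^'n^'n"
  assumes "\<And>z. z \<noteq> 0 \<Longrightarrow> \<exists>\<gamma>\<in>\<Gamma>. X *v z = \<gamma> *s z"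
  obtains \<gamma> where "\<gamma> \<in> \<Gamma>" "X = mscale \<gamma> (mat 1)"
proof -
  define u :: "complex^'n" where "u = (\<chi> i. 1)"
  have "u \<noteq> 0" by (simp add: u_def vec_eq_iff)
  then obtain \<gamma> where \<gamma>: "\<gamma> \<in> \<Gamma>" "X *v u = \<gamma> *s u" using assms by blast
  have "\<exists>c. X *v axis j 1 = c *s axis j 1" for j
    using assms[of "axis j 1"] by (auto simp: axis_eq_0_iff)
  then obtain c where c: "\<And>j. X *v axis j 1 = c j *s axis j 1" by metis
  have X: "X $ i $ j = (if i = j then c j else 0)" for i j
  proof -
    have "X $ i $ j = (X *v axis j 1) $ i"
      by (simp add: matrix_vector_mult_def axis_def if_distrib[of "\<lambda>x. _ * x"] cong: if_cong)
    then show ?thesis unfolding c by (simp add: axis_def)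
  qed
  have "c i = \<gamma>" for i
  proof -
    have "(X *v u) $ i = c i" by (simp add: matrix_vector_mult_def X u_def)
    then have "(\<gamma> *s u) $ i = c i" by (simp only: \<gamma>)
    then show ?thesis by (simp add: u_def)
  qed
  then have "X = mscale \<gamma> (mat 1)" by (simp add: vec_eq_iff X mscale_def mat_def)
  then show ?thesis using that \<gamma> by blast
qed

locale hopf_action =
  fixes d :: complex and m :: nat and act :: "complex^'n^'n \<Rightarrow> (complex^'n) set set \<Rightarrow> (complex^'n) set set"
  assumes n2: "CARD('n) \<ge> 2" and d0: "d \<noteq> 0" and d1: "norm d \<noteq> 1" and m0: "m > 0"
    and hol: "holomorphic_unitary_action (hopf_quotient_topology d m) (hopf_quotient_charts d m) act"
    and eff: "effective_action unitary_group (hopf_quotient d m) act"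
begin

abbreviation cl :: "complex^'n \<Rightarrow> (complex^'n) set set" where "cl \<equiv> hopf_quotient_class d m"

text \<open>Linearity is built in, so the existence of lifts is an analytic statement; invertibility
  keeps the image inside the punctured space.\<close>

definition lifts :: "complex^'n^'n \<Rightarrow> complex^'n^'n \<Rightarrow> bool" where
  "lifts A g \<longleftrightarrow> A \<in> unitary_matrices \<and> invertible g \<and> (\<forall>z. z \<noteq> 0 \<longrightarrow> act A (cl z) = cl (g *v z))"

lemma cl_in: "z \<noteq> 0 \<Longrightarrow> cl z \<in> hopf_quotient d m"
  by (simp add: hopf_quotient_image)

lemma cl_eq: "z \<noteq> 0 \<Longrightarrow> w \<noteq> 0 \<Longrightarrow> cl z = cl w \<longleftrightarrow> (\<exists>c\<in>hopf_deck d m. w = c *s z)"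
  by (rule hopf_quotient_class_eq_iff[OF d0 m0])

lemma cl_scale: "z \<noteq> 0 \<Longrightarrow> c \<in> hopf_deck d m \<Longrightarrow> cl (c *s z) = cl z"
  using cl_eq[of z "c *s z"] deck_nz[OF d0 m0] by (auto simp: cvec_scale_eq_0)

lemma group_act: "group_action unitary_group (hopf_quotient d m) act"
  using hol by (simp add: holomorphic_unitary_action_def)

lemma act_one: "x \<in> hopf_quotient d m \<Longrightarrow> act (mat 1) x = x"
  using group_action.id_eq_one[OF group_act] by (metis restrict_apply' unitary_group_def monoid.select_convs(2))

lemma act_mult:
  "x \<in> hopf_quotient d m \<Longrightarrow> A \<in> unitary_matrices \<Longrightarrow> B \<in> unitary_matrices \<Longrightarrow> act (A ** B) x = act A (act B x)"
  using group_action.composition_rule[OF group_act, of x A B] by (simp add: unitary_group_def)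

lemma invertible_nonzero: "invertible g \<Longrightarrow> z \<noteq> 0 \<Longrightarrow> g *v z \<noteq> 0" for g :: "complex^'n^'n"
  by (metis matrix_inv_left matrix_vector_mul_assoc matrix_vector_mul_lid matrix_vector_mult_0_right)

text \<open>Continuity at the identity and the class of \<open>z0\<close>, read through the open
  projection: the image of a small ball about \<open>z0\<close> is a neighbourhood, so a moved class
  has a representative in that ball.\<close>

lemma displacement_local:
  assumes z0: "z0 \<noteq> 0" and \<epsilon>: "0 < \<epsilon>" "\<epsilon> \<le> 1"
  obtains s t where "s > 0" "t > 0" "0 \<notin> ball z0 t"
    "\<And>A z. A \<in> unitary_matrices \<Longrightarrow> near_one s A \<Longrightarrow> z \<in> ball z0 t \<Longrightarrow>
      \<exists>w. w \<noteq> 0 \<and> act A (cl z) = cl w \<and> norm (w - z) \<le> \<epsilon> * norm z"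
proof -
  \<comment> \<open>Both points lie within \<open>e\<close> of \<open>z0\<close>, so they are at
    most \<open>2 * e\<close> apart; the factor 1/4 absorbs this and the passage from
    \<open>norm z0\<close> to \<open>norm z\<close>.\<close>
  define e where "e = \<epsilon> * norm z0 / 4"
  have e: "e > 0" "4 * e \<le> norm z0" using z0 \<epsilon> by (auto simp: e_def)
  have V0: "0 \<notin> ball z0 e" using e z0 by (auto simp: dist_norm)
  let ?X = "hopf_quotient_topology d m" and ?U = "top_of_set unitary_matrices"
  have cont: "continuous_map (prod_topology ?U ?X) ?X (\<lambda>(A, x). act A x)"
    using hol by (simp add: holomorphic_unitary_action_def)
  have "openin ?X (cl ` ball z0 e)" by (rule openin_hopf_image[OF d0 m0 d1 open_ball V0])
  then have "openin (prod_topology ?U ?X) {p \<in> topspace (prod_topology ?U ?X). (case p of (A, x) \<Rightarrow> act A x) \<in> cl ` ball z0 e}" (is "openin _ ?S")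
    using cont by (rule openin_continuous_map_preimage[rotated])
  moreover have "(mat 1, cl z0) \<in> ?S"
    using z0 e act_one[OF cl_in[OF z0]] cl_in[OF z0] by (auto simp: unitary_matrices_def)
  ultimately obtain P Q where PQ: "openin ?U P" "openin ?X Q" "mat 1 \<in> P" "cl z0 \<in> Q" "P \<times> Q \<subseteq> ?S"
    unfolding openin_prod_topology_alt by meson
  obtain \<delta> where \<delta>: "\<delta> > 0" "ball (mat 1) \<delta> \<inter> unitary_matrices \<subseteq> P"
  proof -
    have "\<forall>x\<in>P. \<exists>e>0. ball x e \<inter> unitary_matrices \<subseteq> P"
      using PQ(1) unfolding openin_contains_ball by (rule conjunct2)
    from bspec[OF this PQ(3)] show ?thesis using that by (elim exE conjE)
  qed
  define s where "s = \<delta> / (2 * (real CARD('n))\<^sup>2)"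
  have s: "s > 0" using \<delta> n2 by (simp add: s_def)
  have "open {z \<in> - {0}. cl z \<in> Q}" using PQ(2) by (simp add: openin_hopf_quotient)
  then obtain t0 where t0: "t0 > 0" "ball z0 t0 \<subseteq> {z \<in> - {0}. cl z \<in> Q}"
  proof -
    have "z0 \<in> {z \<in> - {0}. cl z \<in> Q}" using PQ(4) z0 by simp
    with \<open>open {z \<in> - {0}. cl z \<in> Q}\<close> show ?thesis by (rule openE) (rule that)
  qed
  define t where "t = min t0 e"
  show ?thesis
  proof (rule that[of s t])
    show "s > 0" "t > 0" using s t0 e by (auto simp: t_def)
    show "0 \<notin> ball z0 t" using V0 by (auto simp: t_def)
    fix A :: "complex^'n^'n" and z assume A: "A \<in> unitary_matrices" "near_one s A" and z: "z \<in> ball z0 t"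
    have "norm (A - mat 1) \<le> \<delta> / 2" using norm_le_near_one[OF A(2)] n2 by (simp add: s_def)
    then have "A \<in> P" using \<delta> A by (auto simp: dist_norm norm_minus_commute)
    moreover have "cl z \<in> Q" using z t0 by (auto simp: t_def)
    ultimately have "(A, cl z) \<in> ?S" using PQ(5) by blast
    then obtain w where w: "act A (cl z) = cl w" "w \<in> ball z0 e" by auto
    have "norm (w - z) \<le> norm (z0 - z) + norm (z0 - w)" using norm_triangle_ineq4[of "z0 - z" "z0 - w"] by simp
    also have "\<dots> \<le> 2 * e" using w z by (simp add: dist_norm t_def)
    finally have wz: "norm (w - z) \<le> 2 * e" .
    have "norm z0 \<le> norm z + norm (z0 - z)" by (metis diff_add_cancel norm_triangle_ineq add.commute)
    then have "norm z0 / 2 \<le> norm z" using z e by (simp add: dist_norm t_def)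
    then have "2 * e \<le> \<epsilon> * norm z" using mult_left_mono[of "norm z0 / 2" "norm z" \<epsilon>] \<epsilon> by (simp add: e_def)
    then have "norm (w - z) \<le> \<epsilon> * norm z" using wz by linarith
    moreover have "w \<noteq> 0" using w V0 by auto
    ultimately show "\<exists>w. w \<noteq> 0 \<and> act A (cl z) = cl w \<and> norm (w - z) \<le> \<epsilon> * norm z" using w by blast
  qed
qed

text \<open>Compactness of the quotient makes the radius uniform. The estimate transfers from a
  representative in one of finitely many balls to \<open>z\<close> because the relative displacement
  is unchanged by deck scalars.\<close>

lemma displacement:
  assumes \<epsilon>: "0 < \<epsilon>" "\<epsilon> \<le> 1"
  obtains s where "s > 0"
    "\<And>A z. A \<in> unitary_matrices \<Longrightarrow> near_one s A \<Longrightarrow> z \<noteq> 0 \<Longrightarrow>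
      \<exists>w. w \<noteq> 0 \<and> act A (cl z) = cl w \<and> norm (w - z) \<le> \<epsilon> * norm z"
proof -
  let ?X = "hopf_quotient_topology d m :: (complex^'n) set set topology"
  define P where "P = (\<lambda>z0 s t. s > 0 \<and> t > 0 \<and> 0 \<notin> ball z0 t \<and>
    (\<forall>A z. A \<in> unitary_matrices \<longrightarrow> near_one s A \<longrightarrow> z \<in> ball z0 t \<longrightarrow>
      (\<exists>w. w \<noteq> 0 \<and> act A (cl z) = cl w \<and> norm (w - z) \<le> \<epsilon> * norm z)))"
  have "\<exists>s t. P z0 s t" if "z0 \<noteq> 0" for z0
    using displacement_local[OF that \<epsilon>] unfolding P_def by metis
  then obtain S T where ST: "\<And>z0. z0 \<noteq> 0 \<Longrightarrow> P z0 (S z0) (T z0)" by metis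
  define \<U> where "\<U> = (\<lambda>z0. cl ` ball z0 (T z0)) ` (- {0})"
  have op: "openin ?X U" if "U \<in> \<U>" for U
    using that ST by (auto simp: \<U>_def P_def intro!: openin_hopf_image[OF d0 m0 d1])
  have "topspace ?X \<subseteq> \<Union>\<U>"
  proof
    fix x assume "x \<in> topspace ?X"
    then obtain z where "z \<noteq> 0" "x = cl z" by (auto simp: hopf_quotient_image)
    then show "x \<in> \<Union>\<U>" using ST[of z] by (auto simp: \<U>_def P_def intro!: bexI[of _ z])
  qed
  then obtain \<F> where F: "finite \<F>" "\<F> \<subseteq> \<U>" "topspace ?X \<subseteq> \<Union>\<F>"
    using compact_space_hopf_quotient[OF d0 m0 d1, where 'n='n] op
    unfolding compact_space_def compactin_def by meson
  then obtain Z where Z: "Z \<subseteq> - {0}" "finite Z" "\<F> = (\<lambda>z0. cl ` ball z0 (T z0)) ` Z"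
    using finite_subset_image[OF F(1) F(2)[unfolded \<U>_def]] by (elim exE conjE)
  define s where "s = Min (insert 1 (S ` Z))"
  have "S z > 0" if "z \<in> Z" for z using ST[of z] that Z(1) by (auto simp: P_def)
  then have s0: "s > 0" unfolding s_def using Z(2) by (subst Min_gr_iff) auto
  show ?thesis
  proof (rule that[OF s0])
    fix A :: "complex^'n^'n" and z :: "complex^'n"
    assume A: "A \<in> unitary_matrices" "near_one s A" and z: "z \<noteq> 0"
    have "cl z \<in> \<Union>\<F>" using F(3) cl_in[OF z] by auto
    then obtain z0 y where z0: "z0 \<in> Z" "y \<in> ball z0 (T z0)" "cl z = cl y" unfolding Z(3) by auto
    have P: "P z0 (S z0) (T z0)" using ST Z z0 by blast
    then have y0: "y \<noteq> 0" using z0 by (auto simp: P_def)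
    have "s \<le> S z0" unfolding s_def using Z z0 by (intro Min_le) auto
    then have "near_one (S z0) A" using A near_one_mono by blast
    then obtain w where w: "w \<noteq> 0" "act A (cl y) = cl w" "norm (w - y) \<le> \<epsilon> * norm y"
      using P A z0 unfolding P_def by blast
    obtain c where c: "c \<in> hopf_deck d m" "z = c *s y" using cl_eq[OF y0 z] z0 by auto
    have "c *s w \<noteq> 0" using w z c by (auto simp: cvec_scale_eq_0)
    moreover have "act A (cl z) = cl (c *s w)" using z0 w cl_scale[OF w(1) c(1)] by simp
    moreover have "norm (c *s w - z) \<le> \<epsilon> * norm z"
    proof -
      have "c *s w - z = c *s (w - y)" by (simp add: c vector_ssub_ldistrib)
      then have "norm (c *s w - z) = norm c * norm (w - y)" by (simp only: norm_cvec_scale)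
      then show ?thesis using mult_left_mono[OF w(3), of "norm c"] by (simp add: c norm_cvec_scale mult_ac)
    qed
    ultimately show "\<exists>w. w \<noteq> 0 \<and> act A (cl z) = cl w \<and> norm (w - z) \<le> \<epsilon> * norm z" by blast
  qed
qed

section \<open>Isolation of deck scalars and uniqueness of nearby representatives\<close>

lemma deck_discrete: "\<exists>\<eta>>0. \<forall>\<gamma>\<in>hopf_deck d m. norm (\<gamma> - 1) < \<eta> \<longrightarrow> \<gamma> = 1"
proof -
  define F where "F = {c \<in> hopf_deck d m. 1/2 \<le> norm c \<and> norm c \<le> 2}"
  have F: "finite F" unfolding F_def by (rule finite_deck_annulus[OF d0 m0 d1]) simp
  define \<eta> where "\<eta> = Min (insert (1/2) ((\<lambda>c. norm (c - 1)) ` (F - {1})))"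
  have "\<eta> > 0" unfolding \<eta>_def using F by (subst Min_gr_iff) auto
  moreover have "\<gamma> = 1" if \<gamma>: "\<gamma> \<in> hopf_deck d m" "norm (\<gamma> - 1) < \<eta>" for \<gamma>
  proof (rule ccontr)
    assume ne: "\<gamma> \<noteq> 1"
    have "\<eta> \<le> 1/2" unfolding \<eta>_def using F by (intro Min_le) auto
    then have "norm (\<gamma> - 1) < 1/2" using \<gamma> by linarith
    then have "1/2 \<le> norm \<gamma>" "norm \<gamma> \<le> 2"
      using norm_triangle_ineq2[of 1 \<gamma>] norm_triangle_ineq2[of \<gamma> 1] by (simp_all add: norm_minus_commute)
    then have "\<gamma> \<in> F - {1}" using \<gamma> ne by (simp add: F_def)
    then have "\<eta> \<le> norm (\<gamma> - 1)" unfolding \<eta>_def using F by (intro Min_le) auto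
    then show False using \<gamma> by simp
  qed
  ultimately show ?thesis by blast
qed

lemma near_representative_unique:
  obtains \<epsilon> where "0 < \<epsilon>" "\<epsilon> \<le> 1/4"
    "\<And>z w w'. z \<noteq> 0 \<Longrightarrow> w \<noteq> 0 \<Longrightarrow> w' \<noteq> 0 \<Longrightarrow> cl w = cl w' \<Longrightarrow> norm (w - z) \<le> \<epsilon> * norm z \<Longrightarrow>
      norm (w' - z) \<le> \<epsilon> * norm z \<Longrightarrow> w = w'"
proof -
  obtain \<eta> where \<eta>: "\<eta> > 0" "\<And>\<gamma>. \<gamma> \<in> hopf_deck d m \<Longrightarrow> norm (\<gamma> - 1) < \<eta> \<Longrightarrow> \<gamma> = 1" using deck_discrete by blast
  define \<epsilon> where "\<epsilon> = min (1/4) (\<eta> / 8)"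
  have \<epsilon>: "0 < \<epsilon>" "\<epsilon> \<le> 1/4" "4 * \<epsilon> < \<eta>" using \<eta> by (auto simp: \<epsilon>_def)
  show ?thesis
  proof (rule that[OF \<epsilon>(1,2)])
    fix z w w' :: "complex^'n"
    assume nz: "z \<noteq> 0" "w \<noteq> 0" "w' \<noteq> 0" "cl w = cl w'" and n: "norm (w - z) \<le> \<epsilon> * norm z" "norm (w' - z) \<le> \<epsilon> * norm z"
    obtain c where c: "c \<in> hopf_deck d m" "w' = c *s w" using cl_eq nz by metis
    have "(c - 1) *s w = (w' - z) - (w - z)" by (simp add: c vector_sub_rdistrib)
    then have cw: "norm (c - 1) * norm w \<le> 2 * \<epsilon> * norm z"
      using norm_triangle_ineq4[of "w' - z" "w - z"] n by (simp flip: norm_cvec_scale)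
    have "\<epsilon> * norm z \<le> 1/4 * norm z" using \<epsilon> by (intro mult_right_mono) auto
    moreover have "norm z - norm w \<le> norm (w - z)" by (metis norm_triangle_ineq2 norm_minus_commute)
    moreover have "0 \<le> norm z" by simp
    ultimately have "norm z / 2 \<le> norm w" using n by linarith
    then have "norm (c - 1) * (norm z / 2) \<le> norm (c - 1) * norm w" by (intro mult_left_mono) auto
    then have "norm (c - 1) * (norm z / 2) \<le> 4 * \<epsilon> * (norm z / 2)" using cw by linarith
    then have "norm (c - 1) < \<eta>" using nz \<epsilon> by simp
    then have "c = 1" using \<eta> c by blast
    then show "w = w'" by (simp add: c)
  qed
qed

end

section \<open>Holomorphy and linearity of the lift\<close>

context hopf_action
begin

text \<open>\<open>F\<close> is chosen point by point and carries no regularity of its own. Local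
  inverses of the projection at \<open>z0\<close> and \<open>F z0\<close> give a holomorphic lift
  \<open>G\<close> with the same value at \<open>z0\<close>. The slack between
  \<open>\<epsilon>\<close> and \<open>\<epsilon>'\<close> keeps \<open>G\<close> in the range of
  uniqueness nearby, so there it equals \<open>F\<close>.\<close>

lemma lift_derivative:
  assumes A: "A \<in> unitary_matrices" and \<epsilon>: "\<epsilon> < \<epsilon>'"
    and uni: "\<And>z w w'. z \<noteq> 0 \<Longrightarrow> w \<noteq> 0 \<Longrightarrow> w' \<noteq> 0 \<Longrightarrow> cl w = cl w' \<Longrightarrow> norm (w - z) \<le> \<epsilon>' * norm z \<Longrightarrow>
      norm (w' - z) \<le> \<epsilon>' * norm z \<Longrightarrow> w = w'"
    and F: "\<And>z. z \<noteq> 0 \<Longrightarrow> F z \<noteq> 0 \<and> act A (cl z) = cl (F z) \<and> norm (F z - z) \<le> \<epsilon> * norm z"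
    and z0: "z0 \<noteq> 0"
  shows "\<exists>D. (F has_derivative D) (at z0) \<and> Vector_Spaces.linear (*s) (*s) D"
proof -
  let ?X = "hopf_quotient_topology d m" and ?\<A> = "hopf_quotient_charts d m"
  have Fz0: "F z0 \<noteq> 0" using F z0 by blast
  obtain P where P: "open P" "0 \<notin> P" "z0 \<in> P" "inj_on cl P"
    using hopf_quotient_class_local_inj[OF d0 m0 d1 z0] .
  obtain Q where Q: "open Q" "0 \<notin> Q" "F z0 \<in> Q" "inj_on cl Q"
    using hopf_quotient_class_local_inj[OF d0 m0 d1 Fz0] .
  define \<phi> \<psi> where "\<phi> = inv_into P cl" and "\<psi> = inv_into Q cl"
  have ch: "(cl ` P, \<phi>) \<in> ?\<A>" "(cl ` Q, \<psi>) \<in> ?\<A>"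
    using P Q unfolding hopf_quotient_charts_def \<phi>_def \<psi>_def by blast+
  have "holomorphic_map ?X ?\<A> ?X ?\<A> (act A)"
    using hol A by (simp add: holomorphic_unitary_action_def biholomorphic_self_map_def)
  then have hv: "holomorphic_vec_on (\<lambda>z. \<psi> (act A (inv_into (cl ` P) \<phi> z))) (\<phi> ` {x \<in> cl ` P. act A x \<in> cl ` Q})"
    using ch unfolding holomorphic_map_def by blast
  define G where "G = (\<lambda>z. \<psi> (act A (inv_into (cl ` P) \<phi> z)))"
  define S where "S = \<phi> ` {x \<in> cl ` P. act A x \<in> cl ` Q}"
  have \<phi>cl: "\<phi> (cl z) = z" if "z \<in> P" for z using that P by (simp add: \<phi>_def)
  have inv\<phi>: "inv_into (cl ` P) \<phi> z = cl z" if "z \<in> P" for z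
  proof (rule inv_into_f_eq)
    show "inj_on \<phi> (cl ` P)" unfolding \<phi>_def by (rule inj_on_inv_into) simp
  qed (use that \<phi>cl in auto)
  have SP: "z \<in> P" "cl (G z) = act A (cl z)" "G z \<in> Q" if zS: "z \<in> S" for z
  proof -
    obtain y where y: "y \<in> P" "act A (cl y) \<in> cl ` Q" "z = \<phi> (cl y)" using zS unfolding S_def by blast
    then have zy: "z = y" using \<phi>cl by simp
    then show "z \<in> P" using y by simp
    have "G z = inv_into Q cl (act A (cl y))" using y zy inv\<phi>[of y] by (simp add: G_def \<psi>_def)
    then show "cl (G z) = act A (cl z)" "G z \<in> Q"
      using y zy f_inv_into_f[of "act A (cl y)" cl Q] inv_into_into[of "act A (cl y)" cl Q] by auto
  qed
  have z0S: "z0 \<in> S" unfolding S_def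
    by (rule image_eqI[of _ _ "cl z0"]) (use P Q F[OF z0] \<phi>cl in auto)
  obtain D where D: "(G has_derivative D) (at z0)" "Vector_Spaces.linear (*s) (*s) D" and oS: "open S"
    using hv z0S unfolding holomorphic_vec_on_def G_def[symmetric] S_def[symmetric] by blast
  have Gz0: "G z0 = F z0"
    using SP[OF z0S] F[OF z0] Q by (metis inj_onD)
  have "isCont G z0" by (rule has_derivative_continuous[OF D(1)])
  then have "isCont (\<lambda>z. \<epsilon>' * norm z - norm (G z - z)) z0" by (intro continuous_intros)
  then have "((\<lambda>z. \<epsilon>' * norm z - norm (G z - z)) \<longlongrightarrow> \<epsilon>' * norm z0 - norm (G z0 - z0)) (nhds z0)"
    using tendsto_at_iff_tendsto_nhds unfolding isCont_def by blast
  moreover have "0 < \<epsilon>' * norm z0 - norm (G z0 - z0)"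
  proof -
    have "\<epsilon> * norm z0 < \<epsilon>' * norm z0" using \<epsilon> z0 by simp
    then show ?thesis using F[OF z0] by (simp add: Gz0)
  qed
  ultimately have "\<forall>\<^sub>F z in nhds z0. 0 < \<epsilon>' * norm z - norm (G z - z)" by (rule order_tendstoD(1))
  then obtain N where N: "open N" "z0 \<in> N" "\<And>z. z \<in> N \<Longrightarrow> 0 < \<epsilon>' * norm z - norm (G z - z)"
    unfolding eventually_nhds by blast
  have "G z = F z" if z: "z \<in> S \<inter> N" for z
  proof (rule uni)
    have "z \<in> P" "G z \<in> Q" using z SP(1)[of z] SP(3)[of z] by simp_all
    then show nz: "z \<noteq> 0" and "G z \<noteq> 0" using P(2) Q(2) by metis+
    show "F z \<noteq> 0" "cl (G z) = cl (F z)" using F[OF nz] SP(2) z by auto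
    show "norm (G z - z) \<le> \<epsilon>' * norm z" using N z by fastforce
    have "\<epsilon> * norm z \<le> \<epsilon>' * norm z" using \<epsilon> by (intro mult_right_mono) auto
    then show "norm (F z - z) \<le> \<epsilon>' * norm z" using F[OF nz] by linarith
  qed
  then have "(F has_derivative D) (at z0)"
    using has_derivative_transform_within_open[OF D(1) open_Int[OF oS N(1)]] z0S N(2) by blast
  then show ?thesis using D by blast
qed

lemma exists_near_lift:
  assumes "\<epsilon> > 0"
  shows "\<exists>s>0. \<forall>A\<in>unitary_matrices. near_one s A \<longrightarrow> (\<exists>g. lifts A g \<and> near_one \<epsilon> g)"
proof -
  obtain \<epsilon>' where \<epsilon>': "0 < \<epsilon>'" "\<epsilon>' \<le> 1/4"
    and uni: "\<And>z w w'. z \<noteq> 0 \<Longrightarrow> w \<noteq> 0 \<Longrightarrow> w' \<noteq> 0 \<Longrightarrow> cl w = cl w' \<Longrightarrow> norm (w - z) \<le> \<epsilon>' * norm z \<Longrightarrow>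
      norm (w' - z) \<le> \<epsilon>' * norm z \<Longrightarrow> w = w'" using near_representative_unique by metis
  define e where "e = min \<epsilon> (\<epsilon>' / 2)"
  have e: "0 < e" "e \<le> 1/8" "e < \<epsilon>'" "e \<le> \<epsilon>" using \<epsilon>' assms by (auto simp: e_def)
  have e1: "e \<le> 1" using e by simp
  obtain s where s: "s > 0" "\<And>A z. A \<in> unitary_matrices \<Longrightarrow> near_one s A \<Longrightarrow> z \<noteq> 0 \<Longrightarrow>
      \<exists>w. w \<noteq> 0 \<and> act A (cl z) = cl w \<and> norm (w - z) \<le> e * norm z" using displacement[OF e(1) e1] by metis
  have "\<exists>g. lifts A g \<and> near_one \<epsilon> g" if A: "A \<in> unitary_matrices" "near_one s A" for A
  proof -
    obtain F where F: "\<And>z. z \<noteq> 0 \<Longrightarrow> F z \<noteq> 0 \<and> act A (cl z) = cl (F z) \<and> norm (F z - z) \<le> e * norm z"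
      using s(2)[OF A] by metis
    have bound: "norm (F z) \<le> (1 + e) * norm z" if "z \<noteq> 0" for z
    proof -
      have "norm (F z) \<le> norm (F z - z) + norm z" by (metis diff_add_cancel norm_triangle_ineq)
      then show ?thesis using F[OF that] by (simp add: algebra_simps)
    qed
    have der: "\<exists>D. (F has_derivative D) (at z) \<and> Vector_Spaces.linear (*s) (*s) D" if "z \<noteq> 0" for z
      by (rule lift_derivative[OF A(1) e(3) uni F that])
    obtain g where g: "\<And>z. z \<noteq> 0 \<Longrightarrow> F z = g *v z"
      using holomorphic_linear_growth_imp_linear[OF der bound] by metis
    have "invertible g"
      unfolding invertible_left_inverse matrix_left_invertible_ker using F g by metis
    then have "lifts A g" using A F g by (auto simp: lifts_def)
    moreover have "near_one e g"
      unfolding near_one_def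
    proof
      fix z show "norm (g *v z - z) \<le> e * norm z" using F[of z] g[of z] by (cases "z = 0") auto
    qed
    then have "near_one \<epsilon> g" using e near_one_mono by blast
    ultimately show ?thesis by blast
  qed
  then show ?thesis using s(1) by blast
qed

sublocale linear_lift lifts "hopf_deck d m"
proof
  show "2 \<le> CARD('n)" by (rule n2)
  have one: "mat 1 \<in> (unitary_matrices :: (complex^'n^'n) set)" by (simp add: unitary_matrices_def)
  show "lifts (mat 1) (mat 1)"
    using act_one[OF cl_in] one by (auto simp: lifts_def invertible_def intro!: exI[of _ "mat 1"])
  show "lifts (A ** B) (g ** h)" if "lifts A g" "lifts B h" for A g B h
    using that act_mult[OF cl_in, of _ A B] invertible_nonzero[of h]
    by (auto simp: lifts_def unitary_matrices_mult invertible_mult matrix_vector_mul_assoc)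
  show "A \<in> unitary_matrices" if "lifts A g" for A g using that by (simp add: lifts_def)
  show "\<exists>h. g ** h = mat 1 \<and> h ** g = mat 1 \<and> lifts (adjoint_matrix A) h" if l: "lifts A g" for A g
  proof -
    have A: "A \<in> unitary_matrices" and ig: "invertible g" and ac: "\<And>z. z \<noteq> 0 \<Longrightarrow> act A (cl z) = cl (g *v z)"
      using l by (auto simp: lifts_def)
    let ?h = "matrix_inv g"
    have h: "g ** ?h = mat 1" "?h ** g = mat 1" using ig by (simp_all add: matrix_inv_cancel)
    then have ih: "invertible ?h" unfolding invertible_def by blast
    have "act (adjoint_matrix A) (cl z) = cl (?h *v z)" if z: "z \<noteq> 0" for z
    proof -
      have hz: "?h *v z \<noteq> 0" using invertible_nonzero[OF ih z] .
      have "cl z = act A (cl (?h *v z))" using ac[OF hz] by (simp add: matrix_vector_mul_assoc h)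
      then have "act (adjoint_matrix A) (cl z) = act (adjoint_matrix A ** A) (cl (?h *v z))"
        using act_mult[OF cl_in[OF hz] adjoint_unitary[OF A] A] by simp
      then show ?thesis using act_one[OF cl_in[OF hz]] by (simp add: unitary_inverse[OF A])
    qed
    then have "lifts (adjoint_matrix A) ?h" using ih adjoint_unitary[OF A] by (simp add: lifts_def)
    then show ?thesis using h by blast
  qed
  show "\<exists>\<gamma>\<in>hopf_deck d m. h = mscale \<gamma> g" if l: "lifts A g" "lifts A h" for A g h
  proof -
    have ig: "invertible g" "invertible h" using l by (auto simp: lifts_def)
    \<comment> \<open>The deck scalar depends on \<open>z\<close> at first;
      \<open>matrix_of_scalar_orbits\<close> removes this dependence.\<close>
    have "\<exists>\<gamma>\<in>hopf_deck d m. (matrix_inv g ** h) *v z = \<gamma> *s z" if z: "z \<noteq> 0" for z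
    proof -
      have "cl (g *v z) = cl (h *v z)" using l z by (metis lifts_def)
      then obtain \<gamma> where \<gamma>: "\<gamma> \<in> hopf_deck d m" "h *v z = \<gamma> *s (g *v z)"
        using cl_eq[OF invertible_nonzero[OF ig(1) z] invertible_nonzero[OF ig(2) z]] by blast
      then have "(matrix_inv g ** h) *v z = \<gamma> *s ((matrix_inv g ** g) *v z)"
        by (simp add: mv_scale flip: matrix_vector_mul_assoc)
      then show ?thesis using \<gamma> by (auto simp: matrix_inv_left[OF ig(1)])
    qed
    then obtain \<gamma> where \<gamma>: "\<gamma> \<in> hopf_deck d m" "matrix_inv g ** h = mscale \<gamma> (mat 1)"
      by (rule matrix_of_scalar_orbits)
    then have "(g ** matrix_inv g) ** h = mscale \<gamma> g" by (simp add: mscale_simps flip: matrix_mul_assoc)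
    then show ?thesis using \<gamma> by (auto simp: matrix_inv_right[OF ig(1)])
  qed
  show "\<exists>\<eta>>0. \<forall>\<gamma>\<in>hopf_deck d m. norm (\<gamma> - 1) < \<eta> \<longrightarrow> \<gamma> = 1" by (rule deck_discrete)
  show "\<exists>r>0. \<forall>A\<in>unitary_matrices. near_one r A \<longrightarrow> (\<exists>g. lifts A g \<and> near_one \<epsilon> g)" if "\<epsilon> > 0" for \<epsilon>
    by (rule exists_near_lift[OF that])
  show "A = mat 1" if "lifts A (mat 1)" for A
    using that eff by (auto simp: lifts_def effective_action_def unitary_group_def hopf_quotient_image)
qed

end

section \<open>Central elements and the normal form\<close>

lemma mat_mv: "mat x *v z = x *s z" for z :: "complex^'n"
  by (simp add: vec_eq_iff matrix_vector_mult_def mat_def if_distrib[of "\<lambda>x. x * _"] cong: if_cong)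

lemma mat_diag_mat: "mat x = (diag_mat (\<lambda>_. x) :: complex^'n^'n)"
  by (simp add: mat_def diag_mat_def)

lemma mat_commute: "C ** mat x = mat x ** C" for C :: "complex^'n^'n"
  by (subst matrix_eq) (simp add: mat_mv mv_scale flip: matrix_vector_mul_assoc)

lemma mat_cis_unitary: "mat (cis t) \<in> (unitary_matrices :: (complex^'n^'n) set)"
  using torus_unitary[of "\<lambda>_. t"] by (simp add: torus_def mat_diag_mat)

lemma root_of_unity_special:
  assumes "k > 0" "k dvd CARD('n)"
  shows "mat (cis (2 * pi / real k)) \<in> (special_unitary_matrices :: (complex^'n^'n) set)"
proof -
  obtain l where l: "CARD('n) = k * l" using assms(2) by (rule dvdE)
  have "det (mat (cis (2 * pi / real k)) :: complex^'n^'n) = cis (2 * pi / real k) ^ (k * l)"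
    by (simp add: mat_diag_mat det_diag_mat l)
  also have "\<dots> = 1" using assms(1) by (simp add: power_mult Complex.DeMoivre)
  finally show ?thesis using mat_cis_unitary by (simp add: special_unitary_matrices_def)
qed

text \<open>\<open>t\<close> is the mean of the eigenvalue angles, so the remaining angles have sum
  zero.\<close>

lemma unitary_eq_scalar_mult_special:
  fixes A :: "complex^'n^'n"
  assumes A: "A \<in> unitary_matrices"
  obtains t B where "B \<in> special_unitary_matrices" "A = mat (cis t) ** B"
proof -
  obtain U \<theta> where U: "U \<in> unitary_matrices" "A = U ** torus \<theta> ** adjoint_matrix U"
    using unitary_spectral[OF A] by metis
  define t where "t = (\<Sum>i\<in>UNIV. \<theta> i) / real CARD('n)"
  define B where "B = U ** torus (\<lambda>i. \<theta> i - t) ** adjoint_matrix U"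
  have "(\<Sum>i\<in>UNIV. \<theta> i - t) = 0" by (simp add: sum_subtractf t_def)
  moreover have "det B = det (U ** adjoint_matrix U) * det (torus (\<lambda>i. \<theta> i - t))"
    by (simp add: B_def det_mul)
  ultimately have "det B = 1" by (simp add: unitary_inverse[OF U(1)] det_torus)
  then have "B \<in> special_unitary_matrices"
    using unitary_conj_torus[OF U(1)] by (simp add: special_unitary_matrices_def B_def)
  moreover have "mat (cis t) ** B = A"
  proof -
    have "mat (cis t) ** torus (\<lambda>i. \<theta> i - t) = torus \<theta>"
      by (simp add: mat_diag_mat torus_def diag_mat_mult cis_mult)
    moreover have "mat (cis t) ** B = U ** (mat (cis t) ** torus (\<lambda>i. \<theta> i - t)) ** adjoint_matrix U"
      unfolding B_def by (metis mat_commute matrix_mul_assoc)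
    ultimately show ?thesis by (simp add: U)
  qed
  ultimately show ?thesis using that by metis
qed

lemma exp_log_branch: "d \<noteq> 0 \<Longrightarrow> exp (of_real (ln (norm d)) + \<i> * of_real (Arg2pi d)) = d"
proof -
  assume "d \<noteq> 0"
  then have "exp (of_real (ln (norm d)) + \<i> * of_real (Arg2pi d)) = of_real (norm d) * exp (\<i> * of_real (Arg2pi d))"
    by (simp add: exp_add exp_of_real)
  then show ?thesis using Arg2pi_eq[of d] by simp
qed

text \<open>The real power is the exponential of a multiple of one fixed logarithm of
  \<open>d\<close>; the same branch serves for the integer powers of deck scalars.\<close>

lemma hopf_power_exp:
  "d \<noteq> 0 \<Longrightarrow> hopf_power d \<mu> = exp (of_real \<mu> * (of_real (ln (norm d)) + \<i> * of_real (Arg2pi d)))"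
proof -
  assume d: "d \<noteq> 0"
  have "exp (of_real \<mu> * (of_real (ln (norm d)) + \<i> * of_real (Arg2pi d))) =
      exp (of_real (\<mu> * ln (norm d))) * exp (\<i> * of_real (\<mu> * Arg2pi d))"
    by (simp add: algebra_simps flip: exp_add)
  also have "\<dots> = hopf_power d \<mu>"
    using d by (simp only: hopf_power_def cis_conv_exp exp_of_real) (simp add: powr_def)
  finally show ?thesis by simp
qed

section \<open>Central lifts, coprimality and the normal form\<close>

context hopf_action
begin

text \<open>Adds the sign \<open>\<sigma>\<close>: conjugation by \<open>C\<close> does not affect
  scalars, so a scalar of determinant 1 lifts to itself or to its conjugate.\<close>

lemma classified:
  obtains C c \<kappa> \<sigma> where "invertible C" "\<kappa> = (\<lambda>B. B) \<and> \<sigma> = 1 \<or> \<kappa> = map_matrix cnj \<and> \<sigma> = - 1"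
    "\<And>t::real. lifts (mat (cis t)) (mat (exp (of_real t * c)))"
    "\<And>B. B \<in> special_unitary_matrices \<Longrightarrow> lifts B (C ** \<kappa> B ** matrix_inv C)"
    "\<And>x. (mat (cis x) :: complex^'n^'n) \<in> special_unitary_matrices \<Longrightarrow> lifts (mat (cis x)) (mat (cis (\<sigma> * x)))"
proof -
  obtain C c \<kappa> where C: "invertible C" and \<kappa>: "\<kappa> = (\<lambda>B. B) \<or> \<kappa> = map_matrix cnj"
    and sc: "\<And>t::real. lifts (mat (cis t)) (mat (exp (of_real t * c)))"
    and B: "\<And>B. B \<in> special_unitary_matrices \<Longrightarrow> lifts B (C ** \<kappa> B ** matrix_inv C)"
    by (rule classification) (rule that)
  define \<sigma> :: real where "\<sigma> = (if \<kappa> = (\<lambda>B. B) then 1 else -1)"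
  have \<kappa>\<sigma>: "\<kappa> = (\<lambda>B. B) \<and> \<sigma> = 1 \<or> \<kappa> = map_matrix cnj \<and> \<sigma> = - 1" using \<kappa> by (auto simp: \<sigma>_def)
  have "map_matrix cnj (mat (cis x) :: complex^'n^'n) = mat (cis (- x))" for x
    by (simp add: vec_eq_iff mat_def cis_cnj)
  then have "\<kappa> (mat (cis x)) = mat (cis (\<sigma> * x))" for x using \<kappa>\<sigma> by auto
  moreover have "C ** mat y ** matrix_inv C = mat y" for y
  proof -
    have "C ** mat y ** matrix_inv C = mat y ** (C ** matrix_inv C)"
      by (simp only: mat_commute[of C y] matrix_mul_assoc)
    then show ?thesis by (simp add: matrix_inv_right[OF C])
  qed
  ultimately have "C ** \<kappa> (mat (cis x)) ** matrix_inv C = mat (cis (\<sigma> * x))" for x by simp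
  then show ?thesis using that[OF C \<kappa>\<sigma> sc B] B by metis
qed

text \<open>For the gcd \<open>k\<close>, divisibility of n puts the scalar of order
  \<open>k\<close> into the special unitary group, and divisibility of \<open>m\<close> puts its
  lift among the deck scalars.\<close>

theorem coprime_dimension: "coprime CARD('n) m"
proof -
  define k where "k = gcd CARD('n) m"
  have k: "k > 0" "k dvd CARD('n)" "k dvd m" using m0 by (auto simp: k_def)
  obtain l where l: "m = k * l" using k(3) by (rule dvdE)
  have l0: "l > 0" using m0 l by simp
  obtain \<sigma> :: real where \<sigma>: "\<sigma> = 1 \<or> \<sigma> = - 1"
    and lift: "\<And>x. (mat (cis x) :: complex^'n^'n) \<in> special_unitary_matrices \<Longrightarrow> lifts (mat (cis x)) (mat (cis (\<sigma> * x)))"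
    using classified by metis
  let ?x = "2 * pi / real k"
  have lx: "lifts (mat (cis ?x)) (mat (cis (\<sigma> * ?x)))"
    by (rule lift[OF root_of_unity_special[OF k(1,2)]])
  obtain q :: int where q: "\<sigma> = of_int q" using \<sigma> by (metis of_int_1 of_int_minus)
  have "\<sigma> * ?x = 2 * pi * real_of_int (q * int l) / real m"
    using k(1) l0 by (simp add: q l)
  then have deck: "cis (\<sigma> * ?x) \<in> hopf_deck d m"
    unfolding hopf_deck_def by (intro CollectI exI[of _ 0] exI[of _ "q * int l"]) simp
  have "act (mat (cis ?x)) (cl z) = cl (mat 1 *v z)" if "z \<noteq> 0" for z
    using lx that cl_scale[OF that deck] by (simp add: lifts_def mat_mv)
  then have "lifts (mat (cis ?x)) (mat 1)" using lx by (auto simp: lifts_def invertible_def intro!: exI[of _ "mat 1"])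
  then have "mat (cis ?x) = (mat 1 :: complex^'n^'n)" by (rule effective)
  then have "(mat (cis ?x) :: complex^'n^'n) $ undefined $ undefined = 1" by (simp add: mat_def)
  then have "cis ?x = 1" by (simp add: mat_def)
  then obtain j :: int where "?x = 2 * pi * of_int j" unfolding cis_eq_1_iff by blast
  then have "real_of_int (j * int k) = real_of_int 1" using k(1) by (simp add: field_simps)
  then have "int k * j = 1" by (simp only: of_int_eq_iff mult.commute)
  then have "k = 1" using zmult_eq_1_iff[of "int k" j] k(1) by auto
  then show ?thesis by (simp add: k_def coprime_iff_gcd_eq_1)
qed

text \<open>The scalar \<open>cis (2 * pi / n)\<close> has determinant 1, so it has one lift from
  the scalar family and one from the special unitary group. Their deck quotient fixes
  \<open>c\<close> up to an integer, and \<open>c\<close> gives the formula.\<close>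

theorem transitive_normal_form:
  assumes trans: "transitive_action unitary_group (hopf_quotient d m) act"
  obtains p q s :: int and C \<kappa> and \<sigma> :: real where "s \<noteq> 0" "invertible C"
    "\<kappa> = (\<lambda>B. B) \<and> \<sigma> = 1 \<or> \<kappa> = map_matrix cnj \<and> \<sigma> = - 1"
    "\<And>t B z. B \<in> special_unitary_matrices \<Longrightarrow> z \<noteq> 0 \<Longrightarrow> act (mat (cis t) ** B) (cl z) =
      cl ((cis ((\<sigma> + (of_int p + of_int q / real m) * real CARD('n)) * t) *
        hopf_power d (real CARD('n) * of_int s * t / (2 * pi))) *s ((C ** \<kappa> B ** matrix_inv C) *v z))"
proof -
  obtain C c \<kappa> and \<sigma> :: real where C: "invertible C" and \<kappa>: "\<kappa> = (\<lambda>B. B) \<and> \<sigma> = 1 \<or> \<kappa> = map_matrix cnj \<and> \<sigma> = - 1"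
    and sc: "\<And>t::real. lifts (mat (cis t)) (mat (exp (of_real t * c)))"
    and B: "\<And>B. B \<in> special_unitary_matrices \<Longrightarrow> lifts B (C ** \<kappa> B ** matrix_inv C)"
    and cen: "\<And>x. (mat (cis x) :: complex^'n^'n) \<in> special_unitary_matrices \<Longrightarrow> lifts (mat (cis x)) (mat (cis (\<sigma> * x)))"
    by (rule classified) (rule that)
  let ?n = "real CARD('n)"
  have n0: "?n > 0" using n2 by simp
  define lam where "lam = of_real (ln (norm d)) + \<i> * of_real (Arg2pi d)"
  have lam: "exp lam = d" unfolding lam_def by (rule exp_log_branch[OF d0])
  define t0 where "t0 = 2 * pi / ?n"
  have SU: "mat (cis t0) \<in> (special_unitary_matrices :: (complex^'n^'n) set)"
    unfolding t0_def by (rule root_of_unity_special) auto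
  obtain \<gamma> where \<gamma>: "\<gamma> \<in> hopf_deck d m" "mat (exp (of_real t0 * c)) = mscale \<gamma> (mat (cis (\<sigma> * t0)) :: complex^'n^'n)"
    using lift_unique[OF cen[OF SU] sc] by blast
  then have "(mat (exp (of_real t0 * c)) :: complex^'n^'n) $ undefined $ undefined = \<gamma> * cis (\<sigma> * t0)"
    by (simp only: mscale_def) (simp add: mat_def)
  then have e1: "exp (of_real t0 * c) = \<gamma> * cis (\<sigma> * t0)" by (simp add: mat_def)
  \<comment> \<open>\<open>s\<close> becomes the exponent of \<open>d\<close>, called
    \<open>r\<close> in the final statement, and \<open>q / m\<close> the fractional frequency; the
    integer \<open>p\<close> below is the ambiguity of the logarithm.\<close>
  obtain s q :: int where sq: "\<gamma> = d powi s * cis (2 * pi * of_int q / real m)"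
    using \<gamma>(1) by (auto simp: hopf_deck_def)
  have "d powi s = exp (of_int s * lam)" by (simp add: lam[symmetric] exp_power_int)
  then have "exp (of_real t0 * c) = exp (of_int s * lam + \<i> * of_real (2 * pi * of_int q / real m) + \<i> * of_real (\<sigma> * t0))"
    by (simp add: e1 sq cis_conv_exp exp_add)
  then obtain p :: int where p: "of_real t0 * c = of_int s * lam + \<i> * of_real (2 * pi * of_int q / real m)
      + \<i> * of_real (\<sigma> * t0) + of_int (2 * p) * of_real pi * \<i>"
    unfolding exp_eq by auto
  have tc: "of_real t * c = \<i> * of_real ((\<sigma> + (of_int p + of_int q / real m) * ?n) * t)
      + of_real (?n * of_int s * t / (2 * pi)) * lam" for t :: real
  proof -
    have t0: "t / t0 * t0 = t" "t / t0 = ?n * t / (2 * pi)" using n0 by (simp_all add: t0_def)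
    have "of_real t * c = of_real (t / t0) * (of_real t0 * c)"
      using t0(1) by (simp only: mult.assoc[symmetric] of_real_mult[symmetric])
    also have "\<dots> = of_real (t / t0) * of_int s * lam + \<i> * of_real (t / t0 * (2 * pi * of_int q / real m + \<sigma> * t0 + of_int (2 * p) * pi))"
      unfolding p by (simp add: algebra_simps)
    also have "t / t0 * (2 * pi * of_int q / real m + \<sigma> * t0 + of_int (2 * p) * pi) = (\<sigma> + (of_int p + of_int q / real m) * ?n) * t"
    proof -
      have "t / t0 * (2 * pi * of_int q / real m + \<sigma> * t0 + of_int (2 * p) * pi) =
          \<sigma> * (t / t0 * t0) + (?n * t / (2 * pi)) * (2 * pi * of_int q / real m + of_int (2 * p) * pi)"
        by (simp only: t0(2)[symmetric]) (simp add: algebra_simps)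
      also have "\<dots> = \<sigma> * t + (?n * t) * (of_int q / real m + of_int p)"
        unfolding t0(1) by (simp add: field_simps)
      finally show ?thesis by (simp add: algebra_simps)
    qed
    also have "of_real (t / t0) * of_int s = (of_real (?n * of_int s * t / (2 * pi)) :: complex)"
      unfolding t0(2) by simp
    finally show ?thesis by simp
  qed
  have ex: "exp (of_real t * c) = cis ((\<sigma> + (of_int p + of_int q / real m) * ?n) * t) * hopf_power d (?n * of_int s * t / (2 * pi))" for t :: real
    unfolding hopf_power_exp[OF d0] lam_def[symmetric] cis_conv_exp by (subst tc) (rule exp_add)
  have form: "act (mat (cis t) ** B) (cl z) = cl (exp (of_real t * c) *s ((C ** \<kappa> B ** matrix_inv C) *v z))"
    if "B \<in> special_unitary_matrices" "z \<noteq> 0" for t B z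
    using lift_mult[OF sc B[OF that(1)], of t] that(2) by (simp add: lifts_def mat_mv flip: matrix_vector_mul_assoc)
  have "s \<noteq> 0"
  proof
    assume s: "s = 0"
    \<comment> \<open>With \<open>s = 0\<close> the lifts in question preserve
      \<open>norm (matrix_inv C *v z)\<close>, so within an orbit this norm changes only by integral
      powers of \<open>norm d\<close>; the factor \<open>sqrt (norm d)\<close> would not be
      reached.\<close>
    define x where "x = sqrt (norm d)"
    have x: "x > 0" using d0 by (simp add: x_def)
    define u :: "complex^'n" where "u = axis undefined 1"
    have u: "u \<noteq> 0" "norm u = 1" by (simp_all add: u_def axis_eq_0_iff)
    have Cu: "C *v u \<noteq> 0" "of_real x *s (C *v u) \<noteq> 0"
      using invertible_nonzero[OF C u(1)] x by (auto simp: cvec_scale_eq_0)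
    obtain A where A: "A \<in> unitary_matrices" "act A (cl (C *v u)) = cl (of_real x *s (C *v u))"
      using transitive_action.unique_orbit[OF trans cl_in[OF Cu(1)] cl_in[OF Cu(2)]]
      by (auto simp: unitary_group_def)
    obtain t B where tB: "B \<in> special_unitary_matrices" "A = mat (cis t) ** B"
      using unitary_eq_scalar_mult_special[OF A(1)] .
    have \<kappa>u: "\<kappa> B \<in> unitary_matrices"
      using \<kappa> tB(1) map_matrix_cnj_unitary by (auto simp: special_unitary_matrices_def)
    have v: "(C ** \<kappa> B ** matrix_inv C) *v (C *v u) = C *v (\<kappa> B *v u)"
    proof -
      have "C ** \<kappa> B ** matrix_inv C ** C = C ** \<kappa> B"
        by (simp add: matrix_inv_left[OF C] flip: matrix_mul_assoc)
      then show ?thesis by (simp add: matrix_vector_mul_assoc)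
    qed
    have \<kappa>Bu: "norm (\<kappa> B *v u) = 1" using norm_unitary_mv[OF \<kappa>u] u by simp
    have e: "norm (exp (of_real t * c)) = 1"
      by (simp add: ex s hopf_power_def norm_mult d0)
    have nz: "exp (of_real t * c) *s (C *v (\<kappa> B *v u)) \<noteq> 0"
    proof -
      have "\<kappa> B *v u \<noteq> 0" using \<kappa>Bu by (metis norm_zero zero_neq_one)
      then show ?thesis using invertible_nonzero[OF C] by (simp add: cvec_scale_eq_0)
    qed
    have "cl (exp (of_real t * c) *s (C *v (\<kappa> B *v u))) = cl (of_real x *s (C *v u))"
      using form[OF tB(1) Cu(1), of t] A(2) tB(2) v by simp
    then obtain \<gamma> where \<gamma>: "\<gamma> \<in> hopf_deck d m" "of_real x *s (C *v u) = \<gamma> *s (exp (of_real t * c) *s (C *v (\<kappa> B *v u)))"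
      using cl_eq[OF nz Cu(2)] by blast
    have "C *v (of_real x *s u) = C *v ((\<gamma> * exp (of_real t * c)) *s (\<kappa> B *v u))"
      using \<gamma>(2) by (simp add: mv_scale vector_smult_assoc)
    then have "of_real x *s u = (\<gamma> * exp (of_real t * c)) *s (\<kappa> B *v u)"
      by (metis C matrix_inv_left matrix_vector_mul_assoc matrix_vector_mul_lid)
    then have "norm (complex_of_real x) * norm u = norm (\<gamma> * exp (of_real t * c)) * norm (\<kappa> B *v u)"
      by (metis norm_cvec_scale)
    then have "x = norm \<gamma>" using x e u \<kappa>Bu by (simp add: norm_mult)
    moreover obtain k K :: int where "\<gamma> = d powi k * cis (2 * pi * of_int K / real m)"
      using \<gamma>(1) by (auto simp: hopf_deck_def)
    ultimately have "x = norm d powi k" by (simp add: norm_mult norm_power_int)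
    then have "ln x = of_int k * ln (norm d)" using d0 by (simp add: powr_real_of_int'[symmetric] ln_powr)
    moreover have "ln x = ln (norm d) / 2" using d0 by (simp add: x_def ln_sqrt)
    moreover have "ln (norm d) \<noteq> 0" using d0 d1 by simp
    ultimately have "real_of_int (2 * k) = real_of_int 1" by simp
    then have "2 * k = 1" by (simp only: of_int_eq_iff)
    then show False by presburger
  qed
  then show ?thesis using that[OF _ C \<kappa>, of s p q] form unfolding ex by blast
qed

end

theorem theorem1p2:
  fixes d :: complex
  assumes "CARD('n::finite) \<ge> 2" and "d \<noteq> 0" and "norm d \<noteq> 1"
  shows "(\<forall>m::nat. m > 0 \<longrightarrow>
           (\<exists>act :: complex^'n^'n \<Rightarrow> (complex^'n) set set \<Rightarrow> (complex^'n) set set.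
              holomorphic_unitary_action (hopf_quotient_topology d m) (hopf_quotient_charts d m) act \<and>
              effective_action unitary_group (hopf_quotient d m) act) \<longrightarrow>
           coprime CARD('n) m) \<and>
         (\<forall>m::nat. \<forall>act :: complex^'n^'n \<Rightarrow> (complex^'n) set set \<Rightarrow> (complex^'n) set set.
           m > 0 \<longrightarrow>
           holomorphic_unitary_action (hopf_quotient_topology d m) (hopf_quotient_charts d m) act \<longrightarrow>
           effective_action unitary_group (hopf_quotient d m) act \<longrightarrow>
           transitive_action unitary_group (hopf_quotient d m) act \<longrightarrow>
           (\<exists>(p::int) (q::int) (r::int) (C :: complex^'n^'n). r \<noteq> 0 \<and> invertible C \<and>
             ((\<forall>t::real. \<forall>B\<in>special_unitary_matrices. \<forall>z. z \<noteq> 0 \<longrightarrow>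
                 act (mat (cis t) ** B) (hopf_quotient_class d m z) =
                 hopf_quotient_class d m
                   ((cis ((1 + (real_of_int p + real_of_int q / real m) * real CARD('n)) * t) *
                     hopf_power d (real CARD('n) * real_of_int r * t / (2 * pi))) *s
                    ((C ** B ** matrix_inv C) *v z))) \<or>
              (\<forall>t::real. \<forall>B\<in>special_unitary_matrices. \<forall>z. z \<noteq> 0 \<longrightarrow>
                 act (mat (cis t) ** B) (hopf_quotient_class d m z) =
                 hopf_quotient_class d m
                   ((cis ((- 1 + (real_of_int p + real_of_int q / real m) * real CARD('n)) * t) *
                     hopf_power d (real CARD('n) * real_of_int r * t / (2 * pi))) *s
                    ((C ** map_matrix cnj B ** matrix_inv C) *v z))))))"
proof (intro conjI allI impI)
  fix m :: nat
  assume m: "m > 0" and "\<exists>act :: complex^'n^'n \<Rightarrow> (complex^'n) set set \<Rightarrow> (complex^'n) set set.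
    holomorphic_unitary_action (hopf_quotient_topology d m) (hopf_quotient_charts d m) act \<and>
    effective_action unitary_group (hopf_quotient d m) act"
  then obtain act :: "complex^'n^'n \<Rightarrow> (complex^'n) set set \<Rightarrow> (complex^'n) set set" where
    "holomorphic_unitary_action (hopf_quotient_topology d m) (hopf_quotient_charts d m) act"
    "effective_action unitary_group (hopf_quotient d m) act" by blast
  then have "hopf_action d m act" using assms m by unfold_locales
  then show "coprime CARD('n) m" by (rule hopf_action.coprime_dimension)
next
  fix m :: nat and act :: "complex^'n^'n \<Rightarrow> (complex^'n) set set \<Rightarrow> (complex^'n) set set"
  assume "m > 0" "holomorphic_unitary_action (hopf_quotient_topology d m) (hopf_quotient_charts d m) act"
    "effective_action unitary_group (hopf_quotient d m) act"
    and trans: "transitive_action unitary_group (hopf_quotient d m) act"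
  then have "hopf_action d m act" using assms by unfold_locales
  then obtain p q s :: int and C :: "complex^'n^'n" and \<kappa> and \<sigma> :: real where s: "s \<noteq> 0" and C: "invertible C"
    and \<kappa>: "\<kappa> = (\<lambda>B. B) \<and> \<sigma> = 1 \<or> \<kappa> = map_matrix cnj \<and> \<sigma> = - 1"
    and form: "\<And>t B z. B \<in> special_unitary_matrices \<Longrightarrow> z \<noteq> 0 \<Longrightarrow> act (mat (cis t) ** B) (hopf_quotient_class d m z) =
      hopf_quotient_class d m ((cis ((\<sigma> + (of_int p + of_int q / real m) * real CARD('n)) * t) *
        hopf_power d (real CARD('n) * of_int s * t / (2 * pi))) *s ((C ** \<kappa> B ** matrix_inv C) *v z))"
    by (rule hopf_action.transitive_normal_form[OF _ trans]) (rule that)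
  show "\<exists>(p::int) (q::int) (r::int) (C :: complex^'n^'n). r \<noteq> 0 \<and> invertible C \<and>
             ((\<forall>t::real. \<forall>B\<in>special_unitary_matrices. \<forall>z. z \<noteq> 0 \<longrightarrow>
                 act (mat (cis t) ** B) (hopf_quotient_class d m z) =
                 hopf_quotient_class d m
                   ((cis ((1 + (real_of_int p + real_of_int q / real m) * real CARD('n)) * t) *
                     hopf_power d (real CARD('n) * real_of_int r * t / (2 * pi))) *s
                    ((C ** B ** matrix_inv C) *v z))) \<or>
              (\<forall>t::real. \<forall>B\<in>special_unitary_matrices. \<forall>z. z \<noteq> 0 \<longrightarrow>
                 act (mat (cis t) ** B) (hopf_quotient_class d m z) =
                 hopf_quotient_class d m
                   ((cis ((- 1 + (real_of_int p + real_of_int q / real m) * real CARD('n)) * t) *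
                     hopf_power d (real CARD('n) * real_of_int r * t / (2 * pi))) *s
                    ((C ** map_matrix cnj B ** matrix_inv C) *v z))))"
    using \<kappa>
  proof (elim disjE conjE)
    assume "\<kappa> = (\<lambda>B. B)" "\<sigma> = 1"
    then show ?thesis
      using form s C by (intro exI[of _ p] exI[of _ q] exI[of _ s] exI[of _ C] conjI disjI1 allI ballI impI) simp_all
  next
    assume "\<kappa> = map_matrix cnj" "\<sigma> = - 1"
    then show ?thesis
      using form s C by (intro exI[of _ p] exI[of _ q] exI[of _ s] exI[of _ C] conjI disjI2 allI ballI impI) simp_all
  qed
qed

end
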